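(* The bounded granularity satisfiability problem for global window $L$-PCTL formulae (given a global window formula $\forall G\,\Phi$ and $N\in\mathbb N$, decide whether there exists a Markov chain of granularity bounded by $N$ satisfying $\forall G\,\Phi$) is decidable in time doubly-exponential in both $|\Phi|$ and $N$. Moreover, for every global window formula $\forall G\,\Phi$ that admits a model $C$ (a Markov chain with $C\models\forall G\,\Phi$) of granularity bounded by $N$, there exists a finite Markov chain $C'$ of granularity bounded by $N$ with $C'\models\forall G\,\Phi$.
   Context: A Markov chain (MC) is a tuple $(S,s_{\mathrm{init}},P,AP,L)$ with $S$ a countable set of states, $s_{\mathrm{init}}\in S$, $P:S\to\mathrm{Dist}(S)$, $AP$ a nonempty finite set of atomic propositions, $L:S\to 2^{AP}$; it induces the standard probability measure $\mu$ on infinite paths from each state. An MC has granularity bounded by $N$ if every transition probability equals a rational $a/b$ with $b\le N$. $L$-PCTL: state formulae $\Phi::=p\mid\neg p\mid\Phi_1\wedge\Phi_2\mid\Phi_1\vee\Phi_2\mid\sum_{i=1}^n c_i\mathbb P(\varphi_i)\succcurlyeq c_0$ with $p\in AP$, $n\ge1$, $c_i\in\mathbb Z$, ${\succcurlyeq}\in\{\ge,>\}$; path formulae $\varphi::=X^\ell\Phi\mid\Phi_1U^\ell\Phi_2\mid\Phi_1W^\ell\Phi_2\mid\Phi_1U^\infty\Phi_2\mid\Phi_1W^\infty\Phi_2$, $\ell\in\mathbb N$. An infinite path $s_0s_1\cdots$ satisfies $X^\ell\Phi$ iff $s_\ell\models\Phi$; $\Phi_1U^\ell\Phi_2$ iff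 some $j\le\ell$ has $s_j\models\Phi_2$ and $s_i\models\Phi_1$ for all $i<j$; $\Phi_1W^\ell\Phi_2$ iff for every $j\le\ell$, $s_j\models\Phi_1$ or $s_j\models\Phi_2$ or some $i<j$ has $s_i\models\Phi_2$; $\infty$ versions let $j$ range over $\mathbb N$. A state $s$ satisfies $\sum c_i\mathbb P(\varphi_i)\succcurlyeq c_0$ iff $\sum c_i\,\mu(\{\text{paths from } s\text{ satisfying }\varphi_i\})\succcurlyeq c_0$; atomic and Boolean cases as usual. Constants in binary, horizon labels in unary; $|\Phi|$ is the encoding size. $\Phi$ is a window formula if all horizon labels are finite. A global window formula is $\forall G\,\Phi$ with $\Phi$ a window formula; a state satisfies it iff every state reachable from it satisfies $\Phi$; an MC satisfies it if its initial state does. *)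

theory Defs
  imports "HOL-Probability.Probability" "HOL-Library.Extended_Nat"
begin

section \<open>Markov chains\<close>

record 's mc =
  states :: "'s set"
  init :: 's
  trans_prob :: "'s \<Rightarrow> 's pmf"
  AP :: "nat set"
  label :: "'s \<Rightarrow> nat set"

text \<open>The values of \<open>trans_prob C\<close> and \<open>label C\<close> outside \<open>states C\<close> are irrelevant.\<close>

definition markov_chain :: "'s mc \<Rightarrow> bool" where
  "markov_chain C \<longleftrightarrow>
     countable (states C) \<and> init C \<in> states C \<and>
     (\<forall>s\<in>states C. set_pmf (trans_prob C s) \<subseteq> states C) \<and>
     finite (AP C) \<and> AP C \<noteq> {} \<and>
     (\<forall>s\<in>states C. label C s \<subseteq> AP C)"

definition granularity_le :: "nat \<Rightarrow> 's mc \<Rightarrow> bool" where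
  "granularity_le N C \<longleftrightarrow>
     (\<forall>s\<in>states C. \<forall>t\<in>states C.
        \<exists>a b :: nat. 0 < b \<and> b \<le> N \<and> pmf (trans_prob C s) t = real a / real b)"

definition reachable :: "'s mc \<Rightarrow> 's \<Rightarrow> 's \<Rightarrow> bool" where
  "reachable C s t \<longleftrightarrow> (s, t) \<in> {(u, v). v \<in> set_pmf (trans_prob C u)}\<^sup>*"


section \<open>The measure on infinite paths\<close>

text \<open>
  Paths are functions \<open>nat \<Rightarrow> 's\<close>, with the product of the discrete sigma-algebras. The measure
  is the Ionescu-Tulcea limit of the kernels below; lemma \<open>path_measure_cylinder\<close> shows
  that it has the usual values on the cylinder sets.
\<close>

definition path_kernel :: "('s \<Rightarrow> 's pmf) \<Rightarrow> 's \<Rightarrow> nat \<Rightarrow> (nat \<Rightarrow> 's) \<Rightarrow> 's measure" where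
  "path_kernel K s n \<omega> =
     measure_pmf (case n of 0 \<Rightarrow> return_pmf s | Suc m \<Rightarrow> K (\<omega> m))"

lemma path_kernel_measurable: "path_kernel K s i \<in> measurable (PiM {0..<i} (\<lambda>_. count_space UNIV))
      (subprob_algebra (count_space UNIV))"
proof (cases i)
  case 0
  then show ?thesis
    by (auto simp: path_kernel_def[abs_def] space_subprob_algebra
          intro!: measure_pmf.subprob_space_axioms)
next
  case (Suc m)
  have "(\<lambda>\<omega>. \<omega> m) \<in> measurable (PiM {0..<i} (\<lambda>_. count_space UNIV)) (count_space UNIV)"
    using Suc by (intro measurable_component_singleton) auto
  then show ?thesis
    unfolding path_kernel_def[abs_def] Suc nat.case
    by (rule measurable_compose)
      (auto simp: space_subprob_algebra intro!: measure_pmf.subprob_space_axioms)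
qed

lemma path_kernel_prob: "prob_space (path_kernel K s i x)"
  by (simp add: path_kernel_def measure_pmf.prob_space_axioms)

global_interpretation paths: Ionescu_Tulcea "path_kernel K s" "\<lambda>_. count_space UNIV"
  for K :: "'s \<Rightarrow> 's pmf" and s :: 's
  by (rule Ionescu_Tulcea.intro) (rule path_kernel_measurable, rule path_kernel_prob)

definition path_measure :: "('s \<Rightarrow> 's pmf) \<Rightarrow> 's \<Rightarrow> (nat \<Rightarrow> 's) measure" where
  "path_measure K s = paths.PF.lim K s"

lemma sets_path_measure: "sets (path_measure K s) = sets (PiM UNIV (\<lambda>_. count_space UNIV))"
  by (simp add: path_measure_def paths.PF.sets_lim)

lemma space_path_measure: "space (path_measure K s) = UNIV"
  using sets_eq_imp_space_eq[OF sets_path_measure[of K s]] by (simp add: space_PiM)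

lemma prob_space_path_measure: "prob_space (path_measure K s)"
proof
  have emb: "paths.PF.emb UNIV {} {\<lambda>_. undefined} = UNIV"
    by (auto simp: prod_emb_def space_PiM)
  have "emeasure (paths.PF.lim K s) (paths.PF.emb UNIV {} {\<lambda>_. undefined}) =
      emeasure (paths.CI K s {}) {\<lambda>_. undefined}"
    by (rule paths.lim) (auto simp: space_PiM[symmetric] PiM_empty)
  also have "\<dots> = 1"
    using prob_space.emeasure_space_1[OF paths.PF.prob_space_P[of "{}"]]
    by (simp add: paths.PF.space_P space_PiM)
  finally show "emeasure (path_measure K s) (space (path_measure K s)) = 1"
    unfolding path_measure_def emb space_path_measure[unfolded path_measure_def] .
qed

lemma path_measure_cylinder:
  "measure (path_measure K s) {\<omega>. \<forall>i\<le>n. \<omega> i = w i} =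
     (if w 0 = s then \<Prod>i<n. pmf (K (w i)) (w (Suc i)) else 0)"
proof -
  let ?M = "\<lambda>_::nat. count_space UNIV :: 'a measure"
  define W where "W m = {restrict w {0..<m}}" for m
  define k where "k m = (case m of 0 \<Rightarrow> return_pmf s | Suc j \<Rightarrow> K (w j))" for m
  have W: "W m \<in> sets (PiM {0..<m} ?M)" for m
  proof -
    have "PiE {0..<m} (\<lambda>i. {w i}) = PiE {0..<m} (\<lambda>i. {restrict w {0..<m} i})"
      by (intro PiE_cong) simp
    then have "W m = PiE {0..<m} (\<lambda>i. {w i})"
      by (simp only: W_def PiE_singleton[OF restrict_extensional])
    then show ?thesis by (auto intro!: sets_PiM_I_finite)
  qed
  have u: "(\<lambda>_. undefined) \<in> space (PiM {0..<0} ?M)" by (simp add: space_PiM)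
  have C: "emeasure (paths.C K s 0 m (\<lambda>_. undefined)) (W m) = ennreal (\<Prod>i<m. pmf (k i) (w i))"
    for m
  proof (induction m)
    case 0
    have "W 0 = {\<lambda>_. undefined}" by (simp add: W_def restrict_def)
    then show ?case using W[of 0] by simp
  next
    case (Suc m)
    have eP: "emeasure (paths.eP K s m x) (W (Suc m)) =
        ennreal (pmf (k m) (w m)) * indicator (W m) x"
      if x: "x \<in> space (PiM {0..<m} ?M)" for x
    proof -
      have upd: "x(m := y) = restrict w {0..<Suc m} \<longleftrightarrow> x = restrict w {0..<m} \<and> y = w m" for y
        using x by (auto simp: fun_eq_iff space_PiM PiE_def extensional_def)
      have upd_set: "{y. x(m := y) = restrict w {0..<Suc m}} =
          (if x = restrict w {0..<m} then {w m} else {})"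
        unfolding upd by auto
      have "emeasure (paths.eP K s m x) (W (Suc m)) =
          emeasure (path_kernel K s m x) {y. x(m := y) = restrict w {0..<Suc m}}"
        using paths.emeasure_eP[OF x W] by (simp add: W_def vimage_def)
      also have "\<dots> = ennreal (pmf (k m) (w m)) * indicator (W m) x"
      proof (cases "x = restrict w {0..<m}")
        case True
        then have "path_kernel K s m x = measure_pmf (k m)"
          by (auto simp: path_kernel_def k_def split: nat.split)
        with True show ?thesis unfolding upd_set by (simp add: W_def emeasure_pmf_single)
      next
        case False
        then show ?thesis unfolding upd_set by (simp add: W_def)
      qed
      finally show ?thesis .
    qed
    have eP_meas: "paths.eP K s m \<in> measurable (paths.C K s 0 m (\<lambda>_. undefined))
        (subprob_algebra (PiM {0..<Suc m} ?M))"
      unfolding measurable_cong_sets[OF paths.sets_C[OF u, of K s m] refl] add_0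
      by (rule paths.measurable_eP)
    have "emeasure (paths.C K s 0 (Suc m) (\<lambda>_. undefined)) (W (Suc m)) =
        (\<integral>\<^sup>+x. emeasure (paths.eP K s m x) (W (Suc m)) \<partial>paths.C K s 0 m (\<lambda>_. undefined))"
      using emeasure_bind[OF _ eP_meas W[of "Suc m"]] paths.space_C[OF u, of K s m]
      by (simp add: space_PiM PiE_eq_empty_iff)
    also have "\<dots> = (\<integral>\<^sup>+x. ennreal (pmf (k m) (w m)) * indicator (W m) x
        \<partial>paths.C K s 0 m (\<lambda>_. undefined))"
      using paths.space_C[OF u, of K s m] by (intro nn_integral_cong eP) simp
    also have "\<dots> = ennreal (pmf (k m) (w m)) * ennreal (\<Prod>i<m. pmf (k i) (w i))"
      using W[of m] paths.sets_C[OF u, of K s m] Suc.IH by (simp add: nn_integral_cmult_indicator)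
    finally show ?case by (simp add: ennreal_mult[symmetric] mult.commute prod_nonneg)
  qed
  have "emeasure (path_measure K s) {\<omega>. \<forall>i\<le>n. \<omega> i = w i} =
      emeasure (paths.PF.lim K s) (paths.PF.emb UNIV {0..<Suc n} (W (Suc n)))"
    unfolding path_measure_def
    by (rule arg_cong[where f="emeasure _"])
      (auto simp: prod_emb_def W_def space_PiM fun_eq_iff restrict_def less_Suc_eq_le split: if_splits)
  also have "\<dots> = emeasure (paths.CI K s {0..<Suc n}) (W (Suc n))"
    by (intro paths.lim W) simp
  also have "\<dots> = emeasure (paths.C K s 0 (Suc n) (\<lambda>_. undefined)) (W (Suc n))"
    using paths.emeasure_CI[OF order_refl W[of "Suc n"], of K s]
      prod_emb_id[OF sets.sets_into_space[OF W[of "Suc n"], unfolded space_PiM]]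
    by simp
  also have "\<dots> = ennreal (\<Prod>i<Suc n. pmf (k i) (w i))" by (rule C)
  finally have "measure (path_measure K s) {\<omega>. \<forall>i\<le>n. \<omega> i = w i} = (\<Prod>i<Suc n. pmf (k i) (w i))"
    by (simp add: measure_def prod_nonneg)
  also have "\<dots> = pmf (return_pmf s) (w 0) * (\<Prod>i<n. pmf (K (w i)) (w (Suc i)))"
    by (simp add: prod.lessThan_Suc_shift k_def del: prod.lessThan_Suc)
  finally show ?thesis by (simp add: indicator_def)
qed


section \<open>L-PCTL\<close>

text \<open>Atomic propositions are natural numbers. The bound of a path operator is finite or \<open>\<infinity>\<close>.\<close>

datatype cmp = Ge | Gt

datatype sform =
    Prop nat
  | NProp nat
  | And sform sform
  | Or sform sform
  | Lin "(int \<times> pform) list" cmp int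
and pform =
    Next nat sform
  | Until enat sform sform
  | WUntil enat sform sform

fun cmp_holds :: "cmp \<Rightarrow> real \<Rightarrow> real \<Rightarrow> bool" where
  "cmp_holds Ge x y \<longleftrightarrow> x \<ge> y"
| "cmp_holds Gt x y \<longleftrightarrow> x > y"

fun sat :: "'s mc \<Rightarrow> 's \<Rightarrow> sform \<Rightarrow> bool"
and path_sat :: "'s mc \<Rightarrow> (nat \<Rightarrow> 's) \<Rightarrow> pform \<Rightarrow> bool" where
  "sat C s (Prop a) \<longleftrightarrow> a \<in> label C s"
| "sat C s (NProp a) \<longleftrightarrow> a \<notin> label C s"
| "sat C s (And \<Phi> \<Psi>) \<longleftrightarrow> sat C s \<Phi> \<and> sat C s \<Psi>"
| "sat C s (Or \<Phi> \<Psi>) \<longleftrightarrow> sat C s \<Phi> \<or> sat C s \<Psi>"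
| "sat C s (Lin ts r c0) \<longleftrightarrow>
     cmp_holds r
       (\<Sum>(c, \<phi>)\<leftarrow>ts. of_int c * measure (path_measure (trans_prob C) s) {\<omega>. path_sat C \<omega> \<phi>})
       (of_int c0)"
| "path_sat C \<omega> (Next l \<Phi>) \<longleftrightarrow> sat C (\<omega> l) \<Phi>"
| "path_sat C \<omega> (Until l \<Phi> \<Psi>) \<longleftrightarrow>
     (\<exists>j. enat j \<le> l \<and> sat C (\<omega> j) \<Psi> \<and> (\<forall>i<j. sat C (\<omega> i) \<Phi>))"
| "path_sat C \<omega> (WUntil l \<Phi> \<Psi>) \<longleftrightarrow>
     (\<forall>j. enat j \<le> l \<longrightarrow> sat C (\<omega> j) \<Phi> \<or> sat C (\<omega> j) \<Psi> \<or> (\<exists>i<j. sat C (\<omega> i) \<Psi>))"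

lemma path_sat_measurable:
  "{\<omega>. path_sat C \<omega> \<phi>} \<in> sets (path_measure K s)"
proof -
  note [measurable_cong] = sets_path_measure[of K s]
  have [measurable]: "Measurable.pred (path_measure K s) (\<lambda>\<omega>. sat C (\<omega> j) \<Phi>)" for j \<Phi>
    by (rule measurable_compose[of "\<lambda>\<omega>. \<omega> j" _ "count_space UNIV"]) measurable
  have "Measurable.pred (path_measure K s) (\<lambda>\<omega>. path_sat C \<omega> \<phi>)"
    by (cases \<phi>) simp_all
  then show ?thesis by (simp add: pred_def space_path_measure)
qed

fun atoms :: "sform \<Rightarrow> nat set"
and path_atoms :: "pform \<Rightarrow> nat set" where
  "atoms (Prop a) = {a}"
| "atoms (NProp a) = {a}"
| "atoms (And \<Phi> \<Psi>) = atoms \<Phi> \<union> atoms \<Psi>"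
| "atoms (Or \<Phi> \<Psi>) = atoms \<Phi> \<union> atoms \<Psi>"
| "atoms (Lin ts r c0) = (\<Union>(c, \<phi>)\<in>set ts. path_atoms \<phi>)"
| "path_atoms (Next l \<Phi>) = atoms \<Phi>"
| "path_atoms (Until l \<Phi> \<Psi>) = atoms \<Phi> \<union> atoms \<Psi>"
| "path_atoms (WUntil l \<Phi> \<Psi>) = atoms \<Phi> \<union> atoms \<Psi>"

text \<open>The type also contains linear constraints without summands, which the grammar excludes.\<close>

fun wf_form :: "sform \<Rightarrow> bool"
and wf_path :: "pform \<Rightarrow> bool" where
  "wf_form (Prop a) \<longleftrightarrow> True"
| "wf_form (NProp a) \<longleftrightarrow> True"
| "wf_form (And \<Phi> \<Psi>) \<longleftrightarrow> wf_form \<Phi> \<and> wf_form \<Psi>"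
| "wf_form (Or \<Phi> \<Psi>) \<longleftrightarrow> wf_form \<Phi> \<and> wf_form \<Psi>"
| "wf_form (Lin ts r c0) \<longleftrightarrow> ts \<noteq> [] \<and> (\<forall>(c, \<phi>)\<in>set ts. wf_path \<phi>)"
| "wf_path (Next l \<Phi>) \<longleftrightarrow> wf_form \<Phi>"
| "wf_path (Until l \<Phi> \<Psi>) \<longleftrightarrow> wf_form \<Phi> \<and> wf_form \<Psi>"
| "wf_path (WUntil l \<Phi> \<Psi>) \<longleftrightarrow> wf_form \<Phi> \<and> wf_form \<Psi>"

fun finite_horizons :: "sform \<Rightarrow> bool"
and finite_horizons_path :: "pform \<Rightarrow> bool" where
  "finite_horizons (Prop a) \<longleftrightarrow> True"
| "finite_horizons (NProp a) \<longleftrightarrow> True"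
| "finite_horizons (And \<Phi> \<Psi>) \<longleftrightarrow> finite_horizons \<Phi> \<and> finite_horizons \<Psi>"
| "finite_horizons (Or \<Phi> \<Psi>) \<longleftrightarrow> finite_horizons \<Phi> \<and> finite_horizons \<Psi>"
| "finite_horizons (Lin ts r c0) \<longleftrightarrow> (\<forall>(c, \<phi>)\<in>set ts. finite_horizons_path \<phi>)"
| "finite_horizons_path (Next l \<Phi>) \<longleftrightarrow> finite_horizons \<Phi>"
| "finite_horizons_path (Until l \<Phi> \<Psi>) \<longleftrightarrow> l \<noteq> \<infinity> \<and> finite_horizons \<Phi> \<and> finite_horizons \<Psi>"
| "finite_horizons_path (WUntil l \<Phi> \<Psi>) \<longleftrightarrow> l \<noteq> \<infinity> \<and> finite_horizons \<Phi> \<and> finite_horizons \<Psi>"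

definition window_formula :: "sform \<Rightarrow> bool" where
  "window_formula \<Phi> \<longleftrightarrow> wf_form \<Phi> \<and> finite_horizons \<Phi>"

datatype gform = AG sform

fun global_window_formula :: "gform \<Rightarrow> bool" where
  "global_window_formula (AG \<Phi>) \<longleftrightarrow> window_formula \<Phi>"

fun gsat :: "'s mc \<Rightarrow> 's \<Rightarrow> gform \<Rightarrow> bool" where
  "gsat C s (AG \<Phi>) \<longleftrightarrow> (\<forall>t. reachable C s t \<longrightarrow> sat C t \<Phi>)"

text \<open>A formula is interpreted over chains whose set of propositions contains its atoms.\<close>

fun is_model :: "'s mc \<Rightarrow> gform \<Rightarrow> bool" where
  "is_model C (AG \<Phi>) \<longleftrightarrow> markov_chain C \<and> atoms \<Phi> \<subseteq> AP C \<and> gsat C (init C) (AG \<Phi>)"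


section \<open>Deciding within a time bound\<close>

text \<open>
  The machine model is first-order pure Lisp: a program is a list of mutually recursive unary
  functions on binary trees, evaluated by value, and its running time is the number of
  evaluation steps. No primitive operation looks below the children of a node, so with shared
  cells each step takes a bounded number of pointer operations. Hence running times agree with
  those of Turing machines up to a polynomial, and doubly exponential time is the same for both.
\<close>

datatype sexp = Atom | Dot sexp sexp

datatype expr =
    Param
  | NilE
  | ConsE expr expr
  | CarE expr
  | CdrE expr
  | IfE expr expr expr
  | Call nat expr

type_synonym program = "expr list"

fun car :: "sexp \<Rightarrow> sexp" where
  "car Atom = Atom"
| "car (Dot l r) = l"

fun cdr :: "sexp \<Rightarrow> sexp" where
  "cdr Atom = Atom"
| "cdr (Dot l r) = r"

text \<open>\<open>evaluates p x e v t\<close>: with argument \<open>x\<close>, expression \<open>e\<close> has value \<open>v\<close>, found in \<open>t\<close> steps.\<close>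

inductive evaluates :: "program \<Rightarrow> sexp \<Rightarrow> expr \<Rightarrow> sexp \<Rightarrow> nat \<Rightarrow> bool" for p :: program where
  "evaluates p x Param x 1"
| "evaluates p x NilE Atom 1"
| "evaluates p x e1 v1 t1 \<Longrightarrow> evaluates p x e2 v2 t2 \<Longrightarrow>
     evaluates p x (ConsE e1 e2) (Dot v1 v2) (t1 + t2 + 1)"
| "evaluates p x e v t \<Longrightarrow> evaluates p x (CarE e) (car v) (t + 1)"
| "evaluates p x e v t \<Longrightarrow> evaluates p x (CdrE e) (cdr v) (t + 1)"
| "evaluates p x e1 v1 t1 \<Longrightarrow> v1 \<noteq> Atom \<Longrightarrow> evaluates p x e2 v2 t2 \<Longrightarrow>
     evaluates p x (IfE e1 e2 e3) v2 (t1 + t2 + 1)"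
| "evaluates p x e1 Atom t1 \<Longrightarrow> evaluates p x e3 v3 t3 \<Longrightarrow>
     evaluates p x (IfE e1 e2 e3) v3 (t1 + t3 + 1)"
| "evaluates p x e y t1 \<Longrightarrow> f < length p \<Longrightarrow> evaluates p y (p ! f) v t2 \<Longrightarrow>
     evaluates p x (Call f e) v (t1 + t2 + 1)"

lemma evaluates_deterministic:
  "evaluates p x e v t \<Longrightarrow> evaluates p x e v' t' \<Longrightarrow> v = v' \<and> t = t'"
proof (induction arbitrary: v' t' rule: evaluates.induct)
  case (1 x) from 1 show ?case by cases auto
next
  case (2 x) from 2 show ?case by cases auto
next
  case (3 x e1 v1 t1 e2 v2 t2) from 3(5) show ?case by cases (use 3 in blast)
next
  case (4 x e v t) from 4(3) show ?case by cases (use 4 in blast)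
next
  case (5 x e v t) from 5(3) show ?case by cases (use 5 in blast)
next
  case (6 x e1 v1 t1 e2 v2 t2 e3) from 6(6) show ?case by cases (use 6 in blast)+
next
  case (7 x e1 t1 e3 v3 t3 e2) from 7(5) show ?case by cases (use 7 in blast)+
next
  case (8 x e y t1 f v t2) from 8(6) show ?case by cases (use 8 in blast)
qed

text \<open>On every input in \<open>I\<close> the program halts in time; its answer is yes iff the value is not \<open>Atom\<close>.\<close>

definition decides_within ::
  "program \<Rightarrow> ('i \<Rightarrow> sexp) \<Rightarrow> 'i set \<Rightarrow> ('i \<Rightarrow> bool) \<Rightarrow> ('i \<Rightarrow> nat) \<Rightarrow> bool" where
  "decides_within p enc I Q T \<longleftrightarrow>
     (\<forall>i\<in>I. \<exists>v t. evaluates p (enc i) (Call 0 Param) v t \<and> t \<le> T i \<and> (v \<noteq> Atom \<longleftrightarrow> Q i))"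


section \<open>Encoding of the inputs\<close>

text \<open>Numbers are lists of bits, least significant first and without leading zeros.\<close>

fun nat_bits :: "nat \<Rightarrow> bool list" where
  "nat_bits n = (if n = 0 then [] else odd n # nat_bits (n div 2))"

declare nat_bits.simps [simp del]

fun enc_list :: "sexp list \<Rightarrow> sexp" where
  "enc_list [] = Atom"
| "enc_list (x # xs) = Dot x (enc_list xs)"

definition enc_bool :: "bool \<Rightarrow> sexp" where
  "enc_bool b = (if b then Dot Atom Atom else Atom)"

definition enc_unary :: "nat \<Rightarrow> sexp" where
  "enc_unary n = enc_list (replicate n Atom)"

definition enc_nat :: "nat \<Rightarrow> sexp" where
  "enc_nat n = enc_list (map enc_bool (nat_bits n))"

definition enc_int :: "int \<Rightarrow> sexp" where
  "enc_int z = Dot (enc_bool (z < 0)) (enc_nat (nat \<bar>z\<bar>))"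

fun enc_horizon :: "enat \<Rightarrow> sexp" where
  "enc_horizon l = (case l of enat n \<Rightarrow> Dot Atom (enc_unary n) | \<infinity> \<Rightarrow> Atom)"

fun enc_cmp :: "cmp \<Rightarrow> sexp" where
  "enc_cmp Ge = enc_bool False"
| "enc_cmp Gt = enc_bool True"

fun enc_sform :: "sform \<Rightarrow> sexp"
and enc_pform :: "pform \<Rightarrow> sexp" where
  "enc_sform (Prop a) = Dot (enc_unary 0) (enc_nat a)"
| "enc_sform (NProp a) = Dot (enc_unary 1) (enc_nat a)"
| "enc_sform (And \<Phi> \<Psi>) = Dot (enc_unary 2) (Dot (enc_sform \<Phi>) (enc_sform \<Psi>))"
| "enc_sform (Or \<Phi> \<Psi>) = Dot (enc_unary 3) (Dot (enc_sform \<Phi>) (enc_sform \<Psi>))"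
| "enc_sform (Lin ts r c0) =
     Dot (enc_unary 4)
       (Dot (enc_list (map (\<lambda>(c, \<phi>). Dot (enc_int c) (enc_pform \<phi>)) ts))
         (Dot (enc_cmp r) (enc_int c0)))"
| "enc_pform (Next l \<Phi>) = Dot (enc_unary 0) (Dot (enc_unary l) (enc_sform \<Phi>))"
| "enc_pform (Until l \<Phi> \<Psi>) =
     Dot (enc_unary 1) (Dot (enc_horizon l) (Dot (enc_sform \<Phi>) (enc_sform \<Psi>)))"
| "enc_pform (WUntil l \<Phi> \<Psi>) =
     Dot (enc_unary 2) (Dot (enc_horizon l) (Dot (enc_sform \<Phi>) (enc_sform \<Psi>)))"

fun enc_instance :: "gform \<times> nat \<Rightarrow> sexp" where
  "enc_instance (AG \<Phi>, N) = Dot (enc_sform \<Phi>) (enc_nat N)"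

fun nodes :: "sexp \<Rightarrow> nat" where
  "nodes Atom = 1"
| "nodes (Dot l r) = nodes l + nodes r + 1"

fun formula_size :: "gform \<Rightarrow> nat" where
  "formula_size (AG \<Phi>) = nodes (enc_sform \<Phi>)"

lemma inj_enc_list: "enc_list xs = enc_list ys \<longleftrightarrow> xs = ys"
proof (induction xs arbitrary: ys)
  case Nil
  then show ?case by (cases ys) auto
next
  case (Cons x xs)
  then show ?case by (cases ys) auto
qed

lemma inj_enc_bool: "enc_bool a = enc_bool b \<longleftrightarrow> a = b"
  by (simp add: enc_bool_def)

lemma inj_enc_unary: "enc_unary m = enc_unary n \<longleftrightarrow> m = n"
  by (auto simp: enc_unary_def inj_enc_list)

lemma inj_nat_bits: "nat_bits m = nat_bits n \<longleftrightarrow> m = n"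
proof (induction m arbitrary: n rule: less_induct)
  case (less m)
  show ?case
  proof (cases "m = 0 \<or> n = 0")
    case True
    then show ?thesis by (auto simp: nat_bits.simps[of m] nat_bits.simps[of n])
  next
    case False
    then have "nat_bits m = nat_bits n \<longleftrightarrow> odd m = odd n \<and> m div 2 = n div 2"
      using less[of "m div 2" "n div 2"] by (auto simp: nat_bits.simps[of m] nat_bits.simps[of n])
    also have "\<dots> \<longleftrightarrow> m = n" by presburger
    finally show ?thesis .
  qed
qed

lemma inj_enc_nat: "enc_nat m = enc_nat n \<longleftrightarrow> m = n"
  by (simp add: enc_nat_def inj_enc_list inj_nat_bits inj_map_eq_map inj_def inj_enc_bool)

lemma inj_enc_int: "enc_int a = enc_int b \<longleftrightarrow> a = b"
  by (auto simp: enc_int_def inj_enc_nat inj_enc_bool)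

lemma inj_enc_horizon: "enc_horizon k = enc_horizon l \<longleftrightarrow> k = l"
  by (auto simp: inj_enc_unary split: enat.splits)

lemma inj_enc_cmp: "enc_cmp r = enc_cmp q \<longleftrightarrow> r = q"
  by (cases r; cases q) (auto simp: inj_enc_bool)

lemma
  inj_enc_sform: "enc_sform \<Phi> = enc_sform \<Psi> \<longleftrightarrow> \<Phi> = \<Psi>" and
  inj_enc_pform: "enc_pform \<phi> = enc_pform \<psi> \<longleftrightarrow> \<phi> = \<psi>"
proof (induction \<Phi> and \<phi> arbitrary: \<Psi> and \<psi> rule: enc_sform_enc_pform.induct)
  case (5 ts r c0)
  have IH: "enc_pform \<phi> = enc_pform \<psi> \<longleftrightarrow> \<phi> = \<psi>" if "(c, \<phi>) \<in> set ts" for c \<phi> \<psi>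
    using 5[OF that refl] .
  show ?case
  proof (cases \<Psi>)
    case (Lin us q d0)
    have "map (\<lambda>(c, \<phi>). Dot (enc_int c) (enc_pform \<phi>)) ts =
        map (\<lambda>(c, \<phi>). Dot (enc_int c) (enc_pform \<phi>)) us \<longleftrightarrow> ts = us"
      using IH
    proof (induction ts arbitrary: us)
      case Nil
      then show ?case by auto
    next
      case (Cons x ts)
      obtain c \<phi> where x: "x = (c, \<phi>)" by (cases x)
      have hd: "enc_pform \<phi> = enc_pform \<psi> \<longleftrightarrow> \<phi> = \<psi>" for \<psi>
        using Cons.prems[of c \<phi>] by (simp add: x)
      have tl: "map (\<lambda>(c, \<phi>). Dot (enc_int c) (enc_pform \<phi>)) ts =
          map (\<lambda>(c, \<phi>). Dot (enc_int c) (enc_pform \<phi>)) us \<longleftrightarrow> ts = us" for us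
        by (rule Cons.IH) (use Cons.prems in auto)
      show ?case
        by (cases us) (auto simp: x hd tl inj_enc_int)
    qed
    then show ?thesis by (simp add: Lin inj_enc_list inj_enc_int inj_enc_cmp)
  qed (simp_all add: inj_enc_unary)
next
  case (1 a) then show ?case by (cases \<Psi>) (simp_all add: inj_enc_unary inj_enc_nat)
next
  case (2 a) then show ?case by (cases \<Psi>) (simp_all add: inj_enc_unary inj_enc_nat)
next
  case (3 a b) then show ?case by (cases \<Psi>) (simp_all add: inj_enc_unary)
next
  case (4 a b) then show ?case by (cases \<Psi>) (simp_all add: inj_enc_unary)
next
  case (6 l a) then show ?case by (cases \<psi>) (simp_all add: inj_enc_unary)
next
  case (7 l a b) then show ?case
    by (cases \<psi>) (simp_all add: inj_enc_unary inj_enc_horizon del: enc_horizon.simps)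
next
  case (8 l a b) then show ?case
    by (cases \<psi>) (simp_all add: inj_enc_unary inj_enc_horizon del: enc_horizon.simps)
qed

lemma inj_enc_instance: "inj enc_instance"
proof (rule injI)
  fix x y :: "gform \<times> nat"
  assume "enc_instance x = enc_instance y"
  then show "x = y"
    by (cases x rule: enc_instance.cases; cases y rule: enc_instance.cases)
      (simp add: inj_enc_sform inj_enc_nat)
qed

end

theory Submission
  imports Defs
begin

text \<open>
  Whether a state satisfies a window formula depends only on its labels and on finitely many
  probabilities, those of the path formulas occurring in it and of their versions with smaller
  horizon. With granularity \<open>N\<close> each of these is a multiple of \<open>1 / N!\<^sup>h\<close>, \<open>h\<close> being the
  horizon, so there are only exponentially many types of states. Choosing one reachable
  representative for each type and redirecting its transitions to representatives gives a finite
  model of exponential size. Such a model, written as a matrix, is a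
  certificate of exponential size that can be checked in exponential time, and trying all
  certificates takes doubly exponential time.
\<close>

section \<open>One-step recursion for the probability of a path formula\<close>

text \<open>The factorial is there because every denominator up to \<open>N\<close> divides
  \<open>N!\<close>; types therefore compare exact numbers and no approximation enters. Redirecting
  a transition is harmless because the recursion for a path formula sees a successor only through
  its probability of the same formula with horizon one less. This is why the shortened versions must
  be part of the type.

  Representatives are chosen among reachable states, so the formula holds at every state of the
  small model, and the checker can test all states instead of computing reachability. The program
  has no numbers but unary ones. This is affordable because a certificate is already exponential,
  and a probability multiplied by \<open>D ^ h\<close> is a natural number of at most exponential
  size; the scaling also removes every division. The time bound is in terms of \<open>N\<close>
  itself, not of its binary length, so \<open>N\<close> may be unfolded to unary. All sizes and
  times are finally expressed in the single parameter \<open>u = n + N\<close>, where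
  \<open>n\<close> is the size of the formula.\<close>

fun prefix_pmf :: "('s \<Rightarrow> 's pmf) \<Rightarrow> nat \<Rightarrow> 's \<Rightarrow> 's list pmf" where
  "prefix_pmf K 0 s = return_pmf [s]"
| "prefix_pmf K (Suc n) s = map_pmf ((#) s) (K s \<bind> prefix_pmf K n)"

lemma prefix_pmf_support: "xs \<in> set_pmf (prefix_pmf K n s) \<Longrightarrow> length xs = Suc n \<and> hd xs = s"
  by (induction n arbitrary: s xs) auto

lemma pmf_prefix_pmf:
  "length xs = Suc n \<Longrightarrow> pmf (prefix_pmf K n s) xs =
     (if xs ! 0 = s then \<Prod>i<n. pmf (K (xs ! i)) (xs ! Suc i) else 0)"
proof (induction n arbitrary: s xs)
  case 0
  then show ?case by (cases xs) auto
next
  case (Suc n)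
  then obtain y ys where xs: "xs = y # ys" and ys: "length ys = Suc n" by (cases xs) auto
  have "pmf (prefix_pmf K (Suc n) s) xs = (if y = s then pmf (K s \<bind> prefix_pmf K n) ys else 0)"
  proof (cases "y = s")
    case True
    then show ?thesis by (simp add: xs pmf_map_inj')
  next
    case False
    then show ?thesis by (auto simp: xs pmf_eq_0_set_pmf)
  qed
  also have "pmf (K s \<bind> prefix_pmf K n) ys =
      measure_pmf.expectation (K s) (\<lambda>t. pmf (prefix_pmf K n t) ys)"
    by (simp add: pmf_bind)
  also have "\<dots> = measure_pmf.expectation (K s)
      (\<lambda>t. (\<Prod>i<n. pmf (K (ys ! i)) (ys ! Suc i)) * indicator {ys ! 0} t)"
    by (intro integral_cong_AE) (auto simp: Suc.IH[OF ys] AE_measure_pmf_iff)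
  also have "\<dots> = (\<Prod>i<n. pmf (K (ys ! i)) (ys ! Suc i)) * pmf (K s) (ys ! 0)"
    by (simp add: measure_pmf_single)
  finally show ?case
    by (simp add: xs prod.lessThan_Suc_shift del: prod.lessThan_Suc)
qed

text \<open>The state type may be uncountable, so the event need not be a countable union of
  cylinders. Only the cylinders over the support of \<open>prefix_pmf\<close> are summed, which
  gives one inequality; the same inequality for the complement forces equality, since both measures
  have total mass 1.\<close>

lemma measure_path_prefix:
  fixes Q :: "(nat \<Rightarrow> 's) \<Rightarrow> bool"
  assumes Q: "{\<omega>. Q \<omega>} \<in> sets (path_measure K s)"
    and local: "\<And>\<omega> \<omega>'. (\<And>i. i \<le> n \<Longrightarrow> \<omega> i = \<omega>' i) \<Longrightarrow> Q \<omega> = Q \<omega>'"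
  shows "measure (path_measure K s) {\<omega>. Q \<omega>} = measure (prefix_pmf K n s) {xs. Q (nth xs)}"
proof -
  interpret P: prob_space "path_measure K s" by (rule prob_space_path_measure)
  let ?p = "prefix_pmf K n s"
  note [measurable_cong] = sets_path_measure[of K s]
  define cyl where "cyl xs = {\<omega>. \<forall>i\<le>n. \<omega> i = xs ! i}" for xs :: "'s list"
  have cyl_sets: "cyl xs \<in> sets (path_measure K s)" for xs
  proof -
    have [measurable]: "Measurable.pred (path_measure K s) (\<lambda>\<omega>. \<omega> i = xs ! i)" for i
      by (rule measurable_compose[of "\<lambda>\<omega>. \<omega> i" _ "count_space UNIV"]) measurable
    have "Measurable.pred (path_measure K s) (\<lambda>\<omega>. \<forall>i\<le>n. \<omega> i = xs ! i)" by measurable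
    then show ?thesis by (simp add: pred_def space_path_measure cyl_def)
  qed
  have lower: "measure ?p {xs. R (nth xs)} \<le> measure (path_measure K s) {\<omega>. R \<omega>}"
    if R: "{\<omega>. R \<omega>} \<in> sets (path_measure K s)"
      and loc: "\<And>\<omega> \<omega>'. (\<And>i. i \<le> n \<Longrightarrow> \<omega> i = \<omega>' i) \<Longrightarrow> R \<omega> = R \<omega>'" for R
  proof -
    define A where "A = set_pmf ?p \<inter> {xs. R (nth xs)}"
    have A: "countable A" by (auto simp: A_def)
    have "emeasure ?p {xs. R (nth xs)} = emeasure ?p A"
      by (subst emeasure_Int_set_pmf[symmetric]) (simp add: A_def Int_commute)
    also have "\<dots> = (\<integral>\<^sup>+xs. emeasure ?p {xs} \<partial>count_space A)"
      using A by (intro emeasure_countable_singleton) auto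
    also have "\<dots> = (\<integral>\<^sup>+xs. emeasure (path_measure K s) (cyl xs) \<partial>count_space A)"
    proof (rule nn_integral_cong)
      fix xs assume "xs \<in> space (count_space A)"
      then have "length xs = Suc n" by (auto simp: A_def prefix_pmf_support)
      then show "emeasure ?p {xs} = emeasure (path_measure K s) (cyl xs)"
        by (simp add: emeasure_pmf_single pmf_prefix_pmf P.emeasure_eq_measure cyl_def
            path_measure_cylinder)
    qed
    also have "\<dots> = emeasure (path_measure K s) (\<Union>xs\<in>A. cyl xs)"
    proof (rule emeasure_UN_countable[symmetric])
      show "disjoint_family_on cyl A"
      proof (clarsimp simp: disjoint_family_on_def)
        fix xs ys assume "xs \<in> A" "ys \<in> A" "xs \<noteq> ys"
        moreover from this have "length xs = Suc n" "length ys = Suc n"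
          by (auto simp: A_def prefix_pmf_support)
        ultimately obtain i where "i \<le> n" "xs ! i \<noteq> ys ! i"
          by (metis nth_equalityI less_Suc_eq_le)
        then show "cyl xs \<inter> cyl ys = {}" by (auto simp: cyl_def)
      qed
    qed (use A cyl_sets in auto)
    also have "\<dots> \<le> emeasure (path_measure K s) {\<omega>. R \<omega>}"
    proof (rule emeasure_mono[OF _ R], clarsimp)
      fix \<omega> xs assume "xs \<in> A" "\<omega> \<in> cyl xs"
      then show "R \<omega>" using loc[of \<omega> "nth xs"] by (auto simp: A_def cyl_def)
    qed
    finally show ?thesis
      by (simp add: measure_pmf.emeasure_eq_measure P.emeasure_eq_measure)
  qed
  have "measure ?p {xs. \<not> Q (nth xs)} \<le> measure (path_measure K s) {\<omega>. \<not> Q \<omega>}"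
  proof (rule lower)
    have "space (path_measure K s) - {\<omega>. Q \<omega>} \<in> sets (path_measure K s)" using Q by auto
    then show "{\<omega>. \<not> Q \<omega>} \<in> sets (path_measure K s)"
      by (simp add: space_path_measure Compl_eq_Diff_UNIV[symmetric] Collect_neg_eq)
    show "(\<not> Q \<omega>) = (\<not> Q \<omega>')" if "\<And>i. i \<le> n \<Longrightarrow> \<omega> i = \<omega>' i" for \<omega> \<omega>'
      using local[OF that] by simp
  qed
  moreover have "measure (path_measure K s) {\<omega>. \<not> Q \<omega>} = 1 - measure (path_measure K s) {\<omega>. Q \<omega>}"
    using P.prob_compl[OF Q] by (simp add: space_path_measure Collect_neg_eq Compl_eq_Diff_UNIV)
  moreover have "measure ?p {xs. \<not> Q (nth xs)} = 1 - measure ?p {xs. Q (nth xs)}"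
    using measure_pmf.prob_compl[of "{xs. Q (nth xs)}" ?p]
    by (simp add: Collect_neg_eq Compl_eq_Diff_UNIV)
  ultimately show ?thesis using lower[of Q] Q local by (smt (verit))
qed

section \<open>Expansion laws for path formulas with finite horizon\<close>

fun bound :: "pform \<Rightarrow> nat" where
  "bound (Next l \<Phi>) = l"
| "bound (Until l \<Phi> \<Psi>) = the_enat l"
| "bound (WUntil l \<Phi> \<Psi>) = the_enat l"

text \<open>\<open>verdict S \<phi>\<close> is what the first state of a path settles about \<open>\<phi>\<close>; if it settles nothing, the
  rest of the path has to satisfy \<open>residual \<phi>\<close>.\<close>

fun verdict :: "(sform \<Rightarrow> bool) \<Rightarrow> pform \<Rightarrow> bool option" where
  "verdict S (Next l \<Phi>) = (if l = 0 then Some (S \<Phi>) else None)"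
| "verdict S (Until l \<Phi> \<Psi>) =
     (if S \<Psi> then Some True else if \<not> S \<Phi> \<or> l = 0 then Some False else None)"
| "verdict S (WUntil l \<Phi> \<Psi>) =
     (if S \<Psi> then Some True else if \<not> S \<Phi> then Some False else if l = 0 then Some True else None)"

fun residual :: "pform \<Rightarrow> pform" where
  "residual (Next l \<Phi>) = Next (l - 1) \<Phi>"
| "residual (Until l \<Phi> \<Psi>) = Until (l - 1) \<Phi> \<Psi>"
| "residual (WUntil l \<Phi> \<Psi>) = WUntil (l - 1) \<Phi> \<Psi>"

lemma ex_le_Suc2: "(\<exists>j\<le>Suc n. P j) \<longleftrightarrow> P 0 \<or> (\<exists>j\<le>n. P (Suc j))"
  by (metis Suc_le_mono bot_nat_0.extremum not0_implies_Suc)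

lemma all_le_Suc2: "(\<forall>j\<le>Suc n. P j) \<longleftrightarrow> P 0 \<and> (\<forall>j\<le>n. P (Suc j))"
  by (metis Suc_le_mono bot_nat_0.extremum not0_implies_Suc)

text \<open>The expansion laws of the temporal operators. In the weak until, \<Psi> at position 0
  settles all later positions, being the earlier witness that their clause asks for.\<close>

lemma path_sat_verdict:
  assumes "finite_horizons_path \<phi>"
  shows "path_sat C \<omega> \<phi> =
    (case verdict (sat C (\<omega> 0)) \<phi> of Some b \<Rightarrow> b | None \<Rightarrow> path_sat C (\<lambda>i. \<omega> (Suc i)) (residual \<phi>))"
proof (cases \<phi>)
  case (Next l \<Phi>)
  then show ?thesis by (cases l) auto
next
  case (Until k \<Phi> \<Psi>)
  then obtain l where k: "k = enat l" using assms by auto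
  show ?thesis
    by (cases l) (auto simp: Until k zero_enat_def one_enat_def ex_le_Suc2 All_less_Suc2)
next
  case (WUntil k \<Phi> \<Psi>)
  then obtain l where k: "k = enat l" using assms by auto
  show ?thesis
    by (cases l) (auto simp: WUntil k zero_enat_def one_enat_def all_le_Suc2 Ex_less_Suc2)
qed

lemma residual_simps:
  assumes "finite_horizons_path \<phi>" "verdict S \<phi> = None"
  shows "bound \<phi> = Suc (bound (residual \<phi>))" "finite_horizons_path (residual \<phi>)"
proof -
  have "bound \<phi> = Suc (bound (residual \<phi>)) \<and> finite_horizons_path (residual \<phi>)"
    using assms
    by (cases \<phi>) (auto simp: zero_enat_def one_enat_def split: if_splits)
  then show "bound \<phi> = Suc (bound (residual \<phi>))" "finite_horizons_path (residual \<phi>)" by auto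
qed

lemma path_sat_local:
  assumes "finite_horizons_path \<phi>" "\<And>i. i \<le> bound \<phi> \<Longrightarrow> \<omega> i = \<omega>' i"
  shows "path_sat C \<omega> \<phi> = path_sat C \<omega>' \<phi>"
  using assms
proof (induction "bound \<phi>" arbitrary: \<phi> \<omega> \<omega>' rule: less_induct)
  case less
  have 0: "\<omega> 0 = \<omega>' 0" using less.prems by simp
  show ?case
  proof (cases "verdict (sat C (\<omega> 0)) \<phi>")
    case None
    note r = residual_simps[OF less.prems(1) None]
    have "path_sat C (\<lambda>i. \<omega> (Suc i)) (residual \<phi>) = path_sat C (\<lambda>i. \<omega>' (Suc i)) (residual \<phi>)"
      by (rule less.hyps) (use r less.prems in auto)
    then show ?thesis
      using None 0 by (simp add: path_sat_verdict[OF less.prems(1)])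
  next
    case Some
    then show ?thesis using 0 by (simp add: path_sat_verdict[OF less.prems(1)])
  qed
qed

definition path_prob :: "'s mc \<Rightarrow> 's \<Rightarrow> pform \<Rightarrow> real" where
  "path_prob C s \<phi> = measure (path_measure (trans_prob C) s) {\<omega>. path_sat C \<omega> \<phi>}"

lemma sat_Lin:
  "sat C s (Lin ts r c0) \<longleftrightarrow>
     cmp_holds r (\<Sum>(c, \<phi>)\<leftarrow>ts. of_int c * path_prob C s \<phi>) (of_int c0)"
  by (simp add: path_prob_def)

declare sat.simps(5) [simp del]

lemma path_prob_bounds: "0 \<le> path_prob C s \<phi>" "path_prob C s \<phi> \<le> 1"
  by (auto simp: path_prob_def intro: prob_space.prob_le_1[OF prob_space_path_measure])

lemma path_prob_prefix:
  assumes "finite_horizons_path \<phi>" "bound \<phi> \<le> n"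
  shows "path_prob C s \<phi> = measure (prefix_pmf (trans_prob C) n s) {xs. path_sat C (nth xs) \<phi>}"
  unfolding path_prob_def
proof (rule measure_path_prefix[OF path_sat_measurable])
  show "path_sat C \<omega> \<phi> = path_sat C \<omega>' \<phi>" if "\<And>i. i \<le> n \<Longrightarrow> \<omega> i = \<omega>' i" for \<omega> \<omega>'
    using that assms by (intro path_sat_local) auto
qed

lemma prob_bind_pmf_finite:
  assumes "finite (set_pmf p)"
  shows "measure_pmf.prob (bind_pmf p f) A = (\<Sum>x\<in>set_pmf p. pmf p x * measure_pmf.prob (f x) A)"
proof -
  have "ennreal (measure_pmf.prob (bind_pmf p f) A) = (\<integral>\<^sup>+x. emeasure (f x) A \<partial>p)"
    by (simp add: measure_pmf.emeasure_eq_measure[symmetric] emeasure_bind_pmf)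
  also have "\<dots> = (\<Sum>x\<in>set_pmf p. emeasure (f x) A * ennreal (pmf p x))"
    using assms by (rule nn_integral_measure_pmf_finite) simp
  also have "\<dots> = ennreal (\<Sum>x\<in>set_pmf p. pmf p x * measure_pmf.prob (f x) A)"
    by (simp add: measure_pmf.emeasure_eq_measure ennreal_mult[symmetric] sum_ennreal mult.commute)
  finally show ?thesis
    by (simp add: sum_nonneg)
qed

text \<open>Conditioning on the first step. In \<open>prefix_pmf\<close> this step is split off by
  \<open>bind_pmf\<close>, so the law of total probability becomes a finite sum over the
  successors.\<close>

lemma path_prob_rec:
  assumes \<phi>: "finite_horizons_path \<phi>" and fin: "finite (set_pmf (trans_prob C s))"
  shows "path_prob C s \<phi> = (case verdict (sat C s) \<phi> of Some b \<Rightarrow> of_bool b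
    | None \<Rightarrow> \<Sum>t\<in>set_pmf (trans_prob C s). pmf (trans_prob C s) t * path_prob C t (residual \<phi>))"
proof (cases "verdict (sat C s) \<phi>")
  case (Some b)
  have "path_prob C s \<phi> =
      measure (prefix_pmf (trans_prob C) (bound \<phi>) s) {xs. path_sat C (nth xs) \<phi>}"
    using \<phi> by (rule path_prob_prefix) simp
  \<comment> \<open>All sampled lists start with \<open>s\<close>, so a verdict at \<open>s\<close>
    makes the event almost surely constant.\<close>
  also have "\<dots> = measure (prefix_pmf (trans_prob C) (bound \<phi>) s) {xs. b}"
  proof (rule measure_pmf.finite_measure_eq_AE)
    show "AE xs in prefix_pmf (trans_prob C) (bound \<phi>) s.
        (xs \<in> {xs. path_sat C (nth xs) \<phi>}) = (xs \<in> {xs. b})"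
    proof (rule AE_pmfI)
      fix xs assume "xs \<in> set_pmf (prefix_pmf (trans_prob C) (bound \<phi>) s)"
      from prefix_pmf_support[OF this] have "xs ! 0 = s" by (cases xs) auto
      then show "(xs \<in> {xs. path_sat C (nth xs) \<phi>}) = (xs \<in> {xs. b})"
        using Some by (simp add: path_sat_verdict[OF \<phi>])
    qed
  qed auto
  also have "\<dots> = of_bool b" by (cases b) auto
  finally show ?thesis using Some by simp
next
  case None
  let ?K = "trans_prob C"
  note r = residual_simps[OF \<phi> None]
  define n where "n = bound (residual \<phi>)"
  have "path_prob C s \<phi> = measure (prefix_pmf ?K (Suc n) s) {xs. path_sat C (nth xs) \<phi>}"
    using \<phi> by (rule path_prob_prefix) (simp add: r n_def)
  also have "\<dots> = measure_pmf.prob (bind_pmf (?K s) (prefix_pmf ?K n)) {xs. path_sat C (nth (s # xs)) \<phi>}"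
    by (simp add: vimage_def)
  also have "{xs. path_sat C (nth (s # xs)) \<phi>} = {xs. path_sat C (nth xs) (residual \<phi>)}"
    using None by (simp add: path_sat_verdict[OF \<phi>])
  also have "measure_pmf.prob (bind_pmf (?K s) (prefix_pmf ?K n)) {xs. path_sat C (nth xs) (residual \<phi>)} =
      (\<Sum>t\<in>set_pmf (?K s). pmf (?K s) t *
        measure_pmf.prob (prefix_pmf ?K n t) {xs. path_sat C (nth xs) (residual \<phi>)})"
    by (rule prob_bind_pmf_finite[OF fin])
  also have "\<dots> = (\<Sum>t\<in>set_pmf (?K s). pmf (?K s) t * path_prob C t (residual \<phi>))"
    by (simp add: path_prob_prefix[OF r(2) order_refl] n_def)
  finally show ?thesis using None by simp
qed


section \<open>Transferring satisfaction between chains\<close>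

lemma nodes_enc_list: "nodes (enc_list xs) = 1 + length xs + (\<Sum>x\<leftarrow>xs. nodes x)"
  by (induction xs) auto

lemma nodes_enc_unary [simp]: "nodes (enc_unary n) = 2 * n + 1"
  by (simp add: enc_unary_def nodes_enc_list sum_list_replicate)

lemma nodes_pos [simp]: "0 < nodes x"
  by (cases x) auto

lemma nodes_member: "x \<in> set xs \<Longrightarrow> nodes x < nodes (enc_list xs)"
  by (induction xs) auto

lemma nodes_Lin_member:
  "(c, \<phi>) \<in> set ts \<Longrightarrow> nodes (enc_pform \<phi>) < nodes (enc_sform (Lin ts r c0))"
  using nodes_member[of "Dot (enc_int c) (enc_pform \<phi>)"
      "map (\<lambda>(c, \<phi>). Dot (enc_int c) (enc_pform \<phi>)) ts"] by force

lemma nodes_residual: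
  assumes "finite_horizons_path \<phi>" "verdict S \<phi> = None"
  shows "nodes (enc_pform (residual \<phi>)) < nodes (enc_pform \<phi>)"
  using assms
  by (cases \<phi>) (auto simp: zero_enat_def one_enat_def split: if_splits)

section \<open>Closure of a formula under subformulas and shorter horizons\<close>

fun operands :: "pform \<Rightarrow> sform set" where
  "operands (Next l \<Phi>) = {\<Phi>}"
| "operands (Until l \<Phi> \<Psi>) = {\<Phi>, \<Psi>}"
| "operands (WUntil l \<Phi> \<Psi>) = {\<Phi>, \<Psi>}"

lemma verdict_cong:
  "(\<And>\<Psi>. \<Psi> \<in> operands \<phi> \<Longrightarrow> S \<Psi> = S' \<Psi>) \<Longrightarrow> verdict S \<phi> = verdict S' \<phi>"
  by (cases \<phi>) auto

lemma operands_simps: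
  assumes "\<Psi> \<in> operands \<phi>"
  shows "nodes (enc_sform \<Psi>) < nodes (enc_pform \<phi>)" "atoms \<Psi> \<subseteq> path_atoms \<phi>"
    "finite_horizons_path \<phi> \<Longrightarrow> finite_horizons \<Psi>"
  using assms by (cases \<phi>; auto)+

text \<open>A counterpart of the Fischer-Ladner closure: for finite horizons it is stable under
  \<open>residual\<close>, so the one-step recursion never leaves it.\<close>

fun closure_s :: "sform \<Rightarrow> pform set"
and closure_p :: "pform \<Rightarrow> pform set" where
  "closure_s (Prop a) = {}"
| "closure_s (NProp a) = {}"
| "closure_s (And \<Phi> \<Psi>) = closure_s \<Phi> \<union> closure_s \<Psi>"
| "closure_s (Or \<Phi> \<Psi>) = closure_s \<Phi> \<union> closure_s \<Psi>"
| "closure_s (Lin ts r c0) = (\<Union>(c, \<phi>)\<in>set ts. closure_p \<phi>)"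
| "closure_p (Next l \<Phi>) = (\<lambda>k. Next k \<Phi>) ` {..l} \<union> closure_s \<Phi>"
| "closure_p (Until l \<Phi> \<Psi>) =
     (\<lambda>k. Until (enat k) \<Phi> \<Psi>) ` {..the_enat l} \<union> closure_s \<Phi> \<union> closure_s \<Psi>"
| "closure_p (WUntil l \<Phi> \<Psi>) =
     (\<lambda>k. WUntil (enat k) \<Phi> \<Psi>) ` {..the_enat l} \<union> closure_s \<Phi> \<union> closure_s \<Psi>"

text \<open>Truncated subtraction keeps \<open>residual\<close> inside the closure even when the
  horizon is already 0.\<close>

lemma closure_p_simps:
  assumes "finite_horizons_path \<phi>"
  shows "\<phi> \<in> closure_p \<phi>" "residual \<phi> \<in> closure_p \<phi>" "closure_p (residual \<phi>) \<subseteq> closure_p \<phi>"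
  using assms by (cases \<phi>; auto simp: one_enat_def)+

lemma closure_operands: "\<Psi> \<in> operands \<phi> \<Longrightarrow> closure_s \<Psi> \<subseteq> closure_p \<phi>"
  by (cases \<phi>) auto

lemma closure_finite_horizons:
  "finite_horizons \<Phi> \<Longrightarrow> \<phi> \<in> closure_s \<Phi> \<Longrightarrow> finite_horizons_path \<phi> \<and> bound \<phi> \<le> nodes (enc_sform \<Phi>)"
  "finite_horizons_path \<psi> \<Longrightarrow> \<phi> \<in> closure_p \<psi> \<Longrightarrow> finite_horizons_path \<phi> \<and> bound \<phi> \<le> nodes (enc_pform \<psi>)"
proof (induction \<Phi> and \<psi> rule: closure_s_closure_p.induct)
  case (5 ts r c0)
  then obtain c \<psi> where c: "(c, \<psi>) \<in> set ts" "\<phi> \<in> closure_p \<psi>" by auto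
  then have "finite_horizons_path \<phi> \<and> bound \<phi> \<le> nodes (enc_pform \<psi>)"
    using 5 by auto
  then show ?case using nodes_Lin_member[OF c(1), of r c0] by linarith
qed force+

lemma card_UN_list:
  "card (\<Union>x\<in>set xs. f x) \<le> (\<Sum>x\<leftarrow>xs. card (f x))"
proof (induction xs)
  case (Cons x xs)
  then show ?case using card_Un_le[of "f x" "\<Union>x\<in>set xs. f x"] by simp
qed simp

text \<open>Horizons are encoded in unary, so the \<open>l + 1\<close> versions of an operator with
  horizon up to \<open>l\<close> are paid for by the nodes of its own encoding.\<close>

lemma closure_card:
  "finite_horizons \<Phi> \<Longrightarrow> finite (closure_s \<Phi>) \<and> card (closure_s \<Phi>) \<le> nodes (enc_sform \<Phi>)"
  "finite_horizons_path \<psi> \<Longrightarrow> finite (closure_p \<psi>) \<and> card (closure_p \<psi>) \<le> nodes (enc_pform \<psi>)"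
proof (induction \<Phi> and \<psi> rule: closure_s_closure_p.induct)
  case (3 \<Phi> \<Psi>)
  then show ?case using card_Un_le[of "closure_s \<Phi>" "closure_s \<Psi>"] by auto
next
  case (4 \<Phi> \<Psi>)
  then show ?case using card_Un_le[of "closure_s \<Phi>" "closure_s \<Psi>"] by auto
next
  case (5 ts r c0)
  have "card (closure_s (Lin ts r c0)) \<le> (\<Sum>x\<leftarrow>ts. card (case x of (c, \<phi>) \<Rightarrow> closure_p \<phi>))"
    using card_UN_list[of "\<lambda>x. case x of (c, \<phi>) \<Rightarrow> closure_p \<phi>" ts] by simp
  also have "\<dots> \<le> (\<Sum>x\<leftarrow>ts. nodes (case x of (c, \<phi>) \<Rightarrow> Dot (enc_int c) (enc_pform \<phi>)))"
    using 5 by (intro sum_list_mono) (fastforce intro: le_trans)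
  also have "\<dots> \<le> nodes (enc_sform (Lin ts r c0))"
    by (simp add: nodes_enc_list comp_def)
  finally show ?case using 5 by auto
next
  case (6 l \<Phi>)
  have "card ((\<lambda>k. Next k \<Phi>) ` {..l}) \<le> Suc l"
    using card_image_le[of "{..l}" "\<lambda>k. Next k \<Phi>"] by simp
  with 6 card_Un_le[of "(\<lambda>k. Next k \<Phi>) ` {..l}" "closure_s \<Phi>"] show ?case by auto
next
  case (7 l \<Phi> \<Psi>)
  then obtain k where k: "l = enat k" by auto
  have "card ((\<lambda>k. Until (enat k) \<Phi> \<Psi>) ` {..k}) \<le> Suc k"
    using card_image_le[of "{..k}" "\<lambda>k. Until (enat k) \<Phi> \<Psi>"] by simp
  with 7 k card_Un_le[of "(\<lambda>k. Until (enat k) \<Phi> \<Psi>) ` {..k}" "closure_s \<Phi>"]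
    card_Un_le[of "(\<lambda>k. Until (enat k) \<Phi> \<Psi>) ` {..k} \<union> closure_s \<Phi>" "closure_s \<Psi>"]
  show ?case by auto
next
  case (8 l \<Phi> \<Psi>)
  then obtain k where k: "l = enat k" by auto
  have "card ((\<lambda>k. WUntil (enat k) \<Phi> \<Psi>) ` {..k}) \<le> Suc k"
    using card_image_le[of "{..k}" "\<lambda>k. WUntil (enat k) \<Phi> \<Psi>"] by simp
  with 8 k card_Un_le[of "(\<lambda>k. WUntil (enat k) \<Phi> \<Psi>) ` {..k}" "closure_s \<Phi>"]
    card_Un_le[of "(\<lambda>k. WUntil (enat k) \<Phi> \<Psi>) ` {..k} \<union> closure_s \<Phi>" "closure_s \<Psi>"]
  show ?case by auto
qed auto

lemma atoms_card:
  "finite (atoms \<Phi>) \<and> card (atoms \<Phi>) \<le> nodes (enc_sform \<Phi>)"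
  "finite (path_atoms \<psi>) \<and> card (path_atoms \<psi>) \<le> nodes (enc_pform \<psi>)"
proof (induction \<Phi> and \<psi> rule: atoms_path_atoms.induct)
  case (3 \<Phi> \<Psi>)
  then show ?case using card_Un_le[of "atoms \<Phi>" "atoms \<Psi>"] by auto
next
  case (4 \<Phi> \<Psi>)
  then show ?case using card_Un_le[of "atoms \<Phi>" "atoms \<Psi>"] by auto
next
  case (5 ts r c0)
  have "card (atoms (Lin ts r c0)) \<le> (\<Sum>x\<leftarrow>ts. card (case x of (c, \<phi>) \<Rightarrow> path_atoms \<phi>))"
    using card_UN_list[of "\<lambda>x. case x of (c, \<phi>) \<Rightarrow> path_atoms \<phi>" ts] by simp
  also have "\<dots> \<le> (\<Sum>x\<leftarrow>ts. nodes (case x of (c, \<phi>) \<Rightarrow> Dot (enc_int c) (enc_pform \<phi>)))"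
    using 5 by (intro sum_list_mono) (fastforce intro: le_trans)
  also have "\<dots> \<le> nodes (enc_sform (Lin ts r c0))"
    by (simp add: nodes_enc_list comp_def)
  finally show ?case using 5 by auto
next
  case (7 l \<Phi> \<Psi>)
  then show ?case using card_Un_le[of "atoms \<Phi>" "atoms \<Psi>"] by auto
next
  case (8 l \<Phi> \<Psi>)
  then show ?case using card_Un_le[of "atoms \<Phi>" "atoms \<Psi>"] by auto
qed auto

lemma atoms_nodes:
  "p \<in> atoms \<Phi> \<Longrightarrow> nodes (enc_nat p) \<le> nodes (enc_sform \<Phi>)"
  "p \<in> path_atoms \<psi> \<Longrightarrow> nodes (enc_nat p) \<le> nodes (enc_pform \<psi>)"
proof (induction \<Phi> and \<psi> rule: atoms_path_atoms.induct)
  case (5 ts r c0)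
  then obtain c \<psi> where c: "(c, \<psi>) \<in> set ts" "p \<in> path_atoms \<psi>" by auto
  then have "nodes (enc_nat p) \<le> nodes (enc_pform \<psi>)"
    using 5 by auto
  then show ?case using nodes_Lin_member[OF c(1), of r c0] by linarith
qed auto

text \<open>The map \<open>f\<close> need not commute with transitions; it suffices that one step
  from \<open>s\<close> and one step from \<open>f s\<close> give the same expectation of every
  formula in \<open>X\<close>. Both expectations are of probabilities in \<open>C\<close>, so
  \<open>step\<close> can be checked before anything is known about \<open>C'\<close>. Shortening a
  horizon is no structural descent, hence the joint induction on encoding size, which drops for
  operands and residuals alike.\<close>

lemma sat_transfer_aux:
  fixes C :: "'s mc" and C' :: "'t mc" and f :: "'t \<Rightarrow> 's"
  assumes fin: "\<And>s. s \<in> S' \<Longrightarrow> finite (set_pmf (trans_prob C' s))"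
      "\<And>s. s \<in> S' \<Longrightarrow> finite (set_pmf (trans_prob C (f s)))"
    and closed: "\<And>s. s \<in> S' \<Longrightarrow> set_pmf (trans_prob C' s) \<subseteq> S'"
    and lab: "\<And>s p. s \<in> S' \<Longrightarrow> p \<in> A \<Longrightarrow> p \<in> label C' s \<longleftrightarrow> p \<in> label C (f s)"
    and step: "\<And>s \<phi>. s \<in> S' \<Longrightarrow> \<phi> \<in> X \<Longrightarrow>
      (\<Sum>t\<in>set_pmf (trans_prob C' s). pmf (trans_prob C' s) t * path_prob C (f t) \<phi>) =
      (\<Sum>t\<in>set_pmf (trans_prob C (f s)). pmf (trans_prob C (f s)) t * path_prob C t \<phi>)"
  shows "(\<forall>\<Psi> s. nodes (enc_sform \<Psi>) = m \<longrightarrow> finite_horizons \<Psi> \<longrightarrow> atoms \<Psi> \<subseteq> A \<longrightarrow>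
      closure_s \<Psi> \<subseteq> X \<longrightarrow> s \<in> S' \<longrightarrow> sat C' s \<Psi> = sat C (f s) \<Psi>) \<and>
    (\<forall>\<phi> s. nodes (enc_pform \<phi>) = m \<longrightarrow> finite_horizons_path \<phi> \<longrightarrow> path_atoms \<phi> \<subseteq> A \<longrightarrow>
      closure_p \<phi> \<subseteq> X \<longrightarrow> s \<in> S' \<longrightarrow> path_prob C' s \<phi> = path_prob C (f s) \<phi>)"
proof (induction m rule: less_induct)
  case (less m)
  have IHs: "sat C' s \<Psi> = sat C (f s) \<Psi>"
    if "nodes (enc_sform \<Psi>) < m" "finite_horizons \<Psi>" "atoms \<Psi> \<subseteq> A" "closure_s \<Psi> \<subseteq> X" "s \<in> S'" for \<Psi> s
    using less[OF that(1)] that by blast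
  have IHp: "path_prob C' s \<phi> = path_prob C (f s) \<phi>"
    if "nodes (enc_pform \<phi>) < m" "finite_horizons_path \<phi>" "path_atoms \<phi> \<subseteq> A" "closure_p \<phi> \<subseteq> X"
      "s \<in> S'" for \<phi> s
    using less[OF that(1)] that by blast
  show ?case
  proof (intro conjI allI impI)
    fix \<Psi> s assume m: "nodes (enc_sform \<Psi>) = m" and fh: "finite_horizons \<Psi>"
      and at: "atoms \<Psi> \<subseteq> A" and cl: "closure_s \<Psi> \<subseteq> X" and s: "s \<in> S'"
    show "sat C' s \<Psi> = sat C (f s) \<Psi>"
    proof (cases \<Psi>)
      case (Lin ts r c0)
      have eq: "path_prob C' s \<phi> = path_prob C (f s) \<phi>" if t: "(c, \<phi>) \<in> set ts" for c \<phi>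
      proof (rule IHp)
        show "nodes (enc_pform \<phi>) < m" using nodes_Lin_member[OF t] m Lin by blast
      qed (use fh at cl s t in \<open>auto simp: Lin\<close>)
      have "(\<Sum>(c, \<phi>)\<leftarrow>ts. real_of_int c * path_prob C' s \<phi>) =
          (\<Sum>(c, \<phi>)\<leftarrow>ts. real_of_int c * path_prob C (f s) \<phi>)"
        by (rule arg_cong[where f = sum_list], rule map_cong) (auto dest: eq)
      then show ?thesis by (simp add: Lin sat_Lin)
    qed (use m fh at cl s lab in \<open>auto simp: IHs\<close>)
  next
    fix \<phi> s assume m: "nodes (enc_pform \<phi>) = m" and fh: "finite_horizons_path \<phi>"
      and at: "path_atoms \<phi> \<subseteq> A" and cl: "closure_p \<phi> \<subseteq> X" and s: "s \<in> S'"
    have "verdict (sat C' s) \<phi> = verdict (sat C (f s)) \<phi>"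
    proof (rule verdict_cong, rule IHs)
      fix \<Psi> assume "\<Psi> \<in> operands \<phi>"
      from operands_simps[OF this] closure_operands[OF this] m fh at cl
      show "nodes (enc_sform \<Psi>) < m" "finite_horizons \<Psi>" "atoms \<Psi> \<subseteq> A" "closure_s \<Psi> \<subseteq> X" by auto
    qed (rule s)
    moreover have "(\<Sum>t\<in>set_pmf (trans_prob C' s). pmf (trans_prob C' s) t * path_prob C' t (residual \<phi>)) =
        (\<Sum>t\<in>set_pmf (trans_prob C (f s)). pmf (trans_prob C (f s)) t * path_prob C t (residual \<phi>))"
      if "verdict (sat C' s) \<phi> = None"
    proof -
      have "path_prob C' t (residual \<phi>) = path_prob C (f t) (residual \<phi>)"
        if "t \<in> set_pmf (trans_prob C' s)" for t
      proof (rule IHp)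
        show "nodes (enc_pform (residual \<phi>)) < m"
          using nodes_residual[OF fh \<open>verdict (sat C' s) \<phi> = None\<close>] m by simp
        show "finite_horizons_path (residual \<phi>)"
          using residual_simps[OF fh \<open>verdict (sat C' s) \<phi> = None\<close>] by simp
        show "path_atoms (residual \<phi>) \<subseteq> A" using at by (cases \<phi>) auto
        show "closure_p (residual \<phi>) \<subseteq> X" using closure_p_simps(3)[OF fh] cl by auto
        show "t \<in> S'" using closed[OF s] that by auto
      qed
      \<comment> \<open>The induction hypothesis has moved the inner probabilities from
        \<open>C'\<close> to \<open>C\<close>, which is the form in which \<open>step\<close> speaks
        of them.\<close>
      then show ?thesis
        using step[OF s, of "residual \<phi>"] closure_p_simps(2)[OF fh] cl by auto
    qed
    ultimately show "path_prob C' s \<phi> = path_prob C (f s) \<phi>"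
      by (simp add: path_prob_rec[OF fh] fin s split: option.split)
  qed
qed


section \<open>Small models\<close>

text \<open>With integer numerators over one common denominator \<open>D\<close>, stochasticity and
  granularity become equations of natural numbers, which a program can test.\<close>

definition matrix_chain :: "nat set \<Rightarrow> nat \<Rightarrow> nat \<Rightarrow> (nat \<Rightarrow> nat \<Rightarrow> nat) \<Rightarrow> (nat \<Rightarrow> nat set) \<Rightarrow> nat mc" where
  "matrix_chain A K D w lab =
     \<lparr>states = {..<K}, init = 0,
      trans_prob = (\<lambda>i. embed_pmf (\<lambda>j. if j < K then real (w i j) / real D else 0)),
      AP = A, label = lab\<rparr>"

definition stochastic :: "nat \<Rightarrow> nat \<Rightarrow> (nat \<Rightarrow> nat \<Rightarrow> nat) \<Rightarrow> bool" where
  "stochastic K D w \<longleftrightarrow> 0 < D \<and> 0 < K \<and> (\<forall>i<K. (\<Sum>j<K. w i j) = D)"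

text \<open>The equation is \<open>w / D = a / b\<close> cleared of fractions. Carrying
  \<open>a\<close> and \<open>b\<close> as witnesses spares the checker a search for a small
  denominator.\<close>

definition granular :: "nat \<Rightarrow> nat \<Rightarrow> nat \<Rightarrow> (nat \<Rightarrow> nat \<Rightarrow> nat) \<Rightarrow> (nat \<Rightarrow> nat \<Rightarrow> nat) \<Rightarrow>
    (nat \<Rightarrow> nat \<Rightarrow> nat) \<Rightarrow> bool" where
  "granular N K D w a b \<longleftrightarrow>
     (\<forall>i<K. \<forall>j<K. 0 < b i j \<and> b i j \<le> N \<and> w i j * b i j = a i j * D)"

lemma matrix_chain_simps [simp]:
  "states (matrix_chain A K D w lab) = {..<K}" "init (matrix_chain A K D w lab) = 0"
  "AP (matrix_chain A K D w lab) = A" "label (matrix_chain A K D w lab) = lab"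
  by (simp_all add: matrix_chain_def)

lemma pmf_matrix_chain:
  assumes "stochastic K D w" "i < K"
  shows "pmf (trans_prob (matrix_chain A K D w lab) i) j = (if j < K then real (w i j) / real D else 0)"
  unfolding matrix_chain_def mc.simps
proof (rule pmf_embed_pmf)
  have "(\<integral>\<^sup>+j. ennreal (if j < K then real (w i j) / real D else 0) \<partial>count_space UNIV) =
      (\<integral>\<^sup>+j. ennreal (real (w i j) / real D) \<partial>count_space {..<K})"
    by (subst nn_integral_count_space_indicator) (auto intro!: nn_integral_cong)
  also have "\<dots> = ennreal (\<Sum>j<K. real (w i j) / real D)"
    by (subst nn_integral_count_space_finite) (auto simp: sum_ennreal)
  also have "(\<Sum>j<K. real (w i j) / real D) = real (\<Sum>j<K. w i j) / real D"
    by (simp add: sum_divide_distrib)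
  also have "\<dots> = 1" using assms by (simp add: stochastic_def)
  finally show "(\<integral>\<^sup>+j. ennreal (if j < K then real (w i j) / real D else 0) \<partial>count_space UNIV) = 1"
    by simp
qed simp

lemma set_pmf_matrix_chain:
  assumes "stochastic K D w" "i < K"
  shows "set_pmf (trans_prob (matrix_chain A K D w lab) i) \<subseteq> {..<K}"
    "finite (set_pmf (trans_prob (matrix_chain A K D w lab) i))"
proof -
  show "set_pmf (trans_prob (matrix_chain A K D w lab) i) \<subseteq> {..<K}"
    using assms by (auto simp: set_pmf_iff pmf_matrix_chain split: if_splits)
  then show "finite (set_pmf (trans_prob (matrix_chain A K D w lab) i))"
    by (rule finite_subset) simp
qed

lemma sum_matrix_chain:
  assumes "stochastic K D w" "i < K"
  shows "(\<Sum>t\<in>set_pmf (trans_prob (matrix_chain A K D w lab) i).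
      pmf (trans_prob (matrix_chain A K D w lab) i) t * g t) = (\<Sum>j<K. real (w i j) / real D * g j)"
proof -
  have "(\<Sum>t\<in>set_pmf (trans_prob (matrix_chain A K D w lab) i).
      pmf (trans_prob (matrix_chain A K D w lab) i) t * g t) =
    (\<Sum>t<K. pmf (trans_prob (matrix_chain A K D w lab) i) t * g t)"
    by (rule sum.mono_neutral_left) (use set_pmf_matrix_chain[OF assms] in \<open>auto simp: set_pmf_iff\<close>)
  then show ?thesis by (simp add: pmf_matrix_chain[OF assms])
qed

text \<open>No transition leaves \<open>{..<K}\<close>, so satisfaction at all these indices covers
  every state that the global formula quantifies over.\<close>

lemma matrix_chain_model:
  assumes st: "stochastic K D w" and gr: "granular N K D w a b"
    and A: "finite A" "A \<noteq> {}" "atoms \<Phi> \<subseteq> A" "\<And>i. i < K \<Longrightarrow> lab i \<subseteq> A"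
    and sat: "\<And>i. i < K \<Longrightarrow> sat (matrix_chain A K D w lab) i \<Phi>"
  shows "granularity_le N (matrix_chain A K D w lab)" "is_model (matrix_chain A K D w lab) (AG \<Phi>)"
proof -
  let ?C = "matrix_chain A K D w lab"
  show "granularity_le N ?C"
    unfolding granularity_le_def
  proof (intro ballI)
    fix i j assume "i \<in> states ?C" "j \<in> states ?C"
    then have ij: "i < K" "j < K" by auto
    have "w i j * b i j = a i j * D" and b: "0 < b i j" "b i j \<le> N"
      using gr ij by (auto simp: granular_def)
    then have "real (w i j) * real (b i j) = real (a i j) * real D"
      by (metis of_nat_mult)
    then have "real (w i j) / real D = real (a i j) / real (b i j)"
      using b st by (simp add: stochastic_def field_simps)
    then show "\<exists>x y. 0 < y \<and> y \<le> N \<and> pmf (trans_prob ?C i) j = real x / real y"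
      using b ij by (auto simp: pmf_matrix_chain[OF st])
  qed
  have mc: "markov_chain ?C"
    using st A set_pmf_matrix_chain[OF st] by (auto simp: markov_chain_def stochastic_def)
  have "t < K" if "reachable ?C 0 t" for t
    using that unfolding reachable_def
  proof (induction rule: rtrancl_induct)
    case base
    then show ?case using st by (simp add: stochastic_def)
  next
    case (step y z)
    then show ?case using set_pmf_matrix_chain(1)[OF st step.IH] by auto
  qed
  then show "is_model ?C (AG \<Phi>)"
    using mc A sat by auto
qed

lemma sum_Nats: "(\<And>x. x \<in> A \<Longrightarrow> f x \<in> \<nat>) \<Longrightarrow> sum f A \<in> (\<nat> :: 'a :: semiring_1 set)"
  by (induction A rule: infinite_finite_induct) auto

section \<open>Common denominators and bounded branching\<close>

context
  fixes C :: "'s mc" and N :: nat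
  assumes mc: "markov_chain C" and gran: "granularity_le N C"
begin

text \<open>Already the pair of the initial state with itself requires a denominator between 1 and
  \<open>N\<close>, whatever its probability.\<close>

lemma granularity_pos: "0 < N"
  using mc gran by (auto simp: markov_chain_def granularity_le_def)

lemma fact_pmf_nat:
  assumes "s \<in> states C"
  shows "fact N * pmf (trans_prob C s) t \<in> \<nat>"
proof (cases "t \<in> states C")
  case True
  then obtain a b where b: "0 < b" "b \<le> N" "pmf (trans_prob C s) t = real a / real b"
    using gran assms unfolding granularity_le_def by blast
  then have "b dvd fact N" by (simp add: dvd_fact)
  then obtain k where k: "fact N = b * k" by auto
  have "fact N * pmf (trans_prob C s) t = real (fact N) * (real a / real b)" by (simp add: b)
  also have "\<dots> = real (k * a)" using b by (simp add: k)
  finally show ?thesis by simp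
next
  \<comment> \<open>Granularity speaks about targets in \<open>states C\<close> only; any other
    target has probability 0.\<close>
  case False
  then have "pmf (trans_prob C s) t = 0"
    using mc assms unfolding markov_chain_def by (meson pmf_eq_0_set_pmf subsetD)
  then show ?thesis by simp
qed

text \<open>A positive fraction with denominator at most \<open>N\<close> is at least
  \<open>1 / N\<close>, and the probabilities sum to 1.\<close>

lemma support_finite:
  assumes s: "s \<in> states C"
  shows "finite (set_pmf (trans_prob C s))" "card (set_pmf (trans_prob C s)) \<le> N"
proof -
  let ?p = "trans_prob C s"
  have ge: "1 / real N \<le> pmf ?p t" if t: "t \<in> set_pmf ?p" for t
  proof -
    have "t \<in> states C" using mc s t by (auto simp: markov_chain_def)
    then obtain a b where b: "0 < b" "b \<le> N" "pmf ?p t = real a / real b"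
      using gran s unfolding granularity_le_def by blast
    moreover have "0 < a" using t b by (cases "a = 0") (auto simp: set_pmf_iff)
    ultimately show ?thesis using frac_le[of "real a" 1 "real b" "real N"] by simp
  qed
  have card: "card T \<le> N" if T: "finite T" "T \<subseteq> set_pmf ?p" for T
  proof -
    have "real (card T) * (1 / real N) \<le> (\<Sum>t\<in>T. pmf ?p t)"
      using sum_bounded_below[of T "1 / real N" "pmf ?p"] ge T by auto
    also have "\<dots> = measure ?p T" using T by (simp add: measure_measure_pmf_finite)
    also have "\<dots> \<le> 1" by simp
    finally show ?thesis using granularity_pos by (simp add: field_simps)
  qed
  show "finite (set_pmf ?p)"
  proof (rule ccontr)
    assume "infinite (set_pmf ?p)"
    then obtain T where "finite T" "T \<subseteq> set_pmf ?p" "card T = Suc N"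
      by (meson infinite_arbitrarily_large)
    then show False using card by fastforce
  qed
  then show "card (set_pmf ?p) \<le> N" using card by blast
qed

text \<open>Each step contributes one factor \<open>N!\<close>. The exponent may be any upper bound
  of the horizon, so that all formulas of a closure share one denominator.\<close>

lemma path_prob_nat:
  assumes "finite_horizons_path \<phi>" "s \<in> states C" "bound \<phi> \<le> n"
  shows "fact N ^ n * path_prob C s \<phi> \<in> \<nat>"
  using assms
proof (induction n arbitrary: \<phi> s)
  case 0
  then have "verdict (sat C s) \<phi> \<noteq> None" using residual_simps(1)[OF 0(1)] by fastforce
  then show ?case
    using 0 by (auto simp: path_prob_rec support_finite split: option.split)
next
  case (Suc n)
  show ?case
  proof (cases "verdict (sat C s) \<phi>")
    case None
    have "fact N ^ Suc n * path_prob C s \<phi> = (\<Sum>t\<in>set_pmf (trans_prob C s).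
        (fact N * pmf (trans_prob C s) t) * (fact N ^ n * path_prob C t (residual \<phi>)))"
      using None Suc.prems
      by (simp add: path_prob_rec support_finite sum_distrib_left mult_ac)
    also have "\<dots> \<in> \<nat>"
    proof (rule sum_Nats, rule Nats_mult)
      fix t assume "t \<in> set_pmf (trans_prob C s)"
      then have "t \<in> states C" using mc Suc.prems by (auto simp: markov_chain_def)
      then show "fact N ^ n * path_prob C t (residual \<phi>) \<in> \<nat>"
        using residual_simps[OF Suc.prems(1) None] Suc.prems by (intro Suc.IH) auto
    qed (use fact_pmf_nat Suc.prems in auto)
    finally show ?thesis .
  next
    case (Some b)
    moreover have "fact N ^ Suc n \<in> (\<nat> :: real set)"
      by (metis of_nat_fact of_nat_power of_nat_in_Nats)
    ultimately show ?thesis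
      using Suc.prems by (cases b) (auto simp: path_prob_rec support_finite)
  qed
qed

end

lemma nat_floor_Nats: "x \<in> \<nat> \<Longrightarrow> real (nat \<lfloor>x\<rfloor>) = x"
  by (auto simp: Nats_def)

text \<open>The states of the small model are pairs of a type and an index below \<open>N\<close>. The \<open>k\<close>-th
  successor of a representative leads to the copy with index \<open>k\<close> of its type, so that successors
  of equal type keep distinct targets and no probabilities are added up, which could
  violate the granularity bound.\<close>

lemma small_model:
  fixes C :: "'s mc"
  assumes gran: "granularity_le N C" and model: "is_model C (AG \<Phi>)" and fh: "finite_horizons \<Phi>"
  defines "n \<equiv> nodes (enc_sform \<Phi>)"
  shows "\<exists>K w a b lab. stochastic K (fact N) w \<and> granular N K (fact N) w a b \<and>
    K \<le> N * (2 ^ n * (fact N ^ n + 1) ^ n) \<and> (\<forall>i<K. lab i \<subseteq> atoms \<Phi>) \<and>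
    (\<forall>A. \<forall>i<K. sat (matrix_chain A K (fact N) w lab) i \<Phi>)"
proof -
  have mc: "markov_chain C" and gs: "\<And>t. reachable C (init C) t \<Longrightarrow> sat C t \<Phi>"
    using model by auto
  let ?P = "trans_prob C" and ?D = "fact N :: nat"
  note supp = support_finite[OF mc gran] and Npos = granularity_pos[OF mc gran]
  define X where "X = closure_s \<Phi>"
  have X: "finite X" "card X \<le> n" "\<And>\<phi>. \<phi> \<in> X \<Longrightarrow> finite_horizons_path \<phi> \<and> bound \<phi> \<le> n"
    using closure_card(1)[OF fh] closure_finite_horizons(1)[OF fh] by (auto simp: X_def n_def)
  define R where "R = {t. reachable C (init C) t}"
  have R_init: "init C \<in> R" by (simp add: R_def reachable_def)
  have R_closed: "set_pmf (?P s) \<subseteq> R" if "s \<in> R" for s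
    using that by (auto simp: R_def reachable_def intro: rtrancl_into_rtrancl)
  have R_states: "s \<in> states C" if "s \<in> R" for s
    using that unfolding R_def reachable_def mem_Collect_eq
    by (induction rule: rtrancl_induct) (use mc in \<open>auto simp: markov_chain_def\<close>)
  \<comment> \<open>On reachable states the floor loses nothing: by \<open>path_prob_nat\<close> the
    scaled probability is a natural number, so equal types mean equal probabilities.\<close>
  define ty where "ty s = (label C s \<inter> atoms \<Phi>,
      restrict (\<lambda>\<phi>. nat \<lfloor>real ?D ^ n * path_prob C s \<phi>\<rfloor>) X)" for s
  have val: "real (nat \<lfloor>real ?D ^ n * path_prob C s \<phi>\<rfloor>) = real ?D ^ n * path_prob C s \<phi>"
    if "\<phi> \<in> X" "s \<in> R" for s \<phi>
    using path_prob_nat[OF mc gran _ R_states[OF that(2)]] X(3)[OF that(1)]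
    by (intro nat_floor_Nats) auto
  define T where "T = ty ` R"
  \<comment> \<open>There are at most \<open>n\<close> propositions and at most \<open>n\<close>
    path formulas, the latter with \<open>D ^ n + 1\<close> possible values each; this is the source
    of the bound on \<open>K\<close>.\<close>
  have "T \<subseteq> Pow (atoms \<Phi>) \<times> (X \<rightarrow>\<^sub>E {..?D ^ n})"
  proof
    fix x assume "x \<in> T"
    then obtain s where s: "s \<in> R" "x = ty s" by (auto simp: T_def)
    have "nat \<lfloor>real ?D ^ n * path_prob C s \<phi>\<rfloor> \<le> ?D ^ n" if "\<phi> \<in> X" for \<phi>
    proof -
      have "real ?D ^ n * path_prob C s \<phi> \<le> real ?D ^ n * 1"
        by (intro mult_left_mono path_prob_bounds) simp
      then have "real (nat \<lfloor>real ?D ^ n * path_prob C s \<phi>\<rfloor>) \<le> real (?D ^ n)"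
        using val[OF that s(1)] by simp
      then show ?thesis using of_nat_le_iff by blast
    qed
    then show "x \<in> Pow (atoms \<Phi>) \<times> (X \<rightarrow>\<^sub>E {..?D ^ n})"
      using s by (auto simp: ty_def)
  qed
  moreover have fin: "finite (Pow (atoms \<Phi>) \<times> (X \<rightarrow>\<^sub>E {..?D ^ n}))"
    using X atoms_card(1)[of \<Phi>] by (auto intro: finite_PiE)
  moreover have "card (Pow (atoms \<Phi>) \<times> (X \<rightarrow>\<^sub>E {..?D ^ n})) \<le> 2 ^ n * (?D ^ n + 1) ^ n"
    using X atoms_card(1)[of \<Phi>]
    by (auto simp: card_cartesian_product card_Pow card_PiE n_def
        intro!: mult_mono power_increasing)
  ultimately have T: "finite T" "card T \<le> 2 ^ n * (?D ^ n + 1) ^ n"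
    using finite_subset card_mono le_trans by meson+
  define k where "k = card T"
  obtain h where h: "bij_betw h {0..<k} T"
    using ex_bij_betw_nat_finite[OF T(1)] k_def by blast
  define ix where "ix s = the_inv_into {0..<k} h (ty s)" for s
  define rep where "rep i = (SOME s. s \<in> R \<and> ty s = h i)" for i
  have ix: "ix s < k" "h (ix s) = ty s" if "s \<in> R" for s
    using h that the_inv_into_into[of h "{0..<k}" "ty s" "{0..<k}"] f_the_inv_into_f[of h "{0..<k}" "ty s"]
    by (auto simp: ix_def bij_betw_def T_def)
  have rep: "rep i \<in> R \<and> ty (rep i) = h i" if "i < k" for i
  proof -
    have "h i \<in> T" using h that by (auto simp: bij_betw_def)
    then have "\<exists>s. s \<in> R \<and> ty s = h i" by (auto simp: T_def)
    then show ?thesis unfolding rep_def by (rule someI_ex)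
  qed
  have same: "path_prob C (rep (ix t)) \<phi> = path_prob C t \<phi>" if "t \<in> R" "\<phi> \<in> X" for t \<phi>
  proof -
    have r: "rep (ix t) \<in> R" "ty (rep (ix t)) = ty t" using rep ix that by auto
    then have "nat \<lfloor>real ?D ^ n * path_prob C (rep (ix t)) \<phi>\<rfloor> = nat \<lfloor>real ?D ^ n * path_prob C t \<phi>\<rfloor>"
      using that by (auto simp: ty_def restrict_def fun_eq_iff split: if_splits)
    then have "real ?D ^ n * path_prob C (rep (ix t)) \<phi> = real ?D ^ n * path_prob C t \<phi>"
      using val[OF that(2) that(1)] val[OF that(2) r(1)] by simp
    then show ?thesis by simp
  qed
  define succs where "succs s = (SOME xs. set xs = set_pmf (?P s) \<and> distinct xs)" for s
  have succs: "set (succs s) = set_pmf (?P s)" "distinct (succs s)" "length (succs s) \<le> N"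
    if "s \<in> R" for s
  proof -
    have "\<exists>xs. set xs = set_pmf (?P s) \<and> distinct xs"
      using supp[OF R_states[OF that]] finite_distinct_list by blast
    then have *: "set (succs s) = set_pmf (?P s) \<and> distinct (succs s)"
      unfolding succs_def by (rule someI_ex)
    then show "set (succs s) = set_pmf (?P s)" "distinct (succs s)" by auto
    show "length (succs s) \<le> N"
      using * supp[OF R_states[OF that]] distinct_card by metis
  qed
  define K where "K = k * N"
  \<comment> \<open>Index \<open>i\<close> stands for copy \<open>i mod N\<close> of type
    \<open>i div N\<close>; all copies of a type behave like its representative.\<close>
  define f where "f i = rep (i div N)" for i
  have f: "f i \<in> R" if "i < K" for i
    using rep[of "i div N"] that Npos by (auto simp: f_def K_def less_mult_imp_div_less)
  \<comment> \<open>In row \<open>i\<close>, column \<open>j\<close> is reserved for successor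
    number \<open>j mod N\<close> and is entered only if this successor has type
    \<open>j div N\<close>. So each successor is sent to exactly one column, and no column receives
    two.\<close>
  define hit where "hit i j \<longleftrightarrow> j mod N < length (succs (f i)) \<and> ix (succs (f i) ! (j mod N)) = j div N"
    for i j
  define w where "w i j = (if hit i j then nat \<lfloor>real ?D * pmf (?P (f i)) (succs (f i) ! (j mod N))\<rfloor> else 0)"
    for i j
  have w: "real (w i j) = (if hit i j then real ?D * pmf (?P (f i)) (succs (f i) ! (j mod N)) else 0)"
    if "i < K" for i j
    using fact_pmf_nat[OF mc gran R_states[OF f[OF that]]]
    by (cases "hit i j") (simp_all only: w_def if_True if_False nat_floor_Nats of_nat_0 of_nat_fact)
  \<comment> \<open>A row integrates a function of the type exactly as the distribution it comes
    from. With the constant 1 this gives stochasticity, with path probabilities the assumption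
    \<open>step\<close> of the transfer lemma.\<close>
  have sum_w: "(\<Sum>j<K. real (w i j) / real ?D * g j) =
      (\<Sum>t\<in>set_pmf (?P (f i)). pmf (?P (f i)) t * g' t)"
    if i: "i < K" and g: "\<And>t r. t \<in> set_pmf (?P (f i)) \<Longrightarrow> r < N \<Longrightarrow> g (ix t * N + r) = g' t" for i g g'
  proof -
    let ?xs = "succs (f i)"
    note xs = succs[OF f[OF i]]
    have "(\<Sum>j<K. real (w i j) / real ?D * g j) =
        (\<Sum>j<k * N. (if hit i j then pmf (?P (f i)) (?xs ! (j mod N)) else 0) * g j)"
      by (auto simp: K_def[symmetric] w[OF i] intro!: sum.cong)
    also have "\<dots> = (\<Sum>q<k. \<Sum>r<N.
        (if hit i (q * N + r) then pmf (?P (f i)) (?xs ! r) else 0) * g (q * N + r))"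
    proof -
      have "(\<Sum>j<k * N. F j) = (\<Sum>q<k. \<Sum>r<N. F (q * N + r))" for F :: "nat \<Rightarrow> real"
      proof -
        have "(\<Sum>j<k * N. F j) = (\<Sum>q<k. sum F {q * N..<q * N + N})" by (rule sum.nat_group[symmetric])
        also have "\<dots> = (\<Sum>q<k. \<Sum>r<N. F (q * N + r))"
        proof (rule sum.cong[OF refl])
          fix q
          show "sum F {q * N..<q * N + N} = (\<Sum>r<N. F (q * N + r))"
            using sum.shift_bounds_nat_ivl[of F 0 "q * N" N]
            by (simp add: add.commute lessThan_atLeast0)
        qed
        finally show ?thesis .
      qed
      then show ?thesis by (auto intro!: sum.cong)
    qed
    also have "\<dots> = (\<Sum>r<N. \<Sum>q<k.
        (if hit i (q * N + r) then pmf (?P (f i)) (?xs ! r) else 0) * g (q * N + r))"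
      by (rule sum.swap)
    \<comment> \<open>For fixed \<open>r\<close>, only the block \<open>q\<close> given by the type
      of successor \<open>r\<close> contributes to the inner sum.\<close>
    also have "\<dots> = (\<Sum>r<N. if r < length ?xs then pmf (?P (f i)) (?xs ! r) * g' (?xs ! r) else 0)"
    proof (rule sum.cong[OF refl])
      fix r assume "r \<in> {..<N}"
      then have r: "r < N" by simp
      show "(\<Sum>q<k. (if hit i (q * N + r) then pmf (?P (f i)) (?xs ! r) else 0) * g (q * N + r)) =
          (if r < length ?xs then pmf (?P (f i)) (?xs ! r) * g' (?xs ! r) else 0)"
      proof (cases "r < length ?xs")
        case True
        then have t: "?xs ! r \<in> set_pmf (?P (f i))" using xs(1) nth_mem by blast
        then have t': "?xs ! r \<in> R" using R_closed[OF f[OF i]] by auto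
        have "(\<Sum>q<k. (if hit i (q * N + r) then pmf (?P (f i)) (?xs ! r) else 0) * g (q * N + r)) =
            (\<Sum>q<k. if q = ix (?xs ! r) then pmf (?P (f i)) (?xs ! r) * g (q * N + r) else 0)"
          using r True by (intro sum.cong) (auto simp: hit_def)
        also have "\<dots> = pmf (?P (f i)) (?xs ! r) * g (ix (?xs ! r) * N + r)"
          using ix[OF t'] by simp
        finally show ?thesis using True g[OF t r] by simp
      next
        case False
        then show ?thesis using r by (simp add: hit_def)
      qed
    qed
    also have "\<dots> = (\<Sum>r<length ?xs. pmf (?P (f i)) (?xs ! r) * g' (?xs ! r))"
      using xs(3) by (intro sum.mono_neutral_cong_right) auto
    also have "\<dots> = (\<Sum>t\<leftarrow>?xs. pmf (?P (f i)) t * g' t)"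
      by (simp add: sum_list_sum_nth lessThan_atLeast0)
    also have "\<dots> = (\<Sum>t\<in>set_pmf (?P (f i)). pmf (?P (f i)) t * g' t)"
      using xs by (simp add: sum_list_distinct_conv_sum_set)
    finally show ?thesis .
  qed
  have Kpos: "0 < K"
    using ix(1)[OF R_init] Npos by (auto simp: K_def)
  have stoch: "stochastic K ?D w"
    unfolding stochastic_def
  proof (intro conjI allI impI)
    fix i assume i: "i < K"
    have "(\<Sum>t\<in>set_pmf (?P (f i)). pmf (?P (f i)) t) = 1"
      using supp[OF R_states[OF f[OF i]]] by (simp add: sum_pmf_eq_1)
    then have "(\<Sum>j<K. real (w i j) / real ?D) = 1"
      using sum_w[OF i, of "\<lambda>_. 1" "\<lambda>_. 1"] by simp
    then have "real (\<Sum>j<K. w i j) = real ?D"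
      by (simp add: sum_divide_distrib[symmetric])
    then show "(\<Sum>j<K. w i j) = ?D" using of_nat_eq_iff by blast
  qed (use Kpos in auto)
  \<comment> \<open>An entry is a single original probability, never a sum of several, or it is 0,
    written as \<open>0 / 1\<close>.\<close>
  have "\<exists>a b. 0 < b \<and> b \<le> N \<and> w i j * b = a * ?D" if i: "i < K" for i j
  proof (cases "hit i j")
    case True
    let ?t = "succs (f i) ! (j mod N)"
    have "?t \<in> states C"
      using True succs(1)[OF f[OF i]] R_closed[OF f[OF i]] R_states by (force simp: hit_def)
    then obtain a b where b: "0 < b" "b \<le> N" "pmf (?P (f i)) ?t = real a / real b"
      using gran R_states[OF f[OF i]] unfolding granularity_le_def by blast
    then have "real (w i j * b) = real (a * ?D)"
      using True by (simp add: w[OF i])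
    then show ?thesis using b of_nat_eq_iff by blast
  next
    case False
    then show ?thesis using Npos by (intro exI[of _ 0] exI[of _ 1]) (auto simp: w_def)
  qed
  then obtain a b where ab: "\<And>i j. i < K \<Longrightarrow> 0 < b i j \<and> b i j \<le> N \<and> w i j * b i j = a i j * ?D"
    by metis
  define lab where "lab i = label C (f i) \<inter> atoms \<Phi>" for i
  \<comment> \<open>The proposition set \<open>A\<close> stays arbitrary, because the chain decoded
    from a certificate brings its own.\<close>
  have "sat (matrix_chain A K ?D w lab) i \<Phi>" if i: "i < K" for A i
  proof -
    let ?M = "matrix_chain A K ?D w lab"
    have "sat ?M i \<Phi> = sat C (f i) \<Phi>"
    proof (rule sat_transfer_aux[of "{..<K}" ?M C f "atoms \<Phi>" X, THEN conjunct1, rule_format])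
      fix j \<phi> assume j: "j \<in> {..<K}" and \<phi>: "\<phi> \<in> X"
      have "path_prob C (f (ix t * N + r)) \<phi> = path_prob C t \<phi>"
        if "t \<in> set_pmf (?P (f j))" "r < N" for t r
        using same[of t \<phi>] R_closed[OF f] j \<phi> that by (auto simp: f_def)
      then show "(\<Sum>t\<in>set_pmf (trans_prob ?M j). pmf (trans_prob ?M j) t * path_prob C (f t) \<phi>) =
          (\<Sum>t\<in>set_pmf (trans_prob C (f j)). pmf (trans_prob C (f j)) t * path_prob C t \<phi>)"
        using j sum_matrix_chain[OF stoch, of j A lab "\<lambda>t. path_prob C (f t) \<phi>"]
          sum_w[of j "\<lambda>t. path_prob C (f t) \<phi>" "\<lambda>t. path_prob C t \<phi>"] by simp
    qed (use set_pmf_matrix_chain[OF stoch] supp R_states f i fh in \<open>auto simp: lab_def X_def\<close>)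
    then show ?thesis using gs f[OF i] by (auto simp: R_def)
  qed
  moreover have "K \<le> N * (2 ^ n * (?D ^ n + 1) ^ n)"
    using T(2) by (simp add: K_def k_def mult.commute[of _ N])
  moreover have "granular N K ?D w a b" using ab by (auto simp: granular_def)
  moreover have "\<forall>i<K. lab i \<subseteq> atoms \<Phi>" by (auto simp: lab_def)
  ultimately show ?thesis using stoch by blast
qed


section \<open>The program\<close>

text \<open>Functions with several arguments take them as \<open>Dot x\<^sub>0 (Dot x\<^sub>1 \<dots>)\<close>, the last one without
  terminator. Numbers computed by the program are unary and denoted by the length of the right
  spine, whatever the left children are. A certificate is \<open>Dot D sts\<close>, where \<open>sts\<close> is a list of
  states, a state is \<open>Dot propositions row\<close>, and the \<open>j\<close>-th entry \<open>Dot w (Dot a b)\<close> of a row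
  claims that the probability of moving to the \<open>j\<close>-th state is \<open>w / D = a / b\<close>.
  The probability of a path formula is computed scaled by \<open>D ^ h\<close>, for any
  \<open>h\<close> not below its bound.\<close>

abbreviation "TrueE \<equiv> ConsE NilE NilE"
abbreviation "Arg0 \<equiv> CarE Param"
abbreviation "Arg1 \<equiv> CarE (CdrE Param)"
abbreviation "Arg2 \<equiv> CarE (CdrE (CdrE Param))"
abbreviation "Arg3 \<equiv> CarE (CdrE (CdrE (CdrE Param)))"
abbreviation "Rest1 \<equiv> CdrE Param"
abbreviation "Rest2 \<equiv> CdrE (CdrE Param)"
abbreviation "Rest3 \<equiv> CdrE (CdrE (CdrE Param))"
abbreviation "Rest4 \<equiv> CdrE (CdrE (CdrE (CdrE Param)))"

abbreviation "AppE a b \<equiv> Call 19 (ConsE a b)"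
abbreviation "MulE a b \<equiv> Call 2 (ConsE a b)"
abbreviation "PowE a b \<equiv> Call 3 (ConsE a b)"
abbreviation "LeqE a b \<equiv> Call 4 (ConsE a b)"
abbreviation "EqE a b \<equiv> Call 5 (ConsE a b)"
abbreviation "NatE a \<equiv> Call 6 a"
abbreviation "FlatE a \<equiv> Call 7 a"
abbreviation "MemE a b \<equiv> Call 8 (ConsE a b)"
abbreviation "SatE f s g \<equiv> Call 9 (ConsE f (ConsE s g))"
abbreviation "ProbE f s h g \<equiv> Call 10 (ConsE f (ConsE s (ConsE h g)))"
abbreviation "StepE f rs sts h g \<equiv> Call 11 (ConsE f (ConsE rs (ConsE sts (ConsE h g))))"
abbreviation "LinE sg ts s g \<equiv> Call 12 (ConsE sg (ConsE ts (ConsE s g)))"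
abbreviation "RowE rs sts d n \<equiv> Call 13 (ConsE rs (ConsE sts (ConsE d n)))"
abbreviation "RowSumE rs sts \<equiv> Call 14 (ConsE rs sts)"
abbreviation "ValidE todo sts d n \<equiv> Call 15 (ConsE todo (ConsE sts (ConsE d n)))"
abbreviation "AllE todo f g \<equiv> Call 16 (ConsE todo (ConsE f g))"
abbreviation "CheckE c z \<equiv> Call 17 (ConsE c z)"
abbreviation "SearchE st b z \<equiv> Call 18 (ConsE st (ConsE b z))"
abbreviation "StartE z \<equiv> Call 1 z"

text \<open>The formula travels with its node count and with \<open>N\<close>, both in unary. The
  node count bounds every horizon in the formula and can therefore serve as the exponent of
  \<open>D\<close>.\<close>

definition "main_body = StartE (ConsE Arg0 (ConsE (FlatE Arg0) (NatE Rest1)))"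
definition "app_body = IfE Arg0 (ConsE NilE (AppE (CdrE Arg0) Rest1)) Rest1"
definition "mul_body = IfE Arg0 (AppE Rest1 (MulE (CdrE Arg0) Rest1)) NilE"
definition "pow_body = IfE Rest1 (MulE Arg0 (PowE Arg0 (CdrE Rest1))) TrueE"
definition "leq_body = IfE Arg0 (IfE Rest1 (LeqE (CdrE Arg0) (CdrE Rest1)) NilE) TrueE"
definition "eq_body = IfE Arg0
  (IfE Rest1 (IfE (EqE (CarE Arg0) (CarE Rest1)) (EqE (CdrE Arg0) (CdrE Rest1)) NilE) NilE)
  (IfE Rest1 NilE TrueE)"
text \<open>Horner's rule with the least significant bit first; an encoded bit is itself the unary
  number 0 or 1.\<close>

definition "nat_body = IfE Param (AppE (CarE Param) (AppE (NatE (CdrE Param)) (NatE (CdrE Param)))) NilE"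
definition "flat_body =
  IfE Param (ConsE NilE (AppE (FlatE (CarE Param)) (FlatE (CdrE Param)))) TrueE"
definition "mem_body =
  IfE Rest1 (IfE (EqE Arg0 (CarE Rest1)) TrueE (MemE Arg0 (CdrE Rest1))) NilE"

abbreviation "SatArgE f \<equiv> SatE f Arg1 Rest2"
text \<open>Tags are unary numbers, so nested tests along the spine select the case. A linear
  constraint is multiplied by a power of \<open>D\<close>, and its negative terms are moved to the
  other side. The code of the comparison has length 1 for \<open>Gt\<close> and 0 for
  \<open>Ge\<close>; adding it to the side that has to be smaller reduces both to \<le>.\<close>

definition "sat_body =
  IfE (CarE Arg0)
    (IfE (CdrE (CarE Arg0))
      (IfE (CdrE (CdrE (CarE Arg0)))
        (IfE (CdrE (CdrE (CdrE (CarE Arg0))))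
          (LeqE
            (AppE (CarE (CdrE (CdrE Arg0)))
              (AppE (LinE TrueE (CarE (CdrE Arg0)) Arg1 Rest2)
                (IfE (CarE (CdrE (CdrE (CdrE Arg0)))) NilE
                  (MulE (NatE (CdrE (CdrE (CdrE (CdrE Arg0))))) (PowE Arg3 Arg2)))))
            (AppE (LinE NilE (CarE (CdrE Arg0)) Arg1 Rest2)
              (IfE (CarE (CdrE (CdrE (CdrE Arg0))))
                (MulE (NatE (CdrE (CdrE (CdrE (CdrE Arg0))))) (PowE Arg3 Arg2)) NilE)))
          (IfE (SatArgE (CarE (CdrE Arg0))) TrueE (SatArgE (CdrE (CdrE Arg0)))))
        (IfE (SatArgE (CarE (CdrE Arg0))) (SatArgE (CdrE (CdrE Arg0))) NilE))
      (IfE (MemE (CdrE Arg0) (CarE Arg1)) NilE TrueE))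
    (MemE (CdrE Arg0) (CarE Arg1))"

abbreviation "ProbPowE \<equiv> PowE (CarE (CdrE Rest3)) Arg2"
abbreviation "ProbStepE f \<equiv> StepE f (CdrE Arg1) (CdrE (CdrE Rest3)) (CdrE Arg2) Rest3"
text \<open>This follows \<open>verdict\<close>, with \<open>D ^ h\<close> for probability 1 and
  \<open>NilE\<close> for 0. In the undecided case the exponent passed on is one less, the missing
  factor \<open>D\<close> coming from the weights. Nested state formulas restart with the full
  exponent, which is kept in the last argument.\<close>

definition "prob_body =
  IfE (CarE Arg0)
    (IfE (SatE (CdrE (CdrE (CdrE Arg0))) Arg1 Rest3) ProbPowE
      (IfE (SatE (CarE (CdrE (CdrE Arg0))) Arg1 Rest3)
        (IfE (CdrE (CarE (CdrE Arg0)))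
          (ProbStepE (ConsE (CarE Arg0)
            (ConsE (ConsE NilE (CdrE (CdrE (CarE (CdrE Arg0))))) (CdrE (CdrE Arg0)))))
          (IfE (CdrE (CarE Arg0)) ProbPowE NilE))
        NilE))
    (IfE (CarE (CdrE Arg0))
      (ProbStepE (ConsE NilE (ConsE (CdrE (CarE (CdrE Arg0))) (CdrE (CdrE Arg0)))))
      (IfE (SatE (CdrE (CdrE Arg0)) Arg1 Rest3) ProbPowE NilE))"

definition "step_body =
  IfE Arg2
    (AppE (MulE (CarE (CarE Arg1)) (ProbE Arg0 (CarE Arg2) Arg3 Rest4))
      (StepE Arg0 (CdrE Arg1) (CdrE Arg2) Arg3 Rest4))
    NilE"

definition "lin_body =
  IfE Arg1
    (AppE
      (IfE (EqE Arg0 (CarE (CarE (CarE Arg1))))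
        (MulE (NatE (CdrE (CarE (CarE Arg1)))) (ProbE (CdrE (CarE Arg1)) Arg2 (CarE Rest3) Rest3))
        NilE)
      (LinE Arg0 (CdrE Arg1) Arg2 Rest3))
    NilE"

abbreviation "EntryWE \<equiv> CarE (CarE Arg0)"
abbreviation "EntryAE \<equiv> CarE (CdrE (CarE Arg0))"
abbreviation "EntryBE \<equiv> CdrE (CdrE (CarE Arg0))"
text \<open>The recursion follows the list of states, not the row. Entries missing from a short row
  read as \<open>Atom\<close>, so their denominator is 0 and the row is refused; surplus entries are
  never read.\<close>

definition "row_body =
  IfE Arg1
    (IfE EntryBE
      (IfE (LeqE EntryBE Rest3)
        (IfE (LeqE (MulE EntryWE EntryBE) (MulE EntryAE Arg2))
          (IfE (LeqE (MulE EntryAE Arg2) (MulE EntryWE EntryBE))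
            (RowE (CdrE Arg0) (CdrE Arg1) Arg2 Rest3)
            NilE)
          NilE)
        NilE)
      NilE)
    TrueE"
definition "rowsum_body = IfE Rest1 (AppE EntryWE (RowSumE (CdrE Arg0) (CdrE Rest1))) NilE"
definition "valid_body =
  IfE Arg0
    (IfE (RowE (CdrE (CarE Arg0)) Arg1 Arg2 Rest3)
      (IfE (LeqE (RowSumE (CdrE (CarE Arg0)) Arg1) Arg2)
        (IfE (LeqE Arg2 (RowSumE (CdrE (CarE Arg0)) Arg1))
          (ValidE (CdrE Arg0) Arg1 Arg2 Rest3)
          NilE)
        NilE)
      NilE)
    TrueE"
definition "all_body =
  IfE Arg0 (IfE (SatE Arg1 (CarE Arg0) Rest2) (AllE (CdrE Arg0) Arg1 Rest2) NilE) TrueE"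
definition "check_body =
  IfE (CarE Arg0)
    (IfE (CdrE Arg0)
      (IfE (ValidE (CdrE Arg0) (CdrE Arg0) (CarE Arg0) Rest3)
        (AllE (CdrE Arg0) Arg1 (ConsE Arg2 Arg0))
        NilE)
      NilE)
    NilE"
text \<open>The first argument is a stack of trees. Its top is tried as a certificate before the
  search branches on the next stack instruction; the second argument is the fuel.\<close>

definition "search_body =
  IfE (CheckE (CarE Arg0) Rest2) TrueE
    (IfE Arg1
      (IfE (SearchE (ConsE NilE Arg0) (CdrE Arg1) Rest2) TrueE
        (SearchE (ConsE (ConsE (CarE (CdrE Arg0)) (CarE Arg0)) (CdrE (CdrE Arg0))) (CdrE Arg1) Rest2))
      NilE)"
abbreviation "SizeE \<equiv> AppE Arg1 Rest2"
text \<open>The nested pairs are the unary number 5, so the fuel is \<open>u ^ (u ^ 5)\<close> with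
  \<open>u\<close> the formula size plus \<open>N\<close>; the exponent originates in
  \<open>small_model_bound\<close>.\<close>

definition "start_body =
  SearchE NilE
    (PowE SizeE (PowE SizeE (ConsE NilE (ConsE NilE (ConsE NilE (ConsE NilE TrueE))))))
    Param"

definition prog :: program where
  "prog = [main_body, start_body, mul_body, pow_body, leq_body, eq_body, nat_body, flat_body,
     mem_body, sat_body, prob_body, step_body, lin_body, row_body, rowsum_body, valid_body,
     all_body, check_body, search_body, app_body]"

lemma prog_nth [simp]:
  "prog ! 0 = main_body" "prog ! Suc 0 = start_body" "prog ! 2 = mul_body" "prog ! 3 = pow_body"
  "prog ! 4 = leq_body" "prog ! 5 = eq_body" "prog ! 6 = nat_body" "prog ! 7 = flat_body"
  "prog ! 8 = mem_body" "prog ! 9 = sat_body" "prog ! 10 = prob_body" "prog ! 11 = step_body"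
  "prog ! 12 = lin_body" "prog ! 13 = row_body" "prog ! 14 = rowsum_body" "prog ! 15 = valid_body"
  "prog ! 16 = all_body" "prog ! 17 = check_body" "prog ! 18 = search_body" "prog ! 19 = app_body"
  by (simp_all add: prog_def)

lemma length_prog [simp]: "length prog = 20"
  by (simp add: prog_def)

section \<open>Evaluation, values and running times\<close>

text \<open>Evaluation is deterministic, so each function of \<open>prog\<close> is a partial
  function with a cost. Separating domain, value and time lets the simplifier compute with calls
  instead of building derivations of \<open>evaluates\<close>.\<close>

definition fun_halts :: "nat \<Rightarrow> sexp \<Rightarrow> bool" where
  "fun_halts f y \<longleftrightarrow> (\<exists>v t. evaluates prog y (prog ! f) v t)"
definition fun_value :: "nat \<Rightarrow> sexp \<Rightarrow> sexp" where
  "fun_value f y = (THE v. \<exists>t. evaluates prog y (prog ! f) v t)"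
definition fun_time :: "nat \<Rightarrow> sexp \<Rightarrow> nat" where
  "fun_time f y = (THE t. \<exists>v. evaluates prog y (prog ! f) v t)"

text \<open>\<open>expr_value\<close> and \<open>expr_time\<close> are meaningful only where \<open>expr_halts\<close> holds.\<close>

primrec expr_value :: "expr \<Rightarrow> sexp \<Rightarrow> sexp" where
  "expr_value Param x = x"
| "expr_value NilE x = Atom"
| "expr_value (ConsE e1 e2) x = Dot (expr_value e1 x) (expr_value e2 x)"
| "expr_value (CarE e) x = car (expr_value e x)"
| "expr_value (CdrE e) x = cdr (expr_value e x)"
| "expr_value (IfE e1 e2 e3) x = (if expr_value e1 x = Atom then expr_value e3 x else expr_value e2 x)"
| "expr_value (Call f e) x = fun_value f (expr_value e x)"

primrec expr_time :: "expr \<Rightarrow> sexp \<Rightarrow> nat" where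
  "expr_time Param x = 1"
| "expr_time NilE x = 1"
| "expr_time (ConsE e1 e2) x = expr_time e1 x + expr_time e2 x + 1"
| "expr_time (CarE e) x = expr_time e x + 1"
| "expr_time (CdrE e) x = expr_time e x + 1"
| "expr_time (IfE e1 e2 e3) x =
     expr_time e1 x + (if expr_value e1 x = Atom then expr_time e3 x else expr_time e2 x) + 1"
| "expr_time (Call f e) x = expr_time e x + fun_time f (expr_value e x) + 1"

primrec expr_halts :: "expr \<Rightarrow> sexp \<Rightarrow> bool" where
  "expr_halts Param x \<longleftrightarrow> True"
| "expr_halts NilE x \<longleftrightarrow> True"
| "expr_halts (ConsE e1 e2) x \<longleftrightarrow> expr_halts e1 x \<and> expr_halts e2 x"
| "expr_halts (CarE e) x \<longleftrightarrow> expr_halts e x"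
| "expr_halts (CdrE e) x \<longleftrightarrow> expr_halts e x"
| "expr_halts (IfE e1 e2 e3) x \<longleftrightarrow>
     expr_halts e1 x \<and> (if expr_value e1 x = Atom then expr_halts e3 x else expr_halts e2 x)"
| "expr_halts (Call f e) x \<longleftrightarrow> expr_halts e x \<and> f < 20 \<and> fun_halts f (expr_value e x)"

lemma fun_eqI:
  assumes "evaluates prog y (prog ! f) v t"
  shows "fun_halts f y" "fun_value f y = v" "fun_time f y = t"
  using assms evaluates_deterministic[OF assms]
  unfolding fun_halts_def fun_value_def fun_time_def by blast+

lemma evaluates_expr: "expr_halts e x \<Longrightarrow> evaluates prog x e (expr_value e x) (expr_time e x)"
proof (induction e)
  case (IfE e1 e2 e3)
  then show ?case using evaluates.intros(6,7)[of prog x e1] by auto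
next
  case (Call f e)
  then obtain v t where vt: "evaluates prog (expr_value e x) (prog ! f) v t"
    by (auto simp: fun_halts_def)
  show ?case
    unfolding expr_value.simps expr_time.simps fun_eqI(2,3)[OF vt]
    by (rule evaluates.intros(8)[OF _ _ vt]) (use Call in auto)
qed (simp_all only: expr_value.simps expr_time.simps expr_halts.simps evaluates.intros)

text \<open>A total-correctness triple with a time bound. Callers see a function only through
  \<open>Q\<close> and \<open>T\<close>, so for mutually recursive functions such triples can be
  assumed as hypotheses.\<close>

definition spec :: "nat \<Rightarrow> sexp \<Rightarrow> (sexp \<Rightarrow> bool) \<Rightarrow> nat \<Rightarrow> bool" where
  "spec f x Q T \<longleftrightarrow> fun_halts f x \<and> Q (fun_value f x) \<and> fun_time f x \<le> T"

lemma specI: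
  assumes "prog ! f = b" "expr_halts b x" "Q (expr_value b x)" "expr_time b x \<le> T"
  shows "spec f x Q T"
  using assms fun_eqI[of x f "expr_value b x" "expr_time b x"] evaluates_expr[of b x]
  by (simp add: spec_def)

lemma specD:
  assumes "spec f x Q T"
  shows "fun_halts f x" "Q (fun_value f x)" "fun_time f x \<le> T"
  using assms by (auto simp: spec_def)

lemma spec_mono: "spec f x Q T \<Longrightarrow> (\<And>v. Q v \<Longrightarrow> Q' v) \<Longrightarrow> T \<le> T' \<Longrightarrow> spec f x Q' T'"
  by (auto simp: spec_def)

fun len :: "sexp \<Rightarrow> nat" where
  "len Atom = 0"
| "len (Dot a b) = Suc (len b)"

lemma len_eq_0 [simp]: "len x = 0 \<longleftrightarrow> x = Atom"
  by (cases x) auto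

lemma len_pos: "x \<noteq> Atom \<Longrightarrow> 0 < len x"
  by (cases x) auto

lemma len_le_nodes: "len x < nodes x"
  by (induction x) auto

lemma len_cdr: "len (cdr x) = len x - 1"
  by (cases x) auto

fun elems :: "sexp \<Rightarrow> sexp list" where
  "elems Atom = []"
| "elems (Dot a b) = a # elems b"

lemma length_elems [simp]: "length (elems x) = len x"
  by (induction x) auto

lemma elems_enc_list [simp]: "elems (enc_list xs) = xs"
  by (induction xs) auto

lemma len_enc_list [simp]: "len (enc_list xs) = length xs"
  by (induction xs) auto

lemma len_enc_unary [simp]: "len (enc_unary n) = n"
  by (simp add: enc_unary_def)

section \<open>Arithmetic and lists\<close>

lemma spec_app: "spec 19 (Dot a b) (\<lambda>v. len v = len a + len b) (12 * len a + 5)"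
proof (induction a)
  case Atom
  show ?case by (rule specI) (auto simp: app_body_def cong: if_cong split: if_splits)
next
  case (Dot l r)
  note IH = specD[OF Dot(2)]
  show ?case by (rule specI) (use IH in \<open>auto simp: app_body_def cong: if_cong split: if_splits\<close>)
qed

lemmas app_halts [simp] = specD(1)[OF spec_app]
lemmas app_len [simp] = specD(2)[OF spec_app]
lemmas app_time = specD(3)[OF spec_app]

lemma spec_mul: "spec 2 (Dot a b) (\<lambda>v. len v = len a * len b) (len a * (12 * len b + 20) + 5)"
proof (induction a)
  case Atom
  show ?case by (rule specI) (auto simp: mul_body_def cong: if_cong split: if_splits)
next
  case (Dot l r)
  note IH = specD[OF Dot(2)]
  show ?case
    by (rule specI)
      (use IH app_time[of b "fun_value 2 (Dot r b)"] in \<open>auto simp: mul_body_def algebra_simps cong: if_cong split: if_splits\<close>)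
qed

lemmas mul_halts [simp] = specD(1)[OF spec_mul]
lemmas mul_len [simp] = specD(2)[OF spec_mul]
lemmas mul_time = specD(3)[OF spec_mul]

text \<open>The base \<open>len a + 1\<close> makes powers increase with the exponent even when
  \<open>len a = 0\<close>; the factor \<open>len h + 1\<close> counts the calls.\<close>

lemma spec_pow:
  "spec 3 (Dot a h) (\<lambda>v. len v = len a ^ len h) (60 * (len h + 1) * (len a + 1) ^ (len h + 1))"
proof (induction h)
  case Atom
  show ?case by (rule specI) (auto simp: pow_body_def cong: if_cong split: if_splits)
next
  case (Dot l r)
  note IH = specD[OF Dot(2)]
  let ?A = "len a + 1"
  have a: "len a * len a ^ len r \<le> ?A ^ (len r + 1)"
    by (metis Suc_eq_plus1 le_add1 power_Suc power_mono zero_le)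
  have b: "?A ^ (len r + 1) \<le> ?A ^ (len r + 2)" by (intro power_increasing) auto
  have c: "len a + 1 \<le> ?A ^ (len r + 1)"
    using power_increasing[of 1 "len r + 1" ?A] by simp
  have "fun_time 2 (Dot a (fun_value 3 (Dot a r))) \<le> 12 * (len a * len a ^ len r) + 20 * len a + 5"
    using mul_time[of a "fun_value 3 (Dot a r)"] IH by (simp add: algebra_simps)
  also have "\<dots> \<le> 32 * ?A ^ (len r + 2) + 5" using a b c by linarith
  finally have m: "fun_time 2 (Dot a (fun_value 3 (Dot a r))) \<le> 32 * ?A ^ (len r + 2) + 5" .
  have d: "(len r + 1) * ?A ^ (len r + 1) \<le> (len r + 1) * ?A ^ (len r + 2)"
    using b by (rule mult_le_mono2)
  have e: "1 \<le> ?A ^ (len r + 2)" by (rule one_le_power) simp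
  have f: "60 * (len (Dot l r) + 1) * ?A ^ (len (Dot l r) + 1) =
      60 * ((len r + 1) * ?A ^ (len r + 2)) + 60 * ?A ^ (len r + 2)"
    by (simp add: algebra_simps)
  show ?case
  proof (rule specI)
    have "expr_time pow_body (Dot a (Dot l r)) \<le> fun_time 3 (Dot a r) + 20 +
        fun_time 2 (Dot a (fun_value 3 (Dot a r)))"
      by (simp add: pow_body_def)
    also have "\<dots> \<le> 60 * (len (Dot l r) + 1) * ?A ^ (len (Dot l r) + 1)"
      unfolding f using m d e IH(3) by linarith
    finally show "expr_time pow_body (Dot a (Dot l r)) \<le>
        60 * (len (Dot l r) + 1) * ?A ^ (len (Dot l r) + 1)" .
  qed (use IH in \<open>auto simp: pow_body_def cong: if_cong split: if_splits\<close>)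
qed

lemmas pow_halts [simp] = specD(1)[OF spec_pow]
lemmas pow_len [simp] = specD(2)[OF spec_pow]
lemmas pow_time = specD(3)[OF spec_pow]

lemma spec_leq: "spec 4 (Dot a b) (\<lambda>v. v \<noteq> Atom \<longleftrightarrow> len a \<le> len b) (20 * len a + 10)"
proof (induction a arbitrary: b)
  case Atom
  show ?case by (rule specI) (auto simp: leq_body_def cong: if_cong split: if_splits)
next
  case (Dot l r)
  note IH = specD[OF Dot(2)]
  show ?case
  proof (cases b)
    case Atom
    show ?thesis by (rule specI) (auto simp: leq_body_def Atom cong: if_cong split: if_splits)
  next
    case (Dot c d)
    show ?thesis by (rule specI) (use IH[of d] in \<open>auto simp: leq_body_def Dot cong: if_cong split: if_splits\<close>)
  qed
qed

lemmas leq_halts [simp] = specD(1)[OF spec_leq]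
lemmas leq_value = specD(2)[OF spec_leq]
lemmas leq_time = specD(3)[OF spec_leq]

lemma leq_Atom [simp]: "fun_value 4 (Dot a b) = Atom \<longleftrightarrow> \<not> len a \<le> len b"
  using leq_value by blast

lemma spec_eq: "spec 5 (Dot a b) (\<lambda>v. v \<noteq> Atom \<longleftrightarrow> a = b) (40 * nodes a)"
proof (induction a arbitrary: b)
  case Atom
  show ?case by (rule specI) (auto simp: eq_body_def cong: if_cong split: if_splits)
next
  case (Dot l r)
  note IHl = specD[OF Dot(1)] and IHr = specD[OF Dot(2)]
  show ?case
  proof (cases b)
    case Atom
    show ?thesis by (rule specI) (auto simp: eq_body_def Atom cong: if_cong split: if_splits)
  next
    case (Dot c d)
    show ?thesis
      by (rule specI) (use IHl[of c] IHr[of d] in \<open>auto simp: eq_body_def Dot cong: if_cong split: if_splits\<close>)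
  qed
qed

lemmas eq_halts [simp] = specD(1)[OF spec_eq]
lemmas eq_value = specD(2)[OF spec_eq]
lemmas eq_time = specD(3)[OF spec_eq]

lemma eq_Atom [simp]: "fun_value 5 (Dot a b) = Atom \<longleftrightarrow> a \<noteq> b"
  using eq_value by blast

section \<open>Binary numerals, node counts and membership\<close>

fun bits_value :: "bool list \<Rightarrow> nat" where
  "bits_value [] = 0"
| "bits_value (b # bs) = of_bool b + 2 * bits_value bs"

lemma bits_value_nat_bits: "bits_value (nat_bits n) = n"
proof (induction n rule: less_induct)
  case (less n)
  show ?case
  proof (cases "n = 0")
    case False
    then have "bits_value (nat_bits n) = of_bool (odd n) + 2 * (n div 2)"
      using less[of "n div 2"] by (simp add: nat_bits.simps[of n])
    then show ?thesis by (metis mod_2_eq_odd mod_mult_div_eq add.commute)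
  qed (simp add: nat_bits.simps)
qed

lemma bits_value_less: "bits_value bs < 2 ^ length bs"
  by (induction bs) auto

text \<open>Doubling evaluates the recursive call twice, so the number of calls is exponential in
  the number of bits. Base 4 leaves room for the unary values, which stay below
  \<open>2 ^ length bs\<close>.\<close>

lemma spec_nat_aux:
  "spec 6 (enc_list (map enc_bool bs)) (\<lambda>v. len v = bits_value bs) (50 * 4 ^ length bs)"
proof (induction bs)
  case Nil
  show ?case by (rule specI) (auto simp: nat_body_def cong: if_cong split: if_splits)
next
  case (Cons b bs)
  note IH = specD[OF Cons]
  let ?x = "enc_list (map enc_bool bs)"
  have "(2::nat) ^ length bs \<le> 4 ^ length bs" by (intro power_mono) auto
  with bits_value_less[of bs] have l: "bits_value bs \<le> 4 ^ length bs" by linarith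
  have o: "(1::nat) \<le> 4 ^ length bs" by simp
  have a1: "fun_time 19 (Dot (fun_value 6 ?x) (fun_value 6 ?x)) \<le> 12 * bits_value bs + 5"
    using app_time[of "fun_value 6 ?x" "fun_value 6 ?x"] IH by simp
  have a2: "fun_time 19 (Dot (enc_bool b) z) \<le> 17" for z
    using app_time[of "enc_bool b" z] by (cases b) (simp_all add: enc_bool_def)
  show ?case
  proof (rule specI)
    have "expr_time nat_body (enc_list (map enc_bool (b # bs))) \<le> 2 * (50 * 4 ^ length bs) + 12 * bits_value bs + 40"
      using IH(3) a1 a2[of "fun_value 19 (Dot (fun_value 6 ?x) (fun_value 6 ?x))"]
      by (simp add: nat_body_def)
    also have "\<dots> \<le> 50 * 4 ^ length (b # bs)"
      unfolding list.size power_Suc add_Suc_right add_0_right using l o by linarith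
    finally show "expr_time nat_body (enc_list (map enc_bool (b # bs))) \<le> 50 * 4 ^ length (b # bs)" .
  qed (use IH in \<open>auto simp: nat_body_def enc_bool_def cong: if_cong split: if_splits\<close>)
qed

lemma spec_nat: "spec 6 (enc_nat n) (\<lambda>v. len v = n) (50 * 4 ^ nodes (enc_nat n))"
proof -
  have "length (nat_bits n) \<le> nodes (enc_nat n)"
    by (simp add: enc_nat_def nodes_enc_list)
  then have "(4::nat) ^ length (nat_bits n) \<le> 4 ^ nodes (enc_nat n)"
    by (intro power_increasing) auto
  then show ?thesis
    unfolding enc_nat_def
    by (intro spec_mono[OF spec_nat_aux]) (simp_all add: bits_value_nat_bits)
qed

lemmas nat_halts [simp] = specD(1)[OF spec_nat]
lemmas nat_len [simp] = specD(2)[OF spec_nat]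
lemmas nat_time = specD(3)[OF spec_nat]

lemma spec_flat: "spec 7 x (\<lambda>v. len v = nodes x) (40 * nodes x ^ 2)"
proof (induction x)
  case Atom
  show ?case by (rule specI) (auto simp: flat_body_def cong: if_cong split: if_splits)
next
  case (Dot l r)
  note IHl = specD[OF Dot(1)] and IHr = specD[OF Dot(2)]
  show ?case
    by (rule specI)
      (use IHl IHr app_time[of "fun_value 7 l" "fun_value 7 r"] nodes_pos[of l] in
        \<open>auto simp: flat_body_def power2_eq_square algebra_simps cong: if_cong split: if_splits\<close>)
qed

lemmas flat_halts [simp] = specD(1)[OF spec_flat]
lemmas flat_len [simp] = specD(2)[OF spec_flat]
lemmas flat_time = specD(3)[OF spec_flat]

lemma spec_mem:
  "spec 8 (Dot a l) (\<lambda>v. v \<noteq> Atom \<longleftrightarrow> a \<in> set (elems l)) (len l * (40 * nodes a + 40) + 5)"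
proof (induction l)
  case Atom
  show ?case by (rule specI) (auto simp: mem_body_def cong: if_cong split: if_splits)
next
  case (Dot x r)
  note IH = specD[OF Dot(2)]
  show ?case
    by (rule specI) (use IH eq_time[of a x] in \<open>auto simp: mem_body_def algebra_simps cong: if_cong split: if_splits\<close>)
qed

lemmas mem_halts [simp] = specD(1)[OF spec_mem]
lemmas mem_value = specD(2)[OF spec_mem]
lemmas mem_time = specD(3)[OF spec_mem]

lemma mem_Atom [simp]: "fun_value 8 (Dot a l) = Atom \<longleftrightarrow> a \<notin> set (elems l)"
  using mem_value by blast


section \<open>Checking a certificate\<close>

text \<open>Reading past the end of a row yields \<open>Atom\<close>, hence the number 0 for all
  three components, just as the selectors of the program do.\<close>

primrec entry :: "sexp \<Rightarrow> nat \<Rightarrow> sexp" where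
  "entry r 0 = car r"
| "entry r (Suc j) = entry (cdr r) j"

definition entry_w :: "sexp \<Rightarrow> nat \<Rightarrow> nat" where "entry_w r j = len (car (entry r j))"
definition entry_a :: "sexp \<Rightarrow> nat \<Rightarrow> nat" where "entry_a r j = len (car (cdr (entry r j)))"
definition entry_b :: "sexp \<Rightarrow> nat \<Rightarrow> nat" where "entry_b r j = len (cdr (cdr (entry r j)))"

lemma entry_simps [simp]:
  "entry_w r 0 = len (car (car r))" "entry_w r (Suc j) = entry_w (cdr r) j"
  "entry_a r 0 = len (car (cdr (car r)))" "entry_a r (Suc j) = entry_a (cdr r) j"
  "entry_b r 0 = len (cdr (cdr (car r)))" "entry_b r (Suc j) = entry_b (cdr r) j"
  by (simp_all add: entry_w_def entry_a_def entry_b_def)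

lemma nodes_car: "nodes (car x) \<le> nodes x" and nodes_cdr: "nodes (cdr x) \<le> nodes x"
  by (cases x; simp)+

lemma len_bound:
  assumes "nodes r \<le> B"
  shows "len r \<le> B" "len (car (car r)) \<le> B" "len (car (cdr (car r))) \<le> B" "len (cdr (cdr (car r))) \<le> B"
  using assms len_le_nodes[of r] len_le_nodes[of "car (car r)"] len_le_nodes[of "car (cdr (car r))"]
    len_le_nodes[of "cdr (cdr (car r))"] nodes_car[of r] nodes_car[of "car r"] nodes_cdr[of "car r"]
    nodes_car[of "cdr (car r)"] nodes_cdr[of "cdr (car r)"]
  by linarith+

lemma entry_w_le: "nodes r \<le> B \<Longrightarrow> entry_w r j \<le> B"
proof (induction j arbitrary: r)
  case 0
  then show ?case using len_bound(2)[of r B] by simp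
next
  case (Suc j)
  then show ?case using nodes_cdr[of r] by simp
qed

definition row_ok :: "nat \<Rightarrow> nat \<Rightarrow> nat \<Rightarrow> sexp \<Rightarrow> bool" where
  "row_ok K D N r \<longleftrightarrow>
     (\<forall>j<K. 0 < entry_b r j \<and> entry_b r j \<le> N \<and> entry_w r j * entry_b r j = entry_a r j * D)"

lemma row_ok_0 [simp]: "row_ok 0 D N r"
  by (simp add: row_ok_def)

lemma row_ok_Suc: "row_ok (Suc K) D N r \<longleftrightarrow>
    0 < len (cdr (cdr (car r))) \<and> len (cdr (cdr (car r))) \<le> N \<and>
    len (car (car r)) * len (cdr (cdr (car r))) = len (car (cdr (car r))) * D \<and> row_ok K D N (cdr r)"
  by (auto simp: row_ok_def All_less_Suc2)

lemma mul_time_le: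
  assumes "len a \<le> B" "len b \<le> V"
  shows "fun_time 2 (Dot a b) \<le> 32 * ((B + 1) * (V + 1))" "len a * len b \<le> (B + 1) * (V + 1)"
proof -
  have ab: "len a * len b \<le> B * V" using assms by (rule mult_le_mono)
  have "fun_time 2 (Dot a b) \<le> 12 * (len a * len b) + 20 * len a + 5"
    using mul_time[of a b] by (simp add: algebra_simps)
  also have "\<dots> \<le> 12 * (B * V) + 20 * B + 5" using ab assms(1) by linarith
  also have "\<dots> \<le> 32 * ((B + 1) * (V + 1))" by (simp add: algebra_simps)
  finally show "fun_time 2 (Dot a b) \<le> 32 * ((B + 1) * (V + 1))" .
  show "len a * len b \<le> (B + 1) * (V + 1)" using ab by (simp add: algebra_simps)
qed

lemma spec_row:
  assumes "nodes r \<le> B" "len d \<le> B"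
  shows "spec 13 (Dot r (Dot sts (Dot d n))) (\<lambda>v. v \<noteq> Atom \<longleftrightarrow> row_ok (len sts) (len d) (len n) r)
    ((len sts + 1) * (400 * ((B + 1) * (B + 1))))"
  using assms(1)
proof (induction sts arbitrary: r)
  case Atom
  show ?case by (rule specI) (auto simp: row_body_def cong: if_cong split: if_splits)
next
  case (Dot s sts)
  have "nodes (cdr r) \<le> B" using Dot.prems nodes_cdr[of r] by simp
  note IH = specD[OF Dot.IH(2)[OF this]]
  let ?w = "car (car r)" and ?a = "car (cdr (car r))" and ?b = "cdr (cdr (car r))"
  note le = len_bound[OF Dot.prems]
  have 1: "20 * B + 10 \<le> 20 * ((B + 1) * (B + 1))" by (simp add: algebra_simps)
  have 2: "1 \<le> (B + 1) * (B + 1)" by simp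
  note t1 = mul_time_le[OF le(2) le(4)] and t2 = mul_time_le[OF le(3) assms(2)]
  have t3: "fun_time 4 (Dot ?b n) \<le> 20 * ((B + 1) * (B + 1))"
    using leq_time[of ?b n] le(4) 1 by linarith
  have t4: "fun_time 4 (Dot (fun_value 2 (Dot ?w ?b)) (fun_value 2 (Dot ?a d))) \<le> 30 * ((B + 1) * (B + 1))"
    using leq_time[of "fun_value 2 (Dot ?w ?b)" "fun_value 2 (Dot ?a d)"] t1(2) 2
    by (simp only: mul_len)
  have t5: "fun_time 4 (Dot (fun_value 2 (Dot ?a d)) (fun_value 2 (Dot ?w ?b))) \<le> 30 * ((B + 1) * (B + 1))"
    using leq_time[of "fun_value 2 (Dot ?a d)" "fun_value 2 (Dot ?w ?b)"] t2(2) 2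
    by (simp only: mul_len)
  have "(len (Dot s sts) + 1) * (400 * ((B + 1) * (B + 1))) =
      (len sts + 1) * (400 * ((B + 1) * (B + 1))) + 400 * ((B + 1) * (B + 1))"
    by (simp add: algebra_simps)
  moreover have "expr_time row_body (Dot r (Dot (Dot s sts) (Dot d n))) \<le>
      120 + fun_time 13 (Dot (cdr r) (Dot sts (Dot d n))) + fun_time 4 (Dot ?b n) +
      2 * fun_time 2 (Dot ?w ?b) + 2 * fun_time 2 (Dot ?a d) +
      fun_time 4 (Dot (fun_value 2 (Dot ?w ?b)) (fun_value 2 (Dot ?a d))) +
      fun_time 4 (Dot (fun_value 2 (Dot ?a d)) (fun_value 2 (Dot ?w ?b)))"
    by (simp add: row_body_def cong: if_cong)
  ultimately have time: "expr_time row_body (Dot r (Dot (Dot s sts) (Dot d n))) \<le>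
      (len (Dot s sts) + 1) * (400 * ((B + 1) * (B + 1)))"
    using IH(3) t1(1) t2(1) t3 t4 t5 2 by linarith
  show ?case
    by (rule specI[OF _ _ _ time])
      (use IH(1,2) in \<open>auto simp: row_body_def row_ok_Suc len_pos cong: if_cong split: if_splits\<close>)
qed

lemma spec_rowsum:
  assumes "nodes r \<le> B"
  shows "spec 14 (Dot r sts) (\<lambda>v. len v = (\<Sum>j<len sts. entry_w r j)) ((len sts + 1) * (40 * (B + 1)))"
  using assms
proof (induction sts arbitrary: r)
  case Atom
  show ?case by (rule specI) (auto simp: rowsum_body_def)
next
  case (Dot s sts)
  have "nodes (cdr r) \<le> B" using Dot.prems nodes_cdr[of r] by simp
  note IH = specD[OF Dot.IH(2)[OF this]]
  show ?case
    by (rule specI)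
      (use IH app_time[of "car (car r)" "fun_value 14 (Dot (cdr r) sts)"] len_bound(2)[OF Dot.prems]
        in \<open>auto simp: rowsum_body_def sum.lessThan_Suc_shift simp del: sum.lessThan_Suc\<close>)
qed

definition rows_valid :: "nat \<Rightarrow> nat \<Rightarrow> nat \<Rightarrow> sexp list \<Rightarrow> bool" where
  "rows_valid K D N ss \<longleftrightarrow> (\<forall>s\<in>set ss. row_ok K D N (cdr s) \<and> (\<Sum>j<K. entry_w (cdr s) j) = D)"

lemma spec_valid:
  assumes "nodes todo \<le> B" "len d \<le> B"
  shows "spec 15 (Dot todo (Dot sts (Dot d n)))
    (\<lambda>v. v \<noteq> Atom \<longleftrightarrow> rows_valid (len sts) (len d) (len n) (elems todo))
    ((len todo + 1) * ((len sts + 1) * (700 * ((B + 1) * (B + 1)))))"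
  using assms(1)
proof (induction todo)
  case Atom
  show ?case by (rule specI) (auto simp: valid_body_def rows_valid_def cong: if_cong split: if_splits)
next
  case (Dot s todo)
  have n: "nodes todo \<le> B" "nodes (cdr s) \<le> B"
    using Dot.prems nodes_cdr[of s] by auto
  note IH = specD[OF Dot.IH(2)[OF n(1)]]
  note r = specD[OF spec_row[OF n(2) assms(2), of sts n]] and q = specD[OF spec_rowsum[OF n(2), of sts]]
  let ?q = "fun_value 14 (Dot (cdr s) sts)"
  let ?X = "(len sts + 1) * ((B + 1) * (B + 1))"
  have s: "(\<Sum>j<len sts. entry_w (cdr s) j) \<le> len sts * B"
    using sum_bounded_above[of "{..<len sts}" "entry_w (cdr s)" B] entry_w_le[OF n(2)] by simp
  have X: "len sts * B \<le> ?X" "(len sts + 1) * (B + 1) \<le> ?X" "1 \<le> ?X" "B \<le> ?X"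
    by (simp_all add: algebra_simps)
  have t1: "fun_time 4 (Dot ?q d) \<le> 30 * ?X"
    using leq_time[of ?q d] q(2) s X by simp
  have t2: "fun_time 4 (Dot d ?q) \<le> 30 * ?X"
    using leq_time[of d ?q] assms(2) X by linarith
  have t3: "fun_time 13 (Dot (cdr s) (Dot sts (Dot d n))) \<le> 400 * ?X"
    using r(3) by (simp add: algebra_simps)
  have t4: "fun_time 14 (Dot (cdr s) sts) \<le> 40 * ?X"
  proof -
    have "(len sts + 1) * (40 * (B + 1)) = 40 * ((len sts + 1) * (B + 1))" by (simp add: algebra_simps)
    then show ?thesis using q(3) X(2) by linarith
  qed
  have "(len (Dot s todo) + 1) * ((len sts + 1) * (700 * ((B + 1) * (B + 1)))) =
      (len todo + 1) * ((len sts + 1) * (700 * ((B + 1) * (B + 1)))) + 700 * ?X"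
    by (simp add: algebra_simps)
  moreover have "expr_time valid_body (Dot (Dot s todo) (Dot sts (Dot d n))) \<le>
      100 + fun_time 15 (Dot todo (Dot sts (Dot d n))) + fun_time 13 (Dot (cdr s) (Dot sts (Dot d n))) +
      2 * fun_time 14 (Dot (cdr s) sts) + fun_time 4 (Dot ?q d) + fun_time 4 (Dot d ?q)"
    by (simp add: valid_body_def cong: if_cong)
  ultimately have time: "expr_time valid_body (Dot (Dot s todo) (Dot sts (Dot d n))) \<le>
      (len (Dot s todo) + 1) * ((len sts + 1) * (700 * ((B + 1) * (B + 1))))"
    using IH(3) t1 t2 t3 t4 X(3) by linarith
  show ?case
    by (rule specI[OF _ _ _ time])
      (use IH(1,2) r(1,2) q(1,2) in
        \<open>auto simp: valid_body_def rows_valid_def cong: if_cong split: if_splits\<close>)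
qed

text \<open>Functions 9 to 12 call each other. The specification of the inner call to 10 is
  therefore a hypothesis, discharged later by the induction on formula size; \<open>V\<close> bounds
  its values so that the products can be charged.\<close>

lemma spec_step:
  assumes "nodes r \<le> B"
    and "\<And>j. j < len sts \<Longrightarrow> spec 10 (Dot f (Dot (elems sts ! j) (Dot h g))) (\<lambda>v. len v = q j \<and> q j \<le> V) T"
  shows "spec 11 (Dot f (Dot r (Dot sts (Dot h g)))) (\<lambda>v. len v = (\<Sum>j<len sts. entry_w r j * q j))
    ((len sts + 1) * (T + 200 * ((B + 1) * (V + 1))))"
  using assms
proof (induction sts arbitrary: r q)
  case Atom
  show ?case by (rule specI) (auto simp: step_body_def cong: if_cong split: if_splits)
next
  case (Dot s sts)
  have n: "nodes (cdr r) \<le> B" using Dot.prems(1) nodes_cdr[of r] by simp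
  have "spec 10 (Dot f (Dot (elems sts ! j) (Dot h g))) (\<lambda>v. len v = q (Suc j) \<and> q (Suc j) \<le> V) T"
    if "j < len sts" for j using Dot.prems(2)[of "Suc j"] that by simp
  then have "spec 11 (Dot f (Dot (cdr r) (Dot sts (Dot h g)))) (\<lambda>v. len v = (\<Sum>j<len sts. entry_w (cdr r) j * q (Suc j)))
      ((len sts + 1) * (T + 200 * ((B + 1) * (V + 1))))"
    by (rule Dot.IH(2)[OF n])
  note IH = specD[OF this]
  note p = specD[OF Dot.prems(2)[of 0, simplified]]
  let ?p = "fun_value 10 (Dot f (Dot s (Dot h g)))"
  let ?X = "(B + 1) * (V + 1)"
  have t1: "fun_time 2 (Dot (car (car r)) ?p) \<le> 32 * ?X" "len (car (car r)) * len ?p \<le> ?X"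
    using mul_time_le[OF len_bound(2)[OF Dot.prems(1)], of ?p V] p by auto
  have X: "1 \<le> ?X" by simp
  have t2: "fun_time 19 (Dot (fun_value 2 (Dot (car (car r)) ?p)) z) \<le> 17 * ?X" for z
    using app_time[of "fun_value 2 (Dot (car (car r)) ?p)" z] t1(2) X unfolding mul_len by linarith
  have "(len (Dot s sts) + 1) * (T + 200 * ?X) = (len sts + 1) * (T + 200 * ?X) + (T + 200 * ?X)"
    by (simp add: algebra_simps)
  moreover have "expr_time step_body (Dot f (Dot r (Dot (Dot s sts) (Dot h g)))) \<le>
      70 + fun_time 11 (Dot f (Dot (cdr r) (Dot sts (Dot h g)))) + fun_time 10 (Dot f (Dot s (Dot h g))) +
      fun_time 2 (Dot (car (car r)) ?p) + 17 * ?X"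
    using t2[of "fun_value 11 (Dot f (Dot (cdr r) (Dot sts (Dot h g))))"]
    by (simp add: step_body_def cong: if_cong)
  ultimately have time: "expr_time step_body (Dot f (Dot r (Dot (Dot s sts) (Dot h g)))) \<le>
      (len (Dot s sts) + 1) * (T + 200 * ?X)"
    using IH(3) p(3) t1(1) X by linarith
  show ?case
    by (rule specI[OF _ _ _ time])
      (use IH(1,2) p(1,2) in
        \<open>auto simp: step_body_def sum.lessThan_Suc_shift simp del: sum.lessThan_Suc\<close>)
qed

section \<open>Integer coefficients and linear sums\<close>

lemma nodes_enc_int_bounds:
  assumes "nodes (enc_int c) \<le> n"
  shows "nat \<bar>c\<bar> \<le> 4 ^ n" "fun_time 6 (enc_nat (nat \<bar>c\<bar>)) \<le> 50 * 4 ^ n"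
proof -
  let ?k = "nat \<bar>c\<bar>"
  have n: "nodes (enc_nat ?k) \<le> n" using assms by (simp add: enc_int_def)
  have "length (nat_bits ?k) \<le> n" using n by (simp add: enc_nat_def nodes_enc_list)
  then have "(2::nat) ^ length (nat_bits ?k) \<le> 2 ^ n" by (intro power_increasing) auto
  also have "\<dots> \<le> 4 ^ n" by (intro power_mono) auto
  finally show "?k \<le> 4 ^ n" using bits_value_less[of "nat_bits ?k"] unfolding bits_value_nat_bits by linarith
  have "(4::nat) ^ nodes (enc_nat ?k) \<le> 4 ^ n" using n by (intro power_increasing) auto
  then show "fun_time 6 (enc_nat ?k) \<le> 50 * 4 ^ n" using nat_time[of ?k] by linarith
qed

abbreviation enc_term :: "int \<times> pform \<Rightarrow> sexp" where
  "enc_term \<equiv> \<lambda>(c, \<phi>). Dot (enc_int c) (enc_pform \<phi>)"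

text \<open>The program has natural numbers only. Coefficients of either sign are summed separately,
  and the linear combination is the difference of the two sums.\<close>

definition signed_sum :: "bool \<Rightarrow> (pform \<Rightarrow> nat) \<Rightarrow> (int \<times> pform) list \<Rightarrow> nat" where
  "signed_sum sg q ts = (\<Sum>(c, \<phi>)\<leftarrow>ts. if sg = (c < 0) then nat \<bar>c\<bar> * q \<phi> else 0)"

lemma signed_sum_simps [simp]:
  "signed_sum sg q [] = 0"
  "signed_sum sg q ((c, \<phi>) # ts) = (if sg = (c < 0) then nat \<bar>c\<bar> * q \<phi> else 0) + signed_sum sg q ts"
  by (simp_all add: signed_sum_def)

lemma signed_sum_diff:
  "(\<Sum>(c, \<phi>)\<leftarrow>ts. real_of_int c * real (q \<phi>)) = real (signed_sum False q ts) - real (signed_sum True q ts)"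
  by (induction ts) (auto simp: algebra_simps)

lemma spec_lin:
  assumes "\<And>c \<phi>. (c, \<phi>) \<in> set ts \<Longrightarrow>
      spec 10 (Dot (enc_pform \<phi>) (Dot s (Dot h (Dot h x)))) (\<lambda>v. len v = q \<phi> \<and> q \<phi> \<le> V) T \<and> nodes (enc_int c) \<le> n"
  shows "spec 12 (Dot (enc_bool sg) (Dot (enc_list (map enc_term ts)) (Dot s (Dot h x))))
    (\<lambda>v. len v = signed_sum sg q ts \<and> len v \<le> length ts * ((4 ^ n + 1) * (V + 1)))
    ((length ts + 1) * (T + 400 * ((4 ^ n + 1) * (V + 1))))"
  using assms
proof (induction ts)
  case Nil
  show ?case by (rule specI) (auto simp: lin_body_def cong: if_cong split: if_splits)
next
  case (Cons t ts)
  obtain c \<phi> where t: "t = (c, \<phi>)" by (cases t)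
  have "spec 10 (Dot (enc_pform \<phi>) (Dot s (Dot h (Dot h x)))) (\<lambda>v. len v = q \<phi> \<and> q \<phi> \<le> V) T \<and> nodes (enc_int c) \<le> n"
    by (rule Cons.prems) (simp add: t)
  note p = specD[OF conjunct1[OF this]] and c = nodes_enc_int_bounds[OF conjunct2[OF this]]
  have "spec 10 (Dot (enc_pform \<phi>) (Dot s (Dot h (Dot h x)))) (\<lambda>v. len v = q \<phi> \<and> q \<phi> \<le> V) T \<and> nodes (enc_int c) \<le> n"
    if "(c, \<phi>) \<in> set ts" for c \<phi> by (rule Cons.prems) (simp add: that)
  then have "spec 12 (Dot (enc_bool sg) (Dot (enc_list (map enc_term ts)) (Dot s (Dot h x))))
      (\<lambda>v. len v = signed_sum sg q ts \<and> len v \<le> length ts * ((4 ^ n + 1) * (V + 1)))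
      ((length ts + 1) * (T + 400 * ((4 ^ n + 1) * (V + 1))))"
    by (rule Cons.IH)
  note IH = specD[OF this]
  let ?p = "fun_value 10 (Dot (enc_pform \<phi>) (Dot s (Dot h (Dot h x))))"
  let ?c = "fun_value 6 (enc_nat (nat \<bar>c\<bar>))"
  let ?X = "((4::nat) ^ n + 1) * (V + 1)"
  let ?r = "fun_value 12 (Dot (enc_bool sg) (Dot (enc_list (map enc_term ts)) (Dot s (Dot h x))))"
  have pV: "len ?p \<le> V" using p by simp
  have cl: "len ?c \<le> 4 ^ n" using c by simp
  have t1: "fun_time 2 (Dot ?c ?p) \<le> 32 * ?X" "len ?c * len ?p \<le> ?X"
    using mul_time_le[OF cl pV] by auto
  have X: "1 \<le> ?X" "4 ^ n \<le> ?X" by simp_all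
  have t2: "fun_time 19 (Dot (fun_value 2 (Dot ?c ?p)) ?r) \<le> 17 * ?X"
    using app_time[of "fun_value 2 (Dot ?c ?p)" ?r] t1(2) X unfolding mul_len by linarith
  have t3: "fun_time 5 (Dot (enc_bool sg) z) \<le> 120" for z
    using eq_time[of "enc_bool sg" z] by (cases sg) (auto simp: enc_bool_def)
  have t4: "fun_time 19 (Dot Atom ?r) \<le> 5" using app_time[of Atom ?r] by simp
  have "(length (t # ts) + 1) * (T + 400 * ?X) = (length ts + 1) * (T + 400 * ?X) + (T + 400 * ?X)"
    by (simp add: algebra_simps)
  moreover have "expr_time lin_body (Dot (enc_bool sg) (Dot (enc_list (map enc_term (t # ts))) (Dot s (Dot h x)))) \<le>
      80 + fun_time 12 (Dot (enc_bool sg) (Dot (enc_list (map enc_term ts)) (Dot s (Dot h x)))) +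
      fun_time 10 (Dot (enc_pform \<phi>) (Dot s (Dot h (Dot h x)))) +
      fun_time 2 (Dot ?c ?p) + fun_time 6 (enc_nat (nat \<bar>c\<bar>)) + 5 + 17 * ?X + 120"
    using t2 t3[of "enc_bool (c < 0)"] t4
    by (auto simp: lin_body_def t enc_int_def inj_enc_bool cong: if_cong)
  ultimately have time: "expr_time lin_body (Dot (enc_bool sg) (Dot (enc_list (map enc_term (t # ts))) (Dot s (Dot h x)))) \<le>
      (length (t # ts) + 1) * (T + 400 * ?X)"
    using IH(3) p(3) t1(1) X c(2) by linarith
  have v: "nat \<bar>c\<bar> * q \<phi> \<le> ?X" using t1(2) p(2) by simp
  show ?case
    by (rule specI[OF _ _ _ time])
      (use IH(1,2) p(1,2) v X in
        \<open>auto simp: lin_body_def t enc_int_def inj_enc_bool cong: if_cong\<close>)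
qed


lemma enc_unary_simps [simp]:
  "enc_unary 0 = Atom" "enc_unary (Suc n) = Dot Atom (enc_unary n)"
  "enc_unary 1 = Dot Atom Atom" "enc_unary 2 = Dot Atom (Dot Atom Atom)"
  "enc_unary 3 = Dot Atom (Dot Atom (Dot Atom Atom))"
  "enc_unary 4 = Dot Atom (Dot Atom (Dot Atom (Dot Atom Atom)))"
  by (simp_all add: enc_unary_def eval_nat_numeral)

lemma nodes_elems: "x \<in> set (elems s) \<Longrightarrow> nodes x < nodes s"
  by (induction s) auto

lemma bound_le_nodes: "finite_horizons_path \<phi> \<Longrightarrow> bound \<phi> \<le> nodes (enc_pform \<phi>)"
  using closure_finite_horizons(2) closure_p_simps(1) by blast

text \<open>\<open>W\<close> bounds the cost of the arithmetic in one call, and \<open>R\<close> the number of calls made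
  at the next smaller formula, so that evaluating a formula with \<open>m\<close> nodes costs at most \<open>W * R ^ m\<close>.\<close>

locale certificate =
  fixes sts d hz :: sexp and B :: nat and A :: "nat set"
  assumes nodes_sts: "nodes sts \<le> B" and len_d: "len d \<le> B"
    and stoch: "stochastic (len sts) (len d) (\<lambda>i. entry_w (cdr (elems sts ! i)))"
begin

abbreviation "K \<equiv> len sts"
abbreviation "D \<equiv> len d"
abbreviation "st i \<equiv> elems sts ! i"
abbreviation "n \<equiv> len hz"
abbreviation "g \<equiv> Dot hz (Dot d sts)"

definition "lab i = {p. enc_nat p \<in> set (elems (car (st i)))}"
definition "M = matrix_chain A K D (\<lambda>i. entry_w (cdr (st i))) lab"
text \<open>One bound for all arithmetic at a state: \<open>4 ^ n\<close> dominates a constant of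
  the formula, \<open>(B + 1) ^ (n + 2)\<close> a power of \<open>D\<close> and the cost of forming
  it, and \<open>n + 2\<close> the number of summands or factors.\<close>

definition "U = (n + 2) * (4 ^ n + 1) * (B + 1) ^ (n + 2)"
definition "W = 1000 * U"
definition "R = 4 * n + 2 * B + 20"
definition "V = B ^ n"

lemma K_le: "K \<le> B" using len_le_nodes[of sts] nodes_sts by simp
lemma D_pos: "0 < D" using stoch by (simp add: stochastic_def)
lemma B_pos: "0 < B" using D_pos len_d by simp

lemma nodes_st: assumes "i < K" shows "nodes (st i) \<le> B"
  using nodes_elems[of "st i" sts] assms nodes_sts by simp

lemma nodes_row: "i < K \<Longrightarrow> nodes (cdr (st i)) \<le> B"
  using nodes_st nodes_cdr le_trans by blast

lemma U_bounds:
  shows "1 \<le> U" "(B + 1) * (V + 1) \<le> U" "(4 ^ n + 1) * (V + 1) \<le> U"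
    "n * ((4 ^ n + 1) * (V + 1)) \<le> 2 * U" "(n + 1) * (B + 1) ^ (n + 1) \<le> U" "(n + 1) * B \<le> U"
proof -
  have BV: "V \<le> (B + 1) ^ n" unfolding V_def by (rule power_mono) auto
  have p: "1 \<le> (B + 1) ^ n" by simp
  have q: "(B + 1) ^ n \<le> (B + 1) ^ (n + 1)" "(B + 1) ^ (n + 1) \<le> (B + 1) ^ (n + 2)"
    by (intro power_increasing; simp)+
  have V2: "V + 1 \<le> 2 * (B + 1) ^ n" using BV p by linarith
  have "0 < U" by (simp add: U_def)
  then show "1 \<le> U" by linarith
  have "(B + 1) * (V + 1) \<le> (B + 1) * (2 * (B + 1) ^ n)" using V2 by (rule mult_le_mono2)
  also have "\<dots> = 2 * (B + 1) ^ (n + 1)" by simp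
  also have "\<dots> \<le> (n + 2) * (B + 1) ^ (n + 2)" using q by (intro mult_le_mono) auto
  also have "\<dots> \<le> U" unfolding U_def by (intro mult_le_mono) auto
  finally show "(B + 1) * (V + 1) \<le> U" .
  have X: "(4 ^ n + 1) * (V + 1) \<le> 2 * ((4 ^ n + 1) * (B + 1) ^ (n + 2))"
  proof -
    have "(4 ^ n + 1) * (V + 1) \<le> (4 ^ n + 1) * (2 * (B + 1) ^ (n + 2))"
      using V2 q by (intro mult_le_mono2) linarith
    then show ?thesis by (simp only: mult.left_commute)
  qed
  have "2 * ((4 ^ n + 1) * (B + 1) ^ (n + 2)) \<le> (n + 2) * ((4 ^ n + 1) * (B + 1) ^ (n + 2))"
    by (rule mult_le_mono1) simp
  with X show "(4 ^ n + 1) * (V + 1) \<le> U" by (simp only: U_def mult.assoc)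
  have "n * ((4 ^ n + 1) * (V + 1)) \<le> (n + 2) * (2 * ((4 ^ n + 1) * (B + 1) ^ (n + 2)))"
    by (rule mult_le_mono[OF _ X]) simp
  then show "n * ((4 ^ n + 1) * (V + 1)) \<le> 2 * U" by (simp only: U_def mult.assoc mult.left_commute)
  have "(n + 1) * (B + 1) ^ (n + 1) \<le> (n + 2) * (B + 1) ^ (n + 2)"
    using q(2) by (intro mult_le_mono) auto
  also have "\<dots> \<le> U" unfolding U_def by (intro mult_le_mono) auto
  finally show *: "(n + 1) * (B + 1) ^ (n + 1) \<le> U" .
  have "B \<le> (B + 1) ^ (n + 1)" using power_increasing[of 1 "n + 1" "B + 1"] by simp
  then have "(n + 1) * B \<le> (n + 1) * (B + 1) ^ (n + 1)" by (rule mult_le_mono2)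
  with * show "(n + 1) * B \<le> U" by linarith
qed

lemma pow_time_le: assumes "len h \<le> n" shows "fun_time 3 (Dot d h) \<le> 60 * U"
proof -
  have "(len h + 1) * (D + 1) ^ (len h + 1) \<le> (n + 1) * (B + 1) ^ (n + 1)"
  proof (rule mult_le_mono)
    have "(D + 1) ^ (len h + 1) \<le> (B + 1) ^ (len h + 1)" using len_d by (intro power_mono) auto
    also have "\<dots> \<le> (B + 1) ^ (n + 1)" using assms by (intro power_increasing) auto
    finally show "(D + 1) ^ (len h + 1) \<le> (B + 1) ^ (n + 1)" .
  qed (use assms in simp)
  with U_bounds(5) have "(len h + 1) * (D + 1) ^ (len h + 1) \<le> U" by linarith
  with pow_time[of d h] show ?thesis unfolding mult.assoc by linarith
qed

lemma pow_le_V: assumes "len h \<le> n" shows "D ^ len h \<le> V"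
proof -
  have "D ^ len h \<le> B ^ len h" using len_d by (intro power_mono) auto
  also have "\<dots> \<le> B ^ n" using assms B_pos by (intro power_increasing) auto
  finally show ?thesis by (simp add: V_def)
qed

lemma scaled_prob_le_V:
  assumes "len h \<le> n" "real v = real D ^ len h * path_prob M i \<phi>"
  shows "v \<le> V"
proof -
  have "real v \<le> real D ^ len h * 1"
    unfolding assms(2) by (intro mult_left_mono path_prob_bounds) simp
  then have "real v \<le> real (D ^ len h)" by simp
  then have "v \<le> D ^ len h" by (simp only: of_nat_le_iff)
  with pow_le_V[OF assms(1)] show ?thesis by linarith
qed

lemma path_prob_M:
  assumes "finite_horizons_path \<phi>" "i < K"
  shows "path_prob M i \<phi> = (case verdict (sat M i) \<phi> of Some b \<Rightarrow> of_bool b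
    | None \<Rightarrow> \<Sum>j<K. real (entry_w (cdr (st i)) j) / real D * path_prob M j (residual \<phi>))"
  using path_prob_rec[OF assms(1), of M i] set_pmf_matrix_chain(2)[OF stoch assms(2), of A lab]
    sum_matrix_chain[OF stoch assms(2), of A lab "\<lambda>j. path_prob M j (residual \<phi>)"]
  unfolding M_def[symmetric] by (auto split: option.split)

text \<open>The integer weight supplies the additional factor: \<open>D ^ (h + 1) * (w / D)\<close>
  is \<open>w * D ^ h\<close>, so no division occurs.\<close>

lemma spec_prob_step:
  assumes i: "i < K" and h: "len h \<le> n"
    and p: "\<And>j. j < K \<Longrightarrow> spec 10 (Dot f (Dot (st j) (Dot h g)))
      (\<lambda>v. real (len v) = real D ^ len h * path_prob M j \<phi>) T"
  shows "spec 11 (Dot f (Dot (cdr (st i)) (Dot sts (Dot h g))))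
    (\<lambda>v. real (len v) = real D ^ Suc (len h) * (\<Sum>j<K. real (entry_w (cdr (st i)) j) / real D * path_prob M j \<phi>))
    ((B + 1) * (T + 200 * U))"
proof (rule spec_mono)
  let ?q = "\<lambda>j. len (fun_value 10 (Dot f (Dot (st j) (Dot h g))))"
  show "spec 11 (Dot f (Dot (cdr (st i)) (Dot sts (Dot h g))))
      (\<lambda>v. len v = (\<Sum>j<len sts. entry_w (cdr (st i)) j * ?q j)) ((K + 1) * (T + 200 * ((B + 1) * (V + 1))))"
    by (rule spec_step[OF nodes_row[OF i]])
      (use specD(1,3)[OF p] scaled_prob_le_V[OF h specD(2)[OF p]] in \<open>auto simp: spec_def\<close>)
  show "(K + 1) * (T + 200 * ((B + 1) * (V + 1))) \<le> (B + 1) * (T + 200 * U)"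
    using K_le U_bounds(2) by (intro mult_le_mono add_mono) auto
  fix v assume v: "len v = (\<Sum>j<K. entry_w (cdr (st i)) j * ?q j)"
  have "real (len v) = (\<Sum>j<K. real (entry_w (cdr (st i)) j) * (real D ^ len h * path_prob M j \<phi>))"
    unfolding v using specD(2)[OF p] by simp
  also have "\<dots> = real D ^ Suc (len h) * (\<Sum>j<K. real (entry_w (cdr (st i)) j) / real D * path_prob M j \<phi>)"
    unfolding sum_distrib_left using D_pos by (intro sum.cong) auto
  finally show "real (len v) =
      real D ^ Suc (len h) * (\<Sum>j<K. real (entry_w (cdr (st i)) j) / real D * path_prob M j \<phi>)" .
qed

text \<open>All probabilities of the sum are computed with the same exponent \<open>n\<close>, so
  the positive factor \<open>D ^ n\<close> is common to both sides of the constraint and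
  cancels.\<close>

lemma spec_sat_Lin:
  assumes i: "i < K" and m: "nodes (enc_sform (Lin ts r c0)) \<le> n" and T: "1000 * U \<le> T"
    and p: "\<And>c \<phi>. (c, \<phi>) \<in> set ts \<Longrightarrow> spec 10 (Dot (enc_pform \<phi>) (Dot (st i) (Dot hz g)))
      (\<lambda>v. real (len v) = real D ^ n * path_prob M i \<phi>) T"
  shows "spec 9 (Dot (enc_sform (Lin ts r c0)) (Dot (st i) g)) (\<lambda>v. v \<noteq> Atom \<longleftrightarrow> sat M i (Lin ts r c0))
    (R * T)"
proof -
  define tsx where "tsx = enc_list (map enc_term ts)"
  have enc: "enc_sform (Lin ts r c0) =
      Dot (enc_unary 4) (Dot tsx (Dot (enc_cmp r) (Dot (enc_bool (c0 < 0)) (enc_nat (nat \<bar>c0\<bar>)))))"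
    by (simp add: tsx_def enc_int_def)
  have bools: "enc_bool True = Dot Atom Atom" "enc_bool False = Atom"
    by (simp_all add: enc_bool_def)
  define q where "q \<phi> = len (fun_value 10 (Dot (enc_pform \<phi>) (Dot (st i) (Dot hz g))))" for \<phi>
  let ?X = "((4::nat) ^ n + 1) * (V + 1)"
  have q: "real (q \<phi>) = real D ^ n * path_prob M i \<phi>" if "(c, \<phi>) \<in> set ts" for c \<phi>
    using specD(2)[OF p[OF that]] by (simp add: q_def)
  have lin: "spec 12 (Dot (enc_bool sg) (Dot tsx (Dot (st i) g)))
    (\<lambda>v. len v = signed_sum sg q ts \<and> len v \<le> length ts * ?X)
    ((length ts + 1) * (T + 400 * ?X))" for sg
    unfolding tsx_def
  proof (rule spec_lin)
    fix c \<phi> assume c: "(c, \<phi>) \<in> set ts"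
    have "nodes (Dot (enc_int c) (enc_pform \<phi>)) < nodes (enc_list (map enc_term ts))"
      using c by (intro nodes_member) force
    then have "nodes (enc_int c) \<le> n" using m by simp
    then show "spec 10 (Dot (enc_pform \<phi>) (Dot (st i) (Dot hz g))) (\<lambda>v. len v = q \<phi> \<and> q \<phi> \<le> V) T \<and>
        nodes (enc_int c) \<le> n"
      using specD[OF p[OF c]] q[OF c] scaled_prob_le_V[OF order_refl, of "q \<phi>"] by (auto simp: spec_def q_def)
  qed
  note linT = specD[OF lin[of True]] and linF = specD[OF lin[of False]]
  have lts: "length ts + 1 \<le> n" using m by (simp add: nodes_enc_list)
  have "nodes (enc_int c0) \<le> n" using m by simp
  note c0 = nodes_enc_int_bounds[OF this]
  have "length ts * ?X \<le> n * ?X" using lts by (intro mult_le_mono1) simp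
  with U_bounds(4) have ltsX: "length ts * ?X \<le> 2 * U" by linarith
  have lint: "(length ts + 1) * (T + 400 * ?X) \<le> (n + 1) * (2 * T)"
    using lts T U_bounds(3) by (intro mult_le_mono) linarith+
  define NS where "NS = fun_value 12 (Dot (enc_bool True) (Dot tsx (Dot (st i) g)))"
  define PS where "PS = fun_value 12 (Dot (enc_bool False) (Dot tsx (Dot (st i) g)))"
  define z where "z = fun_value 2 (Dot (fun_value 6 (enc_nat (nat \<bar>c0\<bar>))) (fun_value 3 (Dot d hz)))"
  define zn where "zn = (if c0 < 0 then Atom else z)"
  define zp where "zp = (if c0 < 0 then z else Atom)"
  have lz: "len z = nat \<bar>c0\<bar> * D ^ n" by (simp add: z_def)
  have zX: "len z \<le> ?X" "fun_time 2 (Dot (fun_value 6 (enc_nat (nat \<bar>c0\<bar>))) (fun_value 3 (Dot d hz))) \<le> 32 * ?X"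
    using mul_time_le[of "fun_value 6 (enc_nat (nat \<bar>c0\<bar>))" "4 ^ n" "fun_value 3 (Dot d hz)" V]
      c0(1) pow_le_V[OF order_refl] lz by auto
  have NS: "len NS = signed_sum True q ts" "len NS \<le> 2 * U"
    using linT(2) ltsX by (auto simp: NS_def)
  have PS: "len PS = signed_sum False q ts" "len PS \<le> 2 * U"
    using linF(2) ltsX by (auto simp: PS_def)
  define x where "x = fun_value 19 (Dot (enc_cmp r) (fun_value 19 (Dot NS zn)))"
  define y where "y = fun_value 19 (Dot PS zp)"
  have cmp: "len (enc_cmp r) \<le> 1" by (cases r) (auto simp: enc_bool_def)
  have x: "len x = len (enc_cmp r) + (len NS + len zn)" by (simp add: x_def)
  have y: "len y = len PS + len zp" by (simp add: y_def)
  let ?x = "Dot (Dot (enc_unary 4) (Dot tsx (Dot (enc_cmp r)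
      (Dot (enc_bool (c0 < 0)) (enc_nat (nat \<bar>c0\<bar>)))))) (Dot (st i) g)"
  have val: "expr_value sat_body ?x = fun_value 4 (Dot x y)"
    by (cases "c0 < 0") (simp_all add: sat_body_def x_def y_def NS_def PS_def zn_def zp_def z_def bools)
  have halts: "expr_halts sat_body ?x"
    using linT(1) linF(1) by (cases "c0 < 0") (simp_all add: sat_body_def bools)
  have "expr_time sat_body ?x \<le> 400 +
      fun_time 12 (Dot (enc_bool True) (Dot tsx (Dot (st i) g))) +
      fun_time 12 (Dot (enc_bool False) (Dot tsx (Dot (st i) g))) +
      fun_time 6 (enc_nat (nat \<bar>c0\<bar>)) + fun_time 3 (Dot d hz) +
      fun_time 2 (Dot (fun_value 6 (enc_nat (nat \<bar>c0\<bar>))) (fun_value 3 (Dot d hz))) +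
      fun_time 19 (Dot PS zp) + fun_time 19 (Dot NS zn) +
      fun_time 19 (Dot (enc_cmp r) (fun_value 19 (Dot NS zn))) + fun_time 4 (Dot x y)"
    by (cases "c0 < 0") (simp_all add: sat_body_def x_def y_def NS_def PS_def zn_def zp_def z_def bools)
  moreover have "fun_time 19 (Dot PS zp) \<le> 29 * U"
    using app_time[of PS zp] PS(2) U_bounds(1) by linarith
  moreover have "fun_time 19 (Dot NS zn) \<le> 29 * U"
    using app_time[of NS zn] NS(2) U_bounds(1) by linarith
  moreover have "fun_time 19 (Dot (enc_cmp r) (fun_value 19 (Dot NS zn))) \<le> 17 * U"
    using app_time[of "enc_cmp r" "fun_value 19 (Dot NS zn)"] cmp U_bounds(1) by linarith
  moreover have "len zn \<le> U" using zX(1) U_bounds(3) by (auto simp: zn_def intro: le_trans)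
  then have "fun_time 4 (Dot x y) \<le> 90 * U"
    using leq_time[of x y] x cmp NS(2) U_bounds(1) by linarith
  moreover have "fun_time 6 (enc_nat (nat \<bar>c0\<bar>)) \<le> 50 * U"
  proof -
    have "(4::nat) ^ n \<le> ?X" by simp
    then show ?thesis using c0(2) U_bounds(3) by linarith
  qed
  moreover have "fun_time 3 (Dot d hz) \<le> 60 * U" by (rule pow_time_le) simp
  \<comment> \<open>The two passes over the terms, one for each sign, account for
    \<open>4 * n\<close> in \<open>R\<close>; the summand \<open>2 * B\<close> there pays for the
    successors visited by a path formula.\<close>
  moreover have "2 * ((n + 1) * (2 * T)) + 16 * T \<le> R * T"
    by (simp add: R_def algebra_simps)
  ultimately have time: "expr_time sat_body ?x \<le> R * T"
    using linT(3) linF(3) lint zX(2) U_bounds(1,3) T by linarith 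
  have "(\<Sum>(c, \<phi>)\<leftarrow>ts. real_of_int c * real (q \<phi>)) =
      (\<Sum>(c, \<phi>)\<leftarrow>ts. real D ^ n * (real_of_int c * path_prob M i \<phi>))"
    by (rule arg_cong[where f = sum_list], rule map_cong) (auto simp: q)
  also have "\<dots> = real D ^ n * (\<Sum>(c, \<phi>)\<leftarrow>ts. real_of_int c * path_prob M i \<phi>)"
    unfolding sum_list_const_mult[symmetric] by (simp add: case_prod_unfold)
  finally have diff: "real (len PS) - real (len NS) =
      real D ^ n * (\<Sum>(c, \<phi>)\<leftarrow>ts. real_of_int c * path_prob M i \<phi>)"
    using signed_sum_diff[of q ts] NS(1) PS(1) by simp
  have Dn: "0 < real D ^ n" using D_pos by simp
  have zz: "real (len zn) - real (len zp) = real D ^ n * real_of_int c0"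
    by (simp add: zn_def zp_def lz)
  have "len x \<le> len y \<longleftrightarrow> real (len (enc_cmp r)) + (real (len NS) + real (len zn)) \<le> real (len PS) + real (len zp)"
    unfolding x y by (metis of_nat_add of_nat_le_iff)
  also have "\<dots> \<longleftrightarrow> cmp_holds r (real (len PS) - real (len NS)) (real (len zn) - real (len zp))"
  proof (cases r)
    case Ge
    then show ?thesis by (auto simp: enc_bool_def)
  next
    case Gt
    \<comment> \<open>Both sides are natural numbers, so a strict inequality is a weak one after
      adding 1.\<close>
    have "1 + (real (len NS) + real (len zn)) \<le> real (len PS) + real (len zp) \<longleftrightarrow>
        real (len NS) + real (len zn) < real (len PS) + real (len zp)"
      by (metis Suc_eq_plus1_left Suc_le_eq of_nat_1 of_nat_add of_nat_le_iff of_nat_less_iff)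
    then show ?thesis using Gt by (auto simp: enc_bool_def)
  qed
  also have "\<dots> \<longleftrightarrow> cmp_holds r (\<Sum>(c, \<phi>)\<leftarrow>ts. real_of_int c * path_prob M i \<phi>) (real_of_int c0)"
    unfolding diff zz using Dn by (cases r) auto
  finally have sem: "len x \<le> len y \<longleftrightarrow> sat M i (Lin ts r c0)" by (simp add: sat_Lin)
  show ?thesis
    unfolding enc by (rule specI[OF prog_nth(10) halts _ time]) (simp only: val sem[symmetric] leq_Atom not_not)
qed

text \<open>State and path formulas are evaluated through each other, so both claims share one
  induction on encoding size. The exponent \<open>h\<close> ranges over everything between the
  horizon and \<open>n\<close>, because an evaluation starts with \<open>n\<close> and loses one
  unit per transition.\<close>

lemma spec_sat_prob_aux:
  "(\<forall>\<Phi> i. nodes (enc_sform \<Phi>) = m \<longrightarrow> finite_horizons \<Phi> \<longrightarrow> m \<le> n \<longrightarrow> i < K \<longrightarrow>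
      spec 9 (Dot (enc_sform \<Phi>) (Dot (st i) g)) (\<lambda>v. v \<noteq> Atom \<longleftrightarrow> sat M i \<Phi>) (W * R ^ m)) \<and>
    (\<forall>\<phi> i h. nodes (enc_pform \<phi>) = m \<longrightarrow> finite_horizons_path \<phi> \<longrightarrow> m \<le> n \<longrightarrow>
      bound \<phi> \<le> len h \<longrightarrow> len h \<le> n \<longrightarrow> i < K \<longrightarrow>
      spec 10 (Dot (enc_pform \<phi>) (Dot (st i) (Dot h g)))
        (\<lambda>v. real (len v) = real D ^ len h * path_prob M i \<phi>) (W * R ^ m))"
proof (induction m rule: less_induct)
  case (less m)
  show ?case
  proof (cases "m = 0")
    case False
    \<comment> \<open>A common time bound for all formulas of size below \<open>m\<close>, by
      monotonicity in the exponent.\<close>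
    define T where "T = W * R ^ (m - 1)"
    have RT: "W * R ^ m = R * T" using False by (cases m) (simp_all add: T_def)
    have R0: "0 < R" by (simp add: R_def)
    have TW: "1000 * U \<le> T" using R0 by (simp add: T_def W_def)
    have T1: "1000 \<le> T" using TW U_bounds(1) by linarith
    have mono: "W * R ^ k \<le> T" if "k < m" for k
      unfolding T_def using that R0 by (intro mult_le_mono2 power_increasing) auto
    have R20: "20 * T + (2 * B) * T \<le> R * T" unfolding R_def by (simp add: algebra_simps)
    have IHs: "spec 9 (Dot (enc_sform \<Phi>) (Dot (st i) g)) (\<lambda>v. v \<noteq> Atom \<longleftrightarrow> sat M i \<Phi>) T"
      if "nodes (enc_sform \<Phi>) < m" "finite_horizons \<Phi>" "m \<le> n" "i < K" for \<Phi> i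
      by (rule spec_mono[OF _ _ mono[OF that(1)]]) (use less[OF that(1)] that in auto)
    have IHp: "spec 10 (Dot (enc_pform \<phi>) (Dot (st i) (Dot h g)))
        (\<lambda>v. real (len v) = real D ^ len h * path_prob M i \<phi>) T"
      if "nodes (enc_pform \<phi>) < m" "finite_horizons_path \<phi>" "m \<le> n" "bound \<phi> \<le> len h" "len h \<le> n" "i < K"
      for \<phi> i h
      by (rule spec_mono[OF _ _ mono[OF that(1)]]) (use less[OF that(1)] that in auto)
    show ?thesis
    proof (intro conjI allI impI)
      fix \<Phi> i assume m: "nodes (enc_sform \<Phi>) = m" and fh: "finite_horizons \<Phi>"
        and mn: "m \<le> n" and i: "i < K"
      have "nodes (car (st i)) \<le> B" using nodes_st[OF i] nodes_car[of "st i"] by linarith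
      then have ls: "len (car (st i)) \<le> B" using len_le_nodes[of "car (st i)"] by linarith
      have mem: "fun_time 8 (Dot (enc_nat p) (car (st i))) \<le> 100 * U" if "nodes (enc_nat p) \<le> n" for p
      proof -
        have "len (car (st i)) * (40 * nodes (enc_nat p) + 40) \<le> B * (40 * n + 40)"
          using ls that by (intro mult_le_mono) auto
        also have "\<dots> = 40 * ((n + 1) * B)" by (simp add: algebra_simps)
        finally show ?thesis
          using mem_time[of "enc_nat p" "car (st i)"] U_bounds(1,6) by linarith
      qed
      have lab: "enc_nat p \<in> set (elems (car (st i))) \<longleftrightarrow> p \<in> label M i" for p
        by (simp add: M_def lab_def)
      show "spec 9 (Dot (enc_sform \<Phi>) (Dot (st i) g)) (\<lambda>v. v \<noteq> Atom \<longleftrightarrow> sat M i \<Phi>) (W * R ^ m)"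
      proof (cases \<Phi>)
        case (Prop p)
        have t: "fun_time 8 (Dot (enc_nat p) (car (st i))) \<le> 100 * U"
          using mem m mn by (simp add: Prop)
        show ?thesis
          unfolding RT
          by (rule specI) (use t TW T1 R20 lab[of p] in \<open>auto simp: sat_body_def Prop\<close>)
      next
        case (NProp p)
        have t: "fun_time 8 (Dot (enc_nat p) (car (st i))) \<le> 100 * U"
          using mem m mn by (simp add: NProp)
        show ?thesis
          unfolding RT
          by (rule specI)
            (use t TW T1 R20 lab[of p] in \<open>auto simp: sat_body_def NProp cong: if_cong split: if_splits\<close>)
      next
        case (And \<Phi>1 \<Phi>2)
        note s1 = specD[OF IHs[of \<Phi>1 i]] and s2 = specD[OF IHs[of \<Phi>2 i]]
        show ?thesis
          unfolding RT
          by (rule specI)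
            (use s1 s2 m mn fh i T1 R20 in \<open>auto simp: sat_body_def And cong: if_cong split: if_splits\<close>)
      next
        case (Or \<Phi>1 \<Phi>2)
        note s1 = specD[OF IHs[of \<Phi>1 i]] and s2 = specD[OF IHs[of \<Phi>2 i]]
        show ?thesis
          unfolding RT
          by (rule specI)
            (use s1 s2 m mn fh i T1 R20 in \<open>auto simp: sat_body_def Or cong: if_cong split: if_splits\<close>)
      next
        case (Lin ts r c0)
        show ?thesis
          unfolding RT unfolding Lin
        proof (rule spec_sat_Lin[OF i _ TW])
          fix c \<phi> assume c: "(c, \<phi>) \<in> set ts"
          note lt = nodes_Lin_member[OF c, of r c0]
          have f: "finite_horizons_path \<phi>" using fh c by (auto simp: Lin)
          show "spec 10 (Dot (enc_pform \<phi>) (Dot (st i) (Dot hz g)))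
              (\<lambda>v. real (len v) = real D ^ n * path_prob M i \<phi>) T"
            using lt m mn f i bound_le_nodes[OF f] by (intro IHp) (auto simp: Lin)
        qed (use m mn Lin in auto)
      qed
    next
      fix \<phi> i h assume m: "nodes (enc_pform \<phi>) = m" and fh: "finite_horizons_path \<phi>"
        and mn: "m \<le> n" and bh: "bound \<phi> \<le> len h" and h: "len h \<le> n" and i: "i < K"
      note rec = path_prob_M[OF fh i]
      have pow: "fun_time 3 (Dot d h) \<le> T" using pow_time_le[OF h] TW by linarith
      have step: "spec 11 (Dot (enc_pform (residual \<phi>)) (Dot (cdr (st i)) (Dot sts (Dot (cdr h) g))))
          (\<lambda>v. real (len v) = real D ^ len h * path_prob M i \<phi>) ((2 * B) * T + 2 * T)"
        if v: "verdict (sat M i) \<phi> = None"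
      proof (rule spec_mono)
        \<comment> \<open>An undecided formula has positive horizon, so \<open>h\<close> is
          non-empty and \<open>cdr h\<close> really is its predecessor.\<close>
        have hpos: "0 < len h" using residual_simps(1)[OF fh v] bh by linarith
        show "spec 11 (Dot (enc_pform (residual \<phi>)) (Dot (cdr (st i)) (Dot sts (Dot (cdr h) g))))
          (\<lambda>v. real (len v) = real D ^ Suc (len (cdr h)) *
            (\<Sum>j<K. real (entry_w (cdr (st i)) j) / real D * path_prob M j (residual \<phi>)))
          ((B + 1) * (T + 200 * U))"
        proof (rule spec_prob_step[OF i])
          show "spec 10 (Dot (enc_pform (residual \<phi>)) (Dot (st j) (Dot (cdr h) g)))
              (\<lambda>v. real (len v) = real D ^ len (cdr h) * path_prob M j (residual \<phi>)) T" if "j < K" for j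
            by (rule IHp)
              (use that h bh residual_simps[OF fh v] nodes_residual[OF fh v] m mn in \<open>auto simp: len_cdr\<close>)
        qed (use h in \<open>simp add: len_cdr\<close>)
        have "(B + 1) * (T + 200 * U) \<le> (B + 1) * (2 * T)" using TW by (intro mult_le_mono2) linarith
        then show "(B + 1) * (T + 200 * U) \<le> (2 * B) * T + 2 * T" by (simp add: algebra_simps)
        show "real (len w) = real D ^ len h * path_prob M i \<phi>"
          if "real (len w) = real D ^ Suc (len (cdr h)) *
            (\<Sum>j<K. real (entry_w (cdr (st i)) j) / real D * path_prob M j (residual \<phi>))" for w
          using that hpos v rec by (simp add: len_cdr)
      qed
      show "spec 10 (Dot (enc_pform \<phi>) (Dot (st i) (Dot h g)))
          (\<lambda>v. real (len v) = real D ^ len h * path_prob M i \<phi>) (W * R ^ m)"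
      proof (cases \<phi>)
        case (Next l \<Phi>)
        show ?thesis
        proof (cases l)
          case 0
          have s: "spec 9 (Dot (enc_sform \<Phi>) (Dot (st i) g)) (\<lambda>v. v \<noteq> Atom \<longleftrightarrow> sat M i \<Phi>) T"
            using m mn fh i by (intro IHs) (auto simp: Next)
          show ?thesis
            unfolding RT
            by (rule specI)
              (use specD[OF s] pow T1 R20 rec in \<open>auto simp: prob_body_def Next 0 cong: if_cong split: if_splits\<close>)
        next
          case (Suc k)
          have v: "verdict (sat M i) \<phi> = None" by (simp add: Next Suc)
          have e: "enc_pform (residual \<phi>) = Dot Atom (Dot (enc_unary k) (enc_sform \<Phi>))" by (simp add: Next Suc)
          show ?thesis
            unfolding RT
            by (rule specI)
              (use specD[OF step[OF v, unfolded e]] T1 R20 in \<open>auto simp: prob_body_def Next Suc\<close>)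
        qed
      next
        case (Until k \<Phi> \<Psi>)
        then obtain l where k: "k = enat l" using fh by auto
        have s1: "spec 9 (Dot (enc_sform \<Phi>) (Dot (st i) g)) (\<lambda>v. v \<noteq> Atom \<longleftrightarrow> sat M i \<Phi>) T"
          using m mn fh i by (intro IHs) (auto simp: Until)
        have s2: "spec 9 (Dot (enc_sform \<Psi>) (Dot (st i) g)) (\<lambda>v. v \<noteq> Atom \<longleftrightarrow> sat M i \<Psi>) T"
          using m mn fh i by (intro IHs) (auto simp: Until)
        show ?thesis
        proof (cases "verdict (sat M i) \<phi>")
          case (Some b)
          show ?thesis
            unfolding RT
            by (rule specI)
              (use specD[OF s1] specD[OF s2] pow T1 R20 rec Some in
                \<open>auto simp: prob_body_def Until k zero_enat_def cong: if_cong split: if_splits\<close>)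
        next
          case None
          then obtain l' where l: "l = Suc l'" by (cases l) (auto simp: Until k zero_enat_def split: if_splits)
          have e: "enc_pform (residual \<phi>) =
              Dot (Dot Atom Atom) (Dot (Dot Atom (enc_unary l')) (Dot (enc_sform \<Phi>) (enc_sform \<Psi>)))"
            by (simp add: Until k l one_enat_def)
          show ?thesis
            unfolding RT
            by (rule specI)
              (use specD[OF s1] specD[OF s2] specD[OF step[OF None, unfolded e]] T1 R20 None in
                \<open>auto simp: prob_body_def Until k l cong: if_cong split: if_splits\<close>)
        qed
      next
        case (WUntil k \<Phi> \<Psi>)
        then obtain l where k: "k = enat l" using fh by auto
        have s1: "spec 9 (Dot (enc_sform \<Phi>) (Dot (st i) g)) (\<lambda>v. v \<noteq> Atom \<longleftrightarrow> sat M i \<Phi>) T"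
          using m mn fh i by (intro IHs) (auto simp: WUntil)
        have s2: "spec 9 (Dot (enc_sform \<Psi>) (Dot (st i) g)) (\<lambda>v. v \<noteq> Atom \<longleftrightarrow> sat M i \<Psi>) T"
          using m mn fh i by (intro IHs) (auto simp: WUntil)
        show ?thesis
        proof (cases "verdict (sat M i) \<phi>")
          case (Some b)
          show ?thesis
            unfolding RT
            by (rule specI)
              (use specD[OF s1] specD[OF s2] pow T1 R20 rec Some in
                \<open>auto simp: prob_body_def WUntil k zero_enat_def cong: if_cong split: if_splits\<close>)
        next
          case None
          then obtain l' where l: "l = Suc l'" by (cases l) (auto simp: WUntil k zero_enat_def split: if_splits)
          have e: "enc_pform (residual \<phi>) =
              Dot (Dot Atom (Dot Atom Atom)) (Dot (Dot Atom (enc_unary l')) (Dot (enc_sform \<Phi>) (enc_sform \<Psi>)))"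
            by (simp add: WUntil k l one_enat_def)
          show ?thesis
            unfolding RT
            by (rule specI)
              (use specD[OF s1] specD[OF s2] specD[OF step[OF None, unfolded e]] T1 R20 None in
                \<open>auto simp: prob_body_def WUntil k l cong: if_cong split: if_splits\<close>)
        qed
      qed
    qed
  next
    case True
    then show ?thesis using nodes_pos by (metis less_not_refl)
  qed
qed

lemma spec_sat:
  assumes "finite_horizons \<Phi>" "nodes (enc_sform \<Phi>) \<le> n" "i < K"
  shows "spec 9 (Dot (enc_sform \<Phi>) (Dot (st i) g)) (\<lambda>v. v \<noteq> Atom \<longleftrightarrow> sat M i \<Phi>)
    (W * R ^ nodes (enc_sform \<Phi>))"
  using spec_sat_prob_aux assms by blast

end


section \<open>Searching for a certificate\<close>

lemma spec_all:
  assumes "\<And>s. s \<in> set (elems todo) \<Longrightarrow> spec 9 (Dot f (Dot s x)) (\<lambda>v. v \<noteq> Atom \<longleftrightarrow> P s) T"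
  shows "spec 16 (Dot todo (Dot f x)) (\<lambda>v. v \<noteq> Atom \<longleftrightarrow> (\<forall>s\<in>set (elems todo). P s))
    ((len todo + 1) * (T + 60))"
  using assms
proof (induction todo)
  case Atom
  show ?case by (rule specI) (auto simp: all_body_def)
next
  case (Dot s todo)
  have "spec 16 (Dot todo (Dot f x)) (\<lambda>v. v \<noteq> Atom \<longleftrightarrow> (\<forall>s\<in>set (elems todo). P s))
    ((len todo + 1) * (T + 60))" by (rule Dot.IH(2)) (rule Dot.prems, simp)
  note IH = specD[OF this]
  note s = specD[OF Dot.prems[of s, simplified]]
  show ?case
    by (rule specI) (use IH s in \<open>auto simp: all_body_def cong: if_cong split: if_splits\<close>)
qed

text \<open>Labels read from a certificate may contain propositions foreign to the formula, so these
  are included. The element 0 makes the set non-empty whatever the formula.\<close>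

definition cert_AP :: "sform \<Rightarrow> sexp \<Rightarrow> nat set" where
  "cert_AP \<Phi> sts = insert 0 (atoms \<Phi> \<union> (\<Union>s\<in>set (elems sts). {p. enc_nat p \<in> set (elems (car s))}))"

abbreviation cert_chain :: "sform \<Rightarrow> sexp \<Rightarrow> nat mc" where
  "cert_chain \<Phi> c \<equiv> certificate.M (cdr c) (car c) (cert_AP \<Phi> (cdr c))"

text \<open>Demanding the formula at all listed states is sound, and it excludes no instance with a
  model, since \<open>small_model\<close> is built only from reachable representatives.\<close>

definition accepts :: "sform \<Rightarrow> nat \<Rightarrow> sexp \<Rightarrow> bool" where
  "accepts \<Phi> N c \<longleftrightarrow> car c \<noteq> Atom \<and> cdr c \<noteq> Atom \<and>
     rows_valid (len (cdr c)) (len (car c)) N (elems (cdr c)) \<and>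
     (\<forall>i<len (cdr c). sat (cert_chain \<Phi> c) i \<Phi>)"

lemma rows_valid_stochastic:
  assumes "car c \<noteq> Atom" "cdr c \<noteq> Atom" "rows_valid (len (cdr c)) (len (car c)) N (elems (cdr c))"
  shows "stochastic (len (cdr c)) (len (car c)) (\<lambda>i. entry_w (cdr (elems (cdr c) ! i)))"
    "granular N (len (cdr c)) (len (car c)) (\<lambda>i. entry_w (cdr (elems (cdr c) ! i)))
      (\<lambda>i. entry_a (cdr (elems (cdr c) ! i))) (\<lambda>i. entry_b (cdr (elems (cdr c) ! i)))"
  using assms by (auto simp: stochastic_def granular_def rows_valid_def row_ok_def len_pos)

lemma certificateI:
  assumes "car c \<noteq> Atom" "cdr c \<noteq> Atom" "rows_valid (len (cdr c)) (len (car c)) N (elems (cdr c))"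
    and "nodes c \<le> B"
  shows "certificate (cdr c) (car c) B"
  using rows_valid_stochastic(1)[OF assms(1-3)] assms(4) nodes_car[of c] nodes_cdr[of c] len_le_nodes[of "car c"]
  by unfold_locales auto

lemma accepts_model:
  assumes "accepts \<Phi> N c"
  shows "granularity_le N (cert_chain \<Phi> c)" "is_model (cert_chain \<Phi> c) (AG \<Phi>)"
    "finite (states (cert_chain \<Phi> c))"
proof -
  let ?A = "cert_AP \<Phi> (cdr c)"
  have c: "car c \<noteq> Atom" "cdr c \<noteq> Atom" "rows_valid (len (cdr c)) (len (car c)) N (elems (cdr c))"
    and sat: "\<And>i. i < len (cdr c) \<Longrightarrow> sat (cert_chain \<Phi> c) i \<Phi>"
    using assms by (auto simp: accepts_def)
  interpret certificate "cdr c" "car c" Atom "nodes c" "?A"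
    by (rule certificateI[OF c]) simp
  have inj: "inj enc_nat" by (simp add: inj_def inj_enc_nat)
  have fin: "finite {p. enc_nat p \<in> set xs}" for xs
    using finite_vimageI[OF finite_set[of xs] inj] by (simp add: vimage_def)
  have A: "finite ?A" "?A \<noteq> {}" "atoms \<Phi> \<subseteq> ?A"
    using fin atoms_card(1)[of \<Phi>] by (auto simp: cert_AP_def)
  have lab: "lab i \<subseteq> ?A" if "i < K" for i
  proof -
    have "st i \<in> set (elems (cdr c))" using that by simp
    then show ?thesis by (auto simp: lab_def cert_AP_def)
  qed
  note model = matrix_chain_model[where lab = lab, OF rows_valid_stochastic[OF c] A lab sat[unfolded M_def]]
  show "granularity_le N (cert_chain \<Phi> c)" unfolding M_def by (rule model(1))
  show "is_model (cert_chain \<Phi> c) (AG \<Phi>)" unfolding M_def by (rule model(2))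
  show "finite (states (cert_chain \<Phi> c))" by (simp add: M_def)
qed

definition sat_time :: "nat \<Rightarrow> nat \<Rightarrow> nat" where
  "sat_time B n = 1000 * ((n + 2) * (4 ^ n + 1) * (B + 1) ^ (n + 2)) * (4 * n + 2 * B + 20) ^ n"

definition check_time :: "nat \<Rightarrow> nat \<Rightarrow> nat" where
  "check_time B n = 100 + (B + 1) * ((B + 1) * (700 * ((B + 1) * (B + 1)))) + (B + 1) * (sat_time B n + 60)"

lemma spec_check:
  assumes fh: "finite_horizons \<Phi>" and hz: "len hz = nodes (enc_sform \<Phi>)" and c: "nodes c \<le> B"
  shows "spec 17 (Dot c (Dot (enc_sform \<Phi>) (Dot hz nn)))
    (\<lambda>v. v \<noteq> Atom \<longleftrightarrow> accepts \<Phi> (len nn) c) (check_time B (nodes (enc_sform \<Phi>)))"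
proof -
  let ?d = "car c" and ?s = "cdr c" and ?n = "nodes (enc_sform \<Phi>)"
  have le: "nodes ?s \<le> B" "len ?d \<le> B" "len ?s \<le> B"
    using c nodes_car[of c] nodes_cdr[of c] len_le_nodes[of "car c"] len_le_nodes[of "cdr c"] by linarith+
  note v = specD[OF spec_valid[OF le(1,2), of ?s nn]]
  have vt: "fun_time 15 (Dot ?s (Dot ?s (Dot ?d nn))) \<le> (B + 1) * ((B + 1) * (700 * ((B + 1) * (B + 1))))"
    by (rule order_trans[OF v(3)]) (use le in \<open>intro mult_le_mono; simp\<close>)
  show ?thesis
  proof (cases "?d \<noteq> Atom \<and> ?s \<noteq> Atom \<and> rows_valid (len ?s) (len ?d) (len nn) (elems ?s)")
    case True
    then have ok: "?d \<noteq> Atom" "?s \<noteq> Atom" "rows_valid (len ?s) (len ?d) (len nn) (elems ?s)" by auto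
    \<comment> \<open>For a pair \<open>c\<close>, the argument \<open>Dot hz c\<close> passed by
      \<open>check_body\<close> is the \<open>Dot hz (Dot d sts)\<close> that the locale
      expects.\<close>
    then have cc: "Dot ?d ?s = c" by (cases c) auto
    interpret certificate "?s" "?d" hz B "cert_AP \<Phi> ?s" by (rule certificateI[OF ok c])
    \<comment> \<open>\<open>spec_all\<close> asks for a property of the tree \<open>s\<close>, but
      satisfaction in \<open>M\<close> belongs to an index, and equal trees may occur at several
      indices. So the outcome of the call is itself taken as the property, and \<open>sem\<close>
      translates it.\<close>
    have "spec 16 (Dot ?s (Dot (enc_sform \<Phi>) (Dot hz c)))
      (\<lambda>v. v \<noteq> Atom \<longleftrightarrow> (\<forall>s\<in>set (elems ?s). fun_value 9 (Dot (enc_sform \<Phi>) (Dot s (Dot hz c))) \<noteq> Atom))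
      ((len ?s + 1) * (sat_time B ?n + 60))"
    proof (rule spec_all)
      fix s assume "s \<in> set (elems ?s)"
      then obtain i where i: "i < K" "s = st i" by (auto simp: in_set_conv_nth)
      show "spec 9 (Dot (enc_sform \<Phi>) (Dot s (Dot hz c)))
          (\<lambda>v. v \<noteq> Atom \<longleftrightarrow> fun_value 9 (Dot (enc_sform \<Phi>) (Dot s (Dot hz c))) \<noteq> Atom) (sat_time B ?n)"
        using specD[OF spec_sat[OF fh _ i(1)]] hz
        by (simp add: spec_def sat_time_def i(2) W_def U_def R_def cc)
    qed
    note a = specD[OF this]
    have "fun_value 9 (Dot (enc_sform \<Phi>) (Dot (st i) (Dot hz c))) \<noteq> Atom \<longleftrightarrow> sat M i \<Phi>" if "i < K" for i
      using specD(2)[OF spec_sat[OF fh _ that]] hz by (simp add: cc)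
    then have sem: "(\<forall>s\<in>set (elems ?s). fun_value 9 (Dot (enc_sform \<Phi>) (Dot s (Dot hz c))) \<noteq> Atom) \<longleftrightarrow>
        (\<forall>i<K. sat M i \<Phi>)"
      by (auto simp: all_set_conv_all_nth)
    have at: "fun_time 16 (Dot ?s (Dot (enc_sform \<Phi>) (Dot hz c))) \<le> (B + 1) * (sat_time B ?n + 60)"
      by (rule order_trans[OF a(3)]) (use le in \<open>intro mult_le_mono; simp\<close>)
    show ?thesis
      by (rule specI)
        (use v(1,2) a(1,2) ok vt at sem in
          \<open>auto simp: check_body_def check_time_def accepts_def cong: if_cong split: if_splits\<close>)
  next
    case False
    show ?thesis
      by (rule specI)
        (use v(1,2) vt False in
          \<open>auto simp: check_body_def check_time_def accepts_def cong: if_cong split: if_splits\<close>)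
  qed
qed

section \<open>Enumeration of trees by stack programs\<close>

text \<open>The search runs through the programs of a stack machine whose instructions push a leaf
  (\<open>True\<close>) or join the two topmost trees (\<open>False\<close>); every tree is built by as many
  instructions as it has nodes.\<close>

fun run_ops :: "bool list \<Rightarrow> sexp \<Rightarrow> sexp" where
  "run_ops [] x = x"
| "run_ops (True # ops) x = run_ops ops (Dot Atom x)"
| "run_ops (False # ops) x = run_ops ops (Dot (Dot (car (cdr x)) (car x)) (cdr (cdr x)))"

lemma run_ops_append: "run_ops (xs @ ys) x = run_ops ys (run_ops xs x)"
  by (induction xs x rule: run_ops.induct) auto

text \<open>Postfix order: left subtree, right subtree, join. Having the claim for every stack
  \<open>x\<close> is what allows the sequences to be concatenated.\<close>

lemma run_ops_build: "\<exists>ops. length ops = nodes t \<and> (\<forall>x. run_ops ops x = Dot t x)"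
proof (induction t)
  case Atom
  show ?case by (rule exI[of _ "[True]"]) simp
next
  case (Dot l r)
  then obtain xs ys where "length xs = nodes l" "\<forall>x. run_ops xs x = Dot l x"
    "length ys = nodes r" "\<forall>x. run_ops ys x = Dot r x" by blast
  then show ?case
    by (intro exI[of _ "xs @ ys @ [False]"]) (simp add: run_ops_append)
qed

lemma ex_ops_Suc:
  "(\<exists>ops. length ops \<le> Suc k \<and> P (run_ops ops x)) \<longleftrightarrow> P x \<or>
    (\<exists>ops. length ops \<le> k \<and> P (run_ops ops (Dot Atom x))) \<or>
    (\<exists>ops. length ops \<le> k \<and> P (run_ops ops (Dot (Dot (car (cdr x)) (car x)) (cdr (cdr x)))))"
  (is "?l \<longleftrightarrow> ?r")
proof
  assume ?l
  then obtain ops where "length ops \<le> Suc k" "P (run_ops ops x)" by blast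
  then show ?r by (cases "(ops, x)" rule: run_ops.cases) auto
next
  assume ?r
  then show ?l
    by (elim disjE exE conjE)
      (rule exI[of _ "[]"], simp, rule exI[of _ "True # _"], simp, rule exI[of _ "False # _"], simp)
qed

text \<open>An instruction adds at most four nodes to the stack, the worst case being a join on the
  empty stack, so every tree tested stays within \<open>B\<close>. The factor
  \<open>2 ^ (len b + 1) - 1\<close> counts the instruction sequences of length at most
  \<open>len b\<close>.\<close>

lemma spec_search:
  assumes check: "\<And>c. nodes c \<le> B \<Longrightarrow> spec 17 (Dot c z) (\<lambda>v. v \<noteq> Atom \<longleftrightarrow> Q c) T"
    and "nodes x + 4 * len b \<le> B"
  shows "spec 18 (Dot x (Dot b z))
    (\<lambda>v. v \<noteq> Atom \<longleftrightarrow> (\<exists>ops. length ops \<le> len b \<and> Q (car (run_ops ops x))))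
    ((2 ^ (len b + 1) - 1) * (T + 100))"
  using assms(2)
proof (induction b arbitrary: x)
  case Atom
  have "nodes (car x) \<le> B" using Atom nodes_car[of x] by simp
  note c = specD[OF check[OF this]]
  show ?case
    by (rule specI) (use c in \<open>auto simp: search_body_def cong: if_cong split: if_splits\<close>)
next
  case (Dot l b)
  have "nodes (car x) \<le> B" using Dot.prems nodes_car[of x] by simp
  note c = specD[OF check[OF this]]
  let ?y = "Dot Atom x" and ?z = "Dot (Dot (car (cdr x)) (car x)) (cdr (cdr x))"
  have z: "nodes ?z \<le> nodes x + 4" by (cases x; cases "cdr x") auto
  have "nodes ?y + 4 * len b \<le> B" using Dot.prems by simp
  note y = specD[OF Dot.IH(2)[OF this]]
  have "nodes ?z + 4 * len b \<le> B" using Dot.prems z by simp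
  note zz = specD[OF Dot.IH(2)[OF this]]
  obtain k :: nat where k: "2 ^ (len b + 1) = Suc k" using not0_implies_Suc[of "2 ^ (len b + 1)"] by auto
  have e: "(2 ^ (len (Dot l b) + 1) - 1) * (T + 100) = 2 * (k * (T + 100)) + (T + 100)"
    using k by (simp add: algebra_simps)
  have y3: "fun_time 18 (Dot ?y (Dot b z)) \<le> k * (T + 100)"
    and z3: "fun_time 18 (Dot ?z (Dot b z)) \<le> k * (T + 100)"
    using y(3) zz(3) unfolding k by simp_all
  have time: "expr_time search_body (Dot x (Dot (Dot l b) z)) \<le> (2 ^ (len (Dot l b) + 1) - 1) * (T + 100)"
  proof -
    have "expr_time search_body (Dot x (Dot (Dot l b) z)) \<le> 70 + fun_time 17 (Dot (car x) z) +
        fun_time 18 (Dot ?y (Dot b z)) + fun_time 18 (Dot ?z (Dot b z))"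
      by (simp add: search_body_def cong: if_cong)
    then show ?thesis unfolding e using c(3) y3 z3 by linarith
  qed
  have val: "expr_value search_body (Dot x (Dot (Dot l b) z)) \<noteq> Atom \<longleftrightarrow>
      Q (car x) \<or> (\<exists>ops. length ops \<le> len b \<and> Q (car (run_ops ops ?y))) \<or>
      (\<exists>ops. length ops \<le> len b \<and> Q (car (run_ops ops ?z)))"
    unfolding c(2)[symmetric] y(2)[symmetric] zz(2)[symmetric]
    by (simp add: search_body_def)
  show ?case
  proof (rule specI[OF prog_nth(19) _ _ time])
    show "expr_halts search_body (Dot x (Dot (Dot l b) z))"
      using c(1) y(1) zz(1) by (simp add: search_body_def)
    show "(expr_value search_body (Dot x (Dot (Dot l b) z)) \<noteq> Atom) =
        (\<exists>ops. length ops \<le> len (Dot l b) \<and> Q (car (run_ops ops x)))"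
      unfolding val using ex_ops_Suc[of "len b" "\<lambda>x. Q (car x)" x] by simp
  qed
qed


section \<open>Every small model has a certificate within the budget\<close>

text \<open>A certificate fixes weights and labels below \<open>K\<close> only, whereas
  \<open>matrix_chain\<close> takes functions on all of \<open>nat\<close>. The transfer lemma with
  the identity map bridges this gap.\<close>

lemma matrix_chain_sat_cong:
  assumes st: "stochastic K D w" "stochastic K D w'" and w: "\<And>i j. i < K \<Longrightarrow> j < K \<Longrightarrow> w i j = w' i j"
    and lab: "\<And>i. i < K \<Longrightarrow> lab i = lab' i" and fh: "finite_horizons \<Phi>" and i: "i < K"
  shows "sat (matrix_chain A K D w lab) i \<Phi> = sat (matrix_chain A K D w' lab') i \<Phi>"
proof (rule sat_transfer_aux[where f = "\<lambda>i. i" and S' = "{..<K}" and A = UNIV and X = UNIV,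
      THEN conjunct1, rule_format])
  fix s \<phi> assume "s \<in> {..<K}"
  then show "(\<Sum>t\<in>set_pmf (trans_prob (matrix_chain A K D w lab) s). pmf (trans_prob (matrix_chain A K D w lab) s) t *
        path_prob (matrix_chain A K D w' lab') t \<phi>) =
      (\<Sum>t\<in>set_pmf (trans_prob (matrix_chain A K D w' lab') s). pmf (trans_prob (matrix_chain A K D w' lab') s) t *
        path_prob (matrix_chain A K D w' lab') t \<phi>)"
    using w by (simp add: sum_matrix_chain[OF st(1)] sum_matrix_chain[OF st(2)])
qed (use set_pmf_matrix_chain[OF st(1)] set_pmf_matrix_chain[OF st(2)] lab fh i in auto)

section \<open>Encoding of a matrix chain and its size\<close>

definition enc_state :: "nat \<Rightarrow> (nat \<Rightarrow> nat) \<Rightarrow> (nat \<Rightarrow> nat) \<Rightarrow> (nat \<Rightarrow> nat) \<Rightarrow> nat set \<Rightarrow> sexp" where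
  "enc_state K w a b P =
     Dot (enc_list (map enc_nat (sorted_list_of_set P)))
       (enc_list (map (\<lambda>j. Dot (enc_unary (w j)) (Dot (enc_unary (a j)) (enc_unary (b j)))) [0..<K]))"

definition enc_cert :: "nat \<Rightarrow> nat \<Rightarrow> (nat \<Rightarrow> nat \<Rightarrow> nat) \<Rightarrow> (nat \<Rightarrow> nat \<Rightarrow> nat) \<Rightarrow> (nat \<Rightarrow> nat \<Rightarrow> nat) \<Rightarrow>
    (nat \<Rightarrow> nat set) \<Rightarrow> sexp" where
  "enc_cert K D w a b lab =
     Dot (enc_unary D) (enc_list (map (\<lambda>i. enc_state K (w i) (a i) (b i) (lab i)) [0..<K]))"

lemma entry_enc_list: "j < length xs \<Longrightarrow> entry (enc_list xs) j = xs ! j"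
proof (induction xs arbitrary: j)
  case (Cons x xs)
  then show ?case by (cases j) auto
qed simp

lemma entry_enc_state:
  assumes "j < K"
  shows "entry_w (cdr (enc_state K w a b P)) j = w j" "entry_a (cdr (enc_state K w a b P)) j = a j"
    "entry_b (cdr (enc_state K w a b P)) j = b j"
  using assms by (simp_all add: entry_w_def entry_a_def entry_b_def enc_state_def entry_enc_list)

lemma enc_cert_accepted:
  assumes st: "stochastic K D w" and gr: "granular N K D w a b" and fin: "\<And>i. i < K \<Longrightarrow> finite (lab i)"
    and fh: "finite_horizons \<Phi>" and sat: "\<And>A i. i < K \<Longrightarrow> sat (matrix_chain A K D w lab) i \<Phi>"
  shows "accepts \<Phi> N (enc_cert K D w a b lab)"
proof -
  let ?c = "enc_cert K D w a b lab" and ?A = "cert_AP \<Phi> (cdr (enc_cert K D w a b lab))"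
  have el: "elems (cdr ?c) = map (\<lambda>i. enc_state K (w i) (a i) (b i) (lab i)) [0..<K]"
    by (simp add: enc_cert_def)
  have K: "len (cdr ?c) = K" and D: "len (car ?c) = D" by (simp_all add: enc_cert_def)
  have pos: "0 < K" "0 < D" using st by (auto simp: stochastic_def)
  have nA: "car ?c \<noteq> Atom" "cdr ?c \<noteq> Atom" using pos K D by (metis len.simps(1) less_irrefl)+
  have rv: "rows_valid (len (cdr ?c)) (len (car ?c)) N (elems (cdr ?c))"
    unfolding K D el using gr st
    by (auto simp: rows_valid_def row_ok_def granular_def stochastic_def entry_enc_state)
  interpret certificate "cdr ?c" "car ?c" Atom "nodes ?c" ?A
    by (rule certificateI[OF nA rv]) simp
  have "lab i = certificate.lab (cdr ?c) i" if "i < K" for i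
    using that fin[OF that] by (auto simp: lab_def el enc_state_def inj_enc_nat)
  moreover have "entry_w (cdr (elems (cdr ?c) ! i)) j = w i j" if "i < K" "j < K" for i j
    using that by (simp add: el entry_enc_state)
  ultimately have "sat M i \<Phi>" if "i < K" for i
    unfolding M_def using sat[OF that, of ?A] stoch that st fh unfolding K D
    by (subst matrix_chain_sat_cong[where w' = w and lab' = lab]) auto
  then show ?thesis
    using nA rv K by (simp add: accepts_def)
qed

text \<open>A label has at most \<open>n\<close> propositions of at most \<open>n\<close> nodes
  each. An entry consists of three unary numbers with \<open>w\<close> at most \<open>D\<close> and
  \<open>a\<close>, \<open>b\<close> at most \<open>N\<close>, which gives
  \<open>2 * D + 4 * N + 5\<close>.\<close>

lemma nodes_enc_cert:
  assumes st: "stochastic K D w" and gr: "granular N K D w a b"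
    and lab: "\<And>i. i < K \<Longrightarrow> lab i \<subseteq> atoms \<Phi>"
  defines "n \<equiv> nodes (enc_sform \<Phi>)"
  shows "nodes (enc_cert K D w a b lab) \<le>
    2 * D + 3 + K + K * (n * n + n + K + 3 + K * (2 * D + 4 * N + 5))"
proof -
  have state: "nodes (enc_state K (w i) (a i) (b i) (lab i)) \<le> n * n + n + K + 3 + K * (2 * D + 4 * N + 5)"
    if i: "i < K" for i
  proof -
    have fin: "finite (lab i)" using lab[OF i] atoms_card(1) finite_subset by blast
    have card: "card (lab i) \<le> n"
      using card_mono[OF _ lab[OF i]] atoms_card(1)[of \<Phi>] by (simp add: n_def)
    have "(\<Sum>p\<leftarrow>sorted_list_of_set (lab i). nodes (enc_nat p)) = (\<Sum>p\<in>lab i. nodes (enc_nat p))"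
      using fin by (simp add: sum_list_distinct_conv_sum_set)
    also have "\<dots> \<le> card (lab i) * n"
      using sum_bounded_above[of "lab i" "\<lambda>p. nodes (enc_nat p)" n] atoms_nodes(1) lab[OF i]
      by (auto simp: n_def)
    also have "\<dots> \<le> n * n" using card by (rule mult_le_mono1)
    finally have l: "nodes (enc_list (map enc_nat (sorted_list_of_set (lab i)))) \<le> 1 + n + n * n"
      using card fin by (simp add: nodes_enc_list comp_def)
    have "nodes (Dot (enc_unary (w i j)) (Dot (enc_unary (a i j)) (enc_unary (b i j)))) \<le> 2 * D + 4 * N + 5"
      if j: "j < K" for j
    proof -
      have w: "w i j \<le> D"
        using st i j member_le_sum[of j "{..<K}" "w i"] by (auto simp: stochastic_def)
      have b: "b i j \<le> N" "w i j * b i j = a i j * D"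
        using gr i j by (auto simp: granular_def)
      \<comment> \<open>From \<open>a / b = w / D\<close> and \<open>w\<close> at most
        \<open>D\<close> follows that \<open>a\<close> is at most \<open>b\<close>, hence at most
        \<open>N\<close>.\<close>
      have "D * a i j \<le> D * N"
        using mult_le_mono[OF w b(1)] b(2) by (simp add: mult.commute)
      then have "a i j \<le> N" using st by (simp add: stochastic_def)
      then show ?thesis using w b(1) by simp
    qed
    then have "(\<Sum>j<K. nodes (Dot (enc_unary (w i j)) (Dot (enc_unary (a i j)) (enc_unary (b i j)))))
        \<le> K * (2 * D + 4 * N + 5)"
      using sum_bounded_above[of "{..<K}" _ "2 * D + 4 * N + 5"] by force
    then show ?thesis
      using l by (simp add: enc_state_def nodes_enc_list comp_def interv_sum_list_conv_sum_set_nat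
          atLeast0LessThan)
  qed
  have "(\<Sum>i<K. nodes (enc_state K (w i) (a i) (b i) (lab i))) \<le>
      K * (n * n + n + K + 3 + K * (2 * D + 4 * N + 5))"
    using sum_bounded_above[of "{..<K}" _ "n * n + n + K + 3 + K * (2 * D + 4 * N + 5)"] state by force
  then show ?thesis
    by (simp add: enc_cert_def nodes_enc_list comp_def interv_sum_list_conv_sum_set_nat atLeast0LessThan)
qed

text \<open>Origin of the budget. With \<open>N!\<close> bounded by \<open>u ^ u\<close>, every
  factor of the certificate size is bounded by a power of \<open>u = n + N\<close>; the exponent 5
  suffices because \<open>5 * (u ^ 3 + 2 * u + 1)\<close> is at most \<open>u ^ 5\<close> from
  \<open>u = 4\<close> on.\<close>

lemma small_model_bound:
  fixes n N K :: nat
  assumes n: "3 \<le> n" and N: "1 \<le> N" and K: "K \<le> N * (2 ^ n * (fact N ^ n + 1) ^ n)"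
  shows "2 * fact N + 3 + K + K * (n * n + n + K + 3 + K * (2 * fact N + 4 * N + 5)) \<le>
    (n + N) ^ ((n + N) ^ 5)"
proof -
  define u where "u = n + N"
  have u: "4 \<le> u" "n \<le> u" "N \<le> u" using n N by (auto simp: u_def)
  \<comment> \<open>The exponents of the factors of \<open>K\<close> add up to \<open>k\<close>: 1
    for \<open>N\<close>, \<open>u\<close> for \<open>2 ^ n\<close>, and
    \<open>(u * u + 1) * u\<close> for the power of \<open>N!\<close>.\<close>
  define k where "k = u ^ 3 + 2 * u + 1"
  define X where "X = u ^ k"
  have up: "u ^ i \<le> u ^ j" if "i \<le> j" for i j using u that by (intro power_increasing) auto
  have "fact N \<le> N ^ N" using fact_le_power[of N, where ?'a = nat] by simp
  also have "\<dots> \<le> u ^ N" using u by (intro power_mono) auto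
  also have "\<dots> \<le> u ^ u" using u by (intro up)
  finally have D: "fact N \<le> u ^ u" .
  have "fact N ^ n \<le> (u ^ u) ^ n" using D by (rule power_mono) simp
  also have "\<dots> = u ^ (u * n)" by (simp add: power_mult)
  also have "\<dots> \<le> u ^ (u * u)" using u by (intro up) simp
  finally have "fact N ^ n + 1 \<le> 2 * u ^ (u * u)" using u by (simp add: le_Suc_eq) (metis One_nat_def Suc_leI add_le_mono mult_2 not_numeral_le_zero zero_less_power bot_nat_0.not_eq_extremum plus_1_eq_Suc add.commute)
  also have "\<dots> \<le> u * u ^ (u * u)" using u by (intro mult_le_mono1) simp
  finally have "(fact N ^ n + 1) ^ n \<le> (u ^ Suc (u * u)) ^ n" by (intro power_mono) auto
  also have "\<dots> = u ^ (Suc (u * u) * n)" by (simp only: power_mult)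
  also have "\<dots> \<le> u ^ (Suc (u * u) * u)" using u by (intro up mult_le_mono2)
  finally have F: "(fact N ^ n + 1) ^ n \<le> u ^ (Suc (u * u) * u)" .
  have "2 ^ n \<le> u ^ n" using u by (intro power_mono) auto
  also have "\<dots> \<le> u ^ u" using u by (intro up)
  finally have T: "2 ^ n \<le> u ^ u" .
  have "K \<le> u * (u ^ u * u ^ (Suc (u * u) * u))"
    using K mult_le_mono[OF u(3) mult_le_mono[OF T F]] by linarith
  also have "\<dots> = u ^ (1 + (u + Suc (u * u) * u))" by (simp only: power_add power_one_right)
  also have "1 + (u + Suc (u * u) * u) = k" by (simp add: k_def power3_eq_cube)
  also have "u ^ k = X" by (simp add: X_def)
  finally have KX: "K \<le> X" .
  have DX: "fact N \<le> X"
    using D up[of u k] by (simp add: X_def k_def)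
  have uX: "u \<le> X" using up[of 1 k] by (simp add: X_def k_def)
  have u2X: "u * u \<le> X" using up[of 2 k] u by (simp add: X_def k_def power2_eq_square)
  have X4: "4 \<le> X" using uX u by simp
  have "n * n \<le> u * u" using u by (intro mult_le_mono)
  then have nX: "n * n \<le> X" "n \<le> X" "N \<le> X" using u2X u uX by linarith+
  have "K * (2 * fact N + 4 * N + 5) \<le> X * (8 * X)"
    using KX DX nX X4 by (intro mult_le_mono) linarith+
  then have "n * n + n + K + 3 + K * (2 * fact N + 4 * N + 5) \<le> 4 * X + X * (8 * X)"
    using KX nX X4 by linarith
  also have "\<dots> \<le> X * (9 * X)"
  proof -
    have "4 * X \<le> X * X" using X4 by (rule mult_le_mono1)
    then show ?thesis by simp
  qed
  finally have "K * (n * n + n + K + 3 + K * (2 * fact N + 4 * N + 5)) \<le> X * (X * (9 * X))"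
    using KX by (intro mult_le_mono)
  moreover have "2 * fact N + 3 + K \<le> 4 * X" using DX KX X4 by linarith
  moreover have "4 * X \<le> X * (X * X)"
  proof -
    have "4 * X \<le> X * X" using X4 by (rule mult_le_mono1)
    also have "\<dots> \<le> X * (X * X)" using X4 by simp
    finally show ?thesis .
  qed
  moreover have "X * (X * (9 * X)) = 9 * (X * (X * X))" by simp
  ultimately have "2 * fact N + 3 + K + K * (n * n + n + K + 3 + K * (2 * fact N + 4 * N + 5)) \<le>
      10 * (X * (X * X))"
    using \<open>4 * X \<le> X * (X * X)\<close> DX KX X4 by linarith
  \<comment> \<open>The size is cubic in \<open>X\<close>, from \<open>K\<close> rows of
    \<open>K\<close> entries in unary; two more factors \<open>X\<close> absorb the constant
    10.\<close>
  also have "\<dots> \<le> (X * X) * (X * (X * X))"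
  proof (rule mult_le_mono1)
    have "4 * 4 \<le> X * X" using X4 by (intro mult_le_mono)
    then show "10 \<le> X * X" by simp
  qed
  also have "\<dots> = X ^ 5" by (simp add: eval_nat_numeral)
  also have "\<dots> = u ^ (k * 5)" by (simp add: X_def power_mult)
  also have "\<dots> \<le> u ^ (u ^ 5)"
  proof (rule up)
    have a: "16 * u ^ 3 \<le> u ^ 5"
    proof -
      have "4 * 4 \<le> u * u" using u by (intro mult_le_mono)
      then have "16 * u ^ 3 \<le> (u * u) * u ^ 3" by (intro mult_le_mono1) simp
      then show ?thesis by (simp add: eval_nat_numeral)
    qed
    have b: "16 * u \<le> u ^ 3"
    proof -
      have "4 * 4 \<le> u * u" using u by (intro mult_le_mono)
      then have "16 * u \<le> (u * u) * u" by (intro mult_le_mono1) simp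
      then show ?thesis by (simp add: power3_eq_cube)
    qed
    show "k * 5 \<le> u ^ 5" unfolding k_def using a b u by simp
  qed
  finally show ?thesis by (simp add: u_def)
qed

text \<open>Together with \<open>N\<close> being positive this makes \<open>u\<close> at least 4,
  which is how \<open>small_model_bound\<close> absorbs its constants.\<close>

lemma formula_nodes_ge: "3 \<le> nodes (enc_sform \<Phi>)"
  using nodes_pos by (cases \<Phi>) (auto simp: Suc_le_eq enc_int_def)

definition budget :: "nat \<Rightarrow> nat" where
  "budget u = u ^ (u ^ 5)"

lemma accepts_complete:
  fixes C :: "'s mc"
  assumes "granularity_le N C" "is_model C (AG \<Phi>)" "finite_horizons \<Phi>"
  shows "\<exists>c. nodes c \<le> budget (nodes (enc_sform \<Phi>) + N) \<and> accepts \<Phi> N c"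
proof -
  have N: "1 \<le> N" using granularity_pos[OF _ assms(1)] assms(2) by auto
  from small_model[OF assms] obtain K w a b lab where
    st: "stochastic K (fact N) w" and gr: "granular N K (fact N) w a b" and
    K: "K \<le> N * (2 ^ nodes (enc_sform \<Phi>) * (fact N ^ nodes (enc_sform \<Phi>) + 1) ^ nodes (enc_sform \<Phi>))" and
    lab: "\<And>i. i < K \<Longrightarrow> lab i \<subseteq> atoms \<Phi>" and
    sat: "\<And>A i. i < K \<Longrightarrow> sat (matrix_chain A K (fact N) w lab) i \<Phi>"
    by blast
  have fin: "finite (lab i)" if "i < K" for i
    using lab[OF that] atoms_card(1) finite_subset by blast
  show ?thesis
  proof (intro exI conjI)
    show "accepts \<Phi> N (enc_cert K (fact N) w a b lab)"
      by (rule enc_cert_accepted[OF st gr fin assms(3) sat])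
    show "nodes (enc_cert K (fact N) w a b lab) \<le> budget (nodes (enc_sform \<Phi>) + N)"
      unfolding budget_def
      using nodes_enc_cert[where lab = lab, OF st gr lab] small_model_bound[OF formula_nodes_ge N K] by linarith
  qed
qed

section \<open>Running time\<close>

text \<open>Only the last summand, the number of instruction sequences times the cost of one check,
  is doubly exponential.\<close>

definition start_time :: "nat \<Rightarrow> nat" where
  "start_time u = 200 + 50 * u + 360 * (u + 1) ^ 6 + 60 * (u ^ 5 + 1) * (u + 1) ^ (u ^ 5 + 1) +
     2 ^ (budget u + 1) * (check_time (4 * budget u + 1) u + 100)"

definition total_time :: "nat \<Rightarrow> nat" where
  "total_time u = start_time u + 40 * u ^ 2 + 50 * 4 ^ (4 * u + 1) + 20"

lemma check_time_mono: "n \<le> u \<Longrightarrow> check_time B n \<le> check_time B u"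
  unfolding check_time_def sat_time_def
  by (intro add_mono mult_le_mono order_refl power_mono power_increasing order_trans[OF power_increasing power_mono]) auto

lemma spec_main:
  fixes N :: nat
  assumes fh: "finite_horizons \<Phi>"
  defines "u \<equiv> nodes (enc_sform \<Phi>) + N"
  shows "spec 0 (Dot (enc_sform \<Phi>) (enc_nat N))
    (\<lambda>v. v \<noteq> Atom \<longleftrightarrow> (\<exists>ops. length ops \<le> budget u \<and> accepts \<Phi> N (car (run_ops ops Atom)))) (total_time u)"
proof -
  let ?n = "nodes (enc_sform \<Phi>)"
  define hz where "hz = fun_value 7 (enc_sform \<Phi>)"
  define nn where "nn = fun_value 6 (enc_nat N)"
  have hz: "len hz = ?n" and nn: "len nn = N" by (simp_all add: hz_def nn_def)
  let ?z = "Dot (enc_sform \<Phi>) (Dot hz nn)"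
  define U where "U = fun_value 19 (Dot hz nn)"
  have U: "len U = u" by (simp add: U_def hz nn u_def)
  let ?five = "Dot Atom (Dot Atom (Dot Atom (Dot Atom (Dot Atom Atom))))"
  define b where "b = fun_value 3 (Dot U (fun_value 3 (Dot U ?five)))"
  have five: "len ?five = 5" by simp
  have p5: "len (fun_value 3 (Dot U ?five)) = u ^ 5" unfolding pow_len five U ..
  have b: "len b = budget u"
    using pow_len[of U "fun_value 3 (Dot U ?five)"] unfolding p5 U by (simp only: b_def budget_def)
  \<comment> \<open>The empty stack has one node and each of the \<open>budget u\<close>
    instructions adds at most four, whence the size \<open>4 * budget u + 1\<close>.\<close>
  let ?T = "check_time (4 * budget u + 1) ?n"
  have "spec 18 (Dot Atom (Dot b ?z))
      (\<lambda>v. v \<noteq> Atom \<longleftrightarrow> (\<exists>ops. length ops \<le> len b \<and> accepts \<Phi> (len nn) (car (run_ops ops Atom))))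
      ((2 ^ (len b + 1) - 1) * (?T + 100))"
    by (rule spec_search[where B = "4 * budget u + 1", OF spec_check[OF fh hz]]) (simp_all add: b)
  note s = specD[OF this, unfolded b nn]
  have s3: "fun_time 18 (Dot Atom (Dot b ?z)) \<le> 2 ^ (budget u + 1) * (check_time (4 * budget u + 1) u + 100)"
    by (rule order_trans[OF s(3)], rule mult_le_mono) (use check_time_mono[of ?n u] in \<open>auto simp: u_def\<close>)
  have t1: "fun_time 3 (Dot U ?five) \<le> 360 * (u + 1) ^ 6"
    using pow_time[of U ?five] unfolding five U by simp
  have t2: "fun_time 3 (Dot U (fun_value 3 (Dot U ?five))) \<le> 60 * (u ^ 5 + 1) * (u + 1) ^ (u ^ 5 + 1)"
    using pow_time[of U "fun_value 3 (Dot U ?five)"] unfolding p5 U .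
  have t3: "fun_time 19 (Dot hz nn) \<le> 12 * u + 5"
    using app_time[of hz nn] hz by (simp add: u_def)
  have start: "spec 1 ?z
      (\<lambda>v. v \<noteq> Atom \<longleftrightarrow> (\<exists>ops. length ops \<le> budget u \<and> accepts \<Phi> N (car (run_ops ops Atom)))) (start_time u)"
  proof (rule specI)
    show "prog ! 1 = start_body" by simp
    show "expr_halts start_body ?z" using s(1) by (simp add: start_body_def U_def b_def)
    show "(expr_value start_body ?z \<noteq> Atom) =
        (\<exists>ops. length ops \<le> budget u \<and> accepts \<Phi> N (car (run_ops ops Atom)))"
      unfolding s(2)[symmetric] by (simp add: start_body_def U_def b_def)
    have "expr_time start_body ?z \<le> 100 + 2 * fun_time 19 (Dot hz nn) + fun_time 3 (Dot U ?five) +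
        fun_time 3 (Dot U (fun_value 3 (Dot U ?five))) + fun_time 18 (Dot Atom (Dot b ?z))"
      by (simp add: start_body_def U_def b_def)
    then show "expr_time start_body ?z \<le> start_time u"
      unfolding start_time_def using s3 t1 t2 t3 by linarith
  qed
  note st = specD[OF start]
  have t4: "fun_time 7 (enc_sform \<Phi>) \<le> 40 * u ^ 2"
  proof -
    have "?n ^ 2 \<le> u ^ 2" by (rule power_mono) (simp_all add: u_def)
    then show ?thesis using flat_time[of "enc_sform \<Phi>"] by linarith
  qed
  \<comment> \<open>A bit takes at most four nodes including its list cell. Bounding the number of
    bits by \<open>N\<close> is crude but enough for a bound in terms of \<open>N\<close>.\<close>
  have "nodes (enc_nat N) \<le> 4 * N + 1"
  proof -
    have len: "length (nat_bits N) \<le> N"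
    proof (induction N rule: less_induct)
      case (less N)
      show ?case
      proof (cases "N = 0")
        case False
        then have "length (nat_bits N) \<le> Suc (N div 2)"
          using less[of "N div 2"] by (simp add: nat_bits.simps[of N])
        then show ?thesis using False by linarith
      qed (simp add: nat_bits.simps)
    qed
    have "(\<Sum>x\<leftarrow>nat_bits N. nodes (enc_bool x)) \<le> (\<Sum>x\<leftarrow>nat_bits N. 3)"
      by (rule sum_list_mono) (simp add: enc_bool_def)
    then show ?thesis
      using len by (simp add: enc_nat_def nodes_enc_list comp_def sum_list_triv)
  qed
  then have "(4::nat) ^ nodes (enc_nat N) \<le> 4 ^ (4 * u + 1)"
    by (intro power_increasing) (simp_all add: u_def)
  then have t5: "fun_time 6 (enc_nat N) \<le> 50 * 4 ^ (4 * u + 1)"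
    using nat_time[of N] by linarith
  show ?thesis
  proof (rule specI)
    show "prog ! 0 = main_body" by simp
    show "expr_halts main_body (Dot (enc_sform \<Phi>) (enc_nat N))"
      using st(1) by (simp add: main_body_def hz_def nn_def)
    show "(expr_value main_body (Dot (enc_sform \<Phi>) (enc_nat N)) \<noteq> Atom) =
        (\<exists>ops. length ops \<le> budget u \<and> accepts \<Phi> N (car (run_ops ops Atom)))"
      unfolding st(2)[symmetric] by (simp add: main_body_def hz_def nn_def)
    have "expr_time main_body (Dot (enc_sform \<Phi>) (enc_nat N)) \<le> 20 + fun_time 7 (enc_sform \<Phi>) +
        fun_time 6 (enc_nat N) + fun_time 1 ?z"
      by (simp add: main_body_def hz_def nn_def)
    then show "expr_time main_body (Dot (enc_sform \<Phi>) (enc_nat N)) \<le> total_time u"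
      unfolding total_time_def using t4 t5 st(3) by linarith
  qed
qed

section \<open>Growth classes: polynomial, exponential, doubly exponential\<close>

definition poly_bounded :: "(nat \<Rightarrow> nat) \<Rightarrow> bool" where
  "poly_bounded f \<longleftrightarrow> (\<exists>c. \<forall>u. f u \<le> c * (u + 1) ^ c)"
definition exp_bounded :: "(nat \<Rightarrow> nat) \<Rightarrow> bool" where
  "exp_bounded f \<longleftrightarrow> (\<exists>p. poly_bounded p \<and> (\<forall>u. f u \<le> 2 ^ p u))"
definition exp2_bounded :: "(nat \<Rightarrow> nat) \<Rightarrow> bool" where
  "exp2_bounded f \<longleftrightarrow> (\<exists>p. poly_bounded p \<and> (\<forall>u. f u \<le> 2 ^ (2 ^ p u)))"

text \<open>The rules collected here read a polynomial or exponential bound off the syntax of a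
  term, so that no explicit constants have to be carried through \<open>total_time\<close>.\<close>

named_theorems growth

lemma poly_const [growth]: "poly_bounded (\<lambda>u. k)"
  unfolding poly_bounded_def by (rule exI[of _ k]) simp

lemma poly_id [growth]: "poly_bounded (\<lambda>u. u)"
  unfolding poly_bounded_def by (rule exI[of _ 1]) simp

lemma poly_add [growth]:
  assumes "poly_bounded f" "poly_bounded g" shows "poly_bounded (\<lambda>u. f u + g u)"
proof -
  obtain c d where c: "\<And>u. f u \<le> c * (u + 1) ^ c" and d: "\<And>u. g u \<le> d * (u + 1) ^ d"
    using assms by (auto simp: poly_bounded_def)
  have "f u + g u \<le> (c + d) * (u + 1) ^ (c + d)" for u
  proof -
    have "c * (u + 1) ^ c \<le> c * (u + 1) ^ (c + d)" by (intro mult_le_mono2 power_increasing) auto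
    moreover have "d * (u + 1) ^ d \<le> d * (u + 1) ^ (c + d)" by (intro mult_le_mono2 power_increasing) auto
    ultimately show ?thesis using c[of u] d[of u] by (simp only: add_mult_distrib)
  qed
  then show ?thesis unfolding poly_bounded_def by blast
qed

lemma poly_mult [growth]:
  assumes "poly_bounded f" "poly_bounded g" shows "poly_bounded (\<lambda>u. f u * g u)"
proof -
  obtain c d where c: "\<And>u. f u \<le> c * (u + 1) ^ c" and d: "\<And>u. g u \<le> d * (u + 1) ^ d"
    using assms by (auto simp: poly_bounded_def)
  have "f u * g u \<le> (c * d + c + d) * (u + 1) ^ (c * d + c + d)" for u
  proof -
    have "f u * g u \<le> (c * (u + 1) ^ c) * (d * (u + 1) ^ d)" by (rule mult_le_mono[OF c d])
    also have "\<dots> = (c * d) * (u + 1) ^ (c + d)" by (simp add: power_add)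
    also have "\<dots> \<le> (c * d + c + d) * (u + 1) ^ (c * d + c + d)"
      by (intro mult_le_mono power_increasing) auto
    finally show ?thesis .
  qed
  then show ?thesis unfolding poly_bounded_def by blast
qed

lemma poly_pow [growth]: "poly_bounded f \<Longrightarrow> poly_bounded (\<lambda>u. f u ^ k)"
  by (induction k) (auto intro: growth)

lemma exp_of_poly: "poly_bounded f \<Longrightarrow> exp_bounded f"
  unfolding exp_bounded_def by (metis less_exp less_imp_le)

lemma exp_const [growth]: "exp_bounded (\<lambda>u. k)" and exp_id [growth]: "exp_bounded (\<lambda>u. u)"
  by (simp_all add: exp_of_poly growth)

lemma two_power_add_le: "(2::nat) ^ a + 2 ^ b \<le> 2 ^ (a + b + 1)"
proof -
  have "(2::nat) ^ a \<le> 2 ^ (a + b)" "(2::nat) ^ b \<le> 2 ^ (a + b)" by (intro power_increasing; simp)+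
  moreover have "(2::nat) ^ (a + b + 1) = 2 * 2 ^ (a + b)" by simp
  ultimately show ?thesis by linarith
qed

lemma exp_add [growth]:
  assumes "exp_bounded f" "exp_bounded g" shows "exp_bounded (\<lambda>u. f u + g u)"
proof -
  obtain p q where p: "poly_bounded p" "\<And>u. f u \<le> 2 ^ p u" and q: "poly_bounded q" "\<And>u. g u \<le> 2 ^ q u"
    using assms by (auto simp: exp_bounded_def)
  have "f u + g u \<le> 2 ^ (p u + q u + 1)" for u
    using p(2)[of u] q(2)[of u] two_power_add_le[of "p u" "q u"] by linarith
  moreover have "poly_bounded (\<lambda>u. p u + q u + 1)" by (intro growth p q)
  ultimately show ?thesis unfolding exp_bounded_def by blast
qed

lemma exp_mult [growth]:
  assumes "exp_bounded f" "exp_bounded g" shows "exp_bounded (\<lambda>u. f u * g u)"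
proof -
  obtain p q where p: "poly_bounded p" "\<And>u. f u \<le> 2 ^ p u" and q: "poly_bounded q" "\<And>u. g u \<le> 2 ^ q u"
    using assms by (auto simp: exp_bounded_def)
  have "f u * g u \<le> 2 ^ (p u + q u)" for u
    unfolding power_add by (rule mult_le_mono[OF p(2) q(2)])
  moreover have "poly_bounded (\<lambda>u. p u + q u)" by (intro growth p q)
  ultimately show ?thesis unfolding exp_bounded_def by blast
qed

text \<open>A polynomial exponent only multiplies the polynomial \<open>p\<close> in
  \<open>2 ^ p\<close>; this keeps \<open>u ^ (u ^ 5)\<close> singly exponential.\<close>

lemma exp_power [growth]:
  assumes "exp_bounded f" "poly_bounded g" shows "exp_bounded (\<lambda>u. f u ^ g u)"
proof -
  obtain p where p: "poly_bounded p" "\<And>u. f u \<le> 2 ^ p u"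
    using assms by (auto simp: exp_bounded_def)
  have "f u ^ g u \<le> 2 ^ (p u * g u)" for u
    unfolding power_mult by (rule power_mono[OF p(2)]) simp
  moreover have "poly_bounded (\<lambda>u. p u * g u)" by (intro growth p assms)
  ultimately show ?thesis unfolding exp_bounded_def by blast
qed

lemma exp2_of_exp: "exp_bounded f \<Longrightarrow> exp2_bounded f"
  unfolding exp_bounded_def exp2_bounded_def by (metis le_trans less_exp less_imp_le)

lemma exp2_exp: 
  assumes "exp_bounded f" shows "exp2_bounded (\<lambda>u. 2 ^ f u)"
proof -
  obtain p where p: "poly_bounded p" "\<And>u. f u \<le> 2 ^ p u"
    using assms by (auto simp: exp_bounded_def)
  have "2 ^ f u \<le> (2::nat) ^ (2 ^ p u)" for u by (rule power_increasing[OF p(2)]) simp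
  then show ?thesis unfolding exp2_bounded_def using p(1) by blast
qed

lemma exp2_add:
  assumes "exp2_bounded f" "exp2_bounded g" shows "exp2_bounded (\<lambda>u. f u + g u)"
proof -
  obtain p q where p: "poly_bounded p" "\<And>u. f u \<le> 2 ^ (2 ^ p u)"
    and q: "poly_bounded q" "\<And>u. g u \<le> 2 ^ (2 ^ q u)"
    using assms by (auto simp: exp2_bounded_def)
  have "f u + g u \<le> 2 ^ (2 ^ (p u + q u + 2))" for u
  proof -
    have "f u + g u \<le> 2 ^ (2 ^ p u + 2 ^ q u + 1)"
      using p(2)[of u] q(2)[of u] two_power_add_le[of "2 ^ p u" "2 ^ q u"] by linarith
    also have "\<dots> \<le> 2 ^ (2 ^ (p u + q u + 2))"
    proof (rule power_increasing)
      have "(1::nat) \<le> 2 ^ (p u + q u + 1)" by (rule one_le_power) simp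
      moreover have "(2::nat) ^ (p u + q u + 2) = 2 * 2 ^ (p u + q u + 1)" by simp
      ultimately show "2 ^ p u + 2 ^ q u + 1 \<le> (2::nat) ^ (p u + q u + 2)"
        using two_power_add_le[of "p u" "q u"] by linarith
    qed simp
    finally show ?thesis .
  qed
  moreover have "poly_bounded (\<lambda>u. p u + q u + 2)" by (intro growth p q)
  ultimately show ?thesis unfolding exp2_bounded_def by blast
qed

lemma exp2_mult:
  assumes "exp2_bounded f" "exp2_bounded g" shows "exp2_bounded (\<lambda>u. f u * g u)"
proof -
  obtain p q where p: "poly_bounded p" "\<And>u. f u \<le> 2 ^ (2 ^ p u)"
    and q: "poly_bounded q" "\<And>u. g u \<le> 2 ^ (2 ^ q u)"
    using assms by (auto simp: exp2_bounded_def)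
  have "f u * g u \<le> 2 ^ (2 ^ (p u + q u + 1))" for u
  proof -
    have "f u * g u \<le> 2 ^ (2 ^ p u + 2 ^ q u)"
      unfolding power_add by (rule mult_le_mono[OF p(2) q(2)])
    also have "\<dots> \<le> 2 ^ (2 ^ (p u + q u + 1))"
      by (rule power_increasing[OF two_power_add_le]) simp
    finally show ?thesis .
  qed
  moreover have "poly_bounded (\<lambda>u. p u + q u + 1)" by (intro growth p q)
  ultimately show ?thesis unfolding exp2_bounded_def by blast
qed

lemma exp_budget [growth]: "exp_bounded budget"
  unfolding budget_def by (intro growth)

lemma exp2_total_time: "exp2_bounded total_time"
proof -
  have b: "exp_bounded (\<lambda>u. budget u)" using exp_budget by simp
  have c: "exp_bounded (\<lambda>u. check_time (4 * budget u + 1) u + 100)"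
    unfolding check_time_def sat_time_def by (intro growth b)
  have s: "exp_bounded (\<lambda>u. 200 + 50 * u + 360 * (u + 1) ^ 6 + 60 * (u ^ 5 + 1) * (u + 1) ^ (u ^ 5 + 1))"
    by (intro growth)
  have r: "exp_bounded (\<lambda>u. 40 * u ^ 2)" "exp_bounded (\<lambda>u. 50 * 4 ^ (4 * u + 1))" "exp_bounded (\<lambda>u. 20)"
    by (intro growth)+
  have "exp2_bounded (\<lambda>u. 2 ^ (budget u + 1) * (check_time (4 * budget u + 1) u + 100))"
    by (intro exp2_mult exp2_exp growth b exp2_of_exp[OF c])
  from exp2_add[OF exp2_add[OF exp2_add[OF exp2_add[OF exp2_of_exp[OF s] this] exp2_of_exp[OF r(1)]]
        exp2_of_exp[OF r(2)]] exp2_of_exp[OF r(3)]]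
  show ?thesis unfolding total_time_def start_time_def .
qed

lemma exp2_bounded_explicit:
  assumes "exp2_bounded f"
  shows "\<exists>c. \<forall>u. f u \<le> 2 ^ (2 ^ (c * u ^ c + c))"
proof -
  obtain p where p: "poly_bounded p" "\<And>u. f u \<le> 2 ^ (2 ^ p u)"
    using assms by (auto simp: exp2_bounded_def)
  obtain c where c: "\<And>u. p u \<le> c * (u + 1) ^ c" using p(1) by (auto simp: poly_bounded_def)
  \<comment> \<open>For positive \<open>u\<close>, \<open>(u + 1) ^ c\<close> is at most
    \<open>2 ^ c * u ^ c\<close>; the case \<open>u = 0\<close> is covered by the additive
    \<open>d\<close> in the claim.\<close>
  define d where "d = c * 2 ^ c + c"
  have "p u \<le> d * u ^ d + d" for u
  proof (cases "u = 0")
    case True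
    then show ?thesis using c[of 0] by (simp add: d_def)
  next
    case False
    have "(u + 1) ^ c \<le> (2 * u) ^ c" using False by (intro power_mono) auto
    also have "\<dots> = 2 ^ c * u ^ c" by (rule power_mult_distrib)
    also have "\<dots> \<le> 2 ^ c * u ^ d" using False by (intro mult_le_mono2 power_increasing) (auto simp: d_def)
    finally have "c * (u + 1) ^ c \<le> (c * 2 ^ c) * u ^ d" by simp
    also have "\<dots> \<le> d * u ^ d" by (intro mult_le_mono1) (simp add: d_def)
    finally show ?thesis using c[of u] by linarith
  qed
  then have "f u \<le> 2 ^ (2 ^ (d * u ^ d + d))" for u
    by (intro order_trans[OF p(2)] power_increasing) auto
  then show ?thesis by blast
qed

theorem theorem29:
  shows
    "(\<exists>(p :: program) (c :: nat).
        decides_within p enc_instance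
          {(\<Psi>, N). global_window_formula \<Psi>}
          (\<lambda>(\<Psi>, N). \<exists>C :: nat mc. granularity_le N C \<and> is_model C \<Psi>)
          (\<lambda>(\<Psi>, N). 2 ^ (2 ^ (c * (formula_size \<Psi> + N) ^ c + c))))
     \<and> (\<forall>(\<Psi> :: gform) (N :: nat) (C :: 's mc).
          global_window_formula \<Psi> \<longrightarrow> granularity_le N C \<longrightarrow> is_model C \<Psi> \<longrightarrow>
          (\<exists>C' :: nat mc. finite (states C') \<and> granularity_le N C' \<and> is_model C' \<Psi>))"
proof
  \<comment> \<open>The 2 extra steps are those of the outer \<open>Call 0 Param\<close>.\<close>
  obtain c where c: "\<And>u. total_time u + 2 \<le> 2 ^ (2 ^ (c * u ^ c + c))"
    using exp2_bounded_explicit[OF exp2_add[OF exp2_total_time exp2_of_exp[OF exp_const[of 2]]]] by blast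
  show "\<exists>(p :: program) (c :: nat). decides_within p enc_instance {(\<Psi>, N). global_window_formula \<Psi>}
      (\<lambda>(\<Psi>, N). \<exists>C :: nat mc. granularity_le N C \<and> is_model C \<Psi>)
      (\<lambda>(\<Psi>, N). 2 ^ (2 ^ (c * (formula_size \<Psi> + N) ^ c + c)))"
    unfolding decides_within_def
  proof (intro exI[of _ prog] exI[of _ c] ballI)
    fix i :: "gform \<times> nat" assume "i \<in> {(\<Psi>, N). global_window_formula \<Psi>}"
    then obtain \<Phi> N where i: "i = (AG \<Phi>, N)" and fh: "finite_horizons \<Phi>"
      by (cases i rule: enc_instance.cases) (auto simp: window_formula_def)
    let ?u = "formula_size (AG \<Phi>) + N"
    note m = specD[OF spec_main[OF fh, of N], folded formula_size.simps]
    have "expr_halts (Call 0 Param) (enc_instance i)" using m(1) by (simp add: i)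
    from evaluates_expr[OF this]
    have ev: "evaluates prog (enc_instance i) (Call 0 Param) (fun_value 0 (enc_instance i))
        (fun_time 0 (enc_instance i) + 2)" by simp
    have "(\<exists>ops. length ops \<le> budget ?u \<and> accepts \<Phi> N (car (run_ops ops Atom))) \<longleftrightarrow>
        (\<exists>C :: nat mc. granularity_le N C \<and> is_model C (AG \<Phi>))" (is "?l \<longleftrightarrow> ?r")
    proof
      assume ?l
      \<comment> \<open>Soundness: an accepted tree of any size yields a model.\<close>
      then show ?r using accepts_model by blast
    next
      assume ?r
      then obtain C :: "nat mc" where "granularity_le N C" "is_model C (AG \<Phi>)" by blast
      from accepts_complete[OF this fh] obtain t where
        t: "nodes t \<le> budget ?u" "accepts \<Phi> N t" by auto
      \<comment> \<open>Run on the empty stack \<open>Atom\<close>, the sequence that builds the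
        certificate leaves it on top, where \<open>car\<close> finds it.\<close>
      then show ?l using run_ops_build[of t] by (metis car.simps(2))
    qed
    note correct = this
    show "\<exists>v t. evaluates prog (enc_instance i) (Call 0 Param) v t \<and>
        t \<le> (case i of (\<Psi>, N) \<Rightarrow> 2 ^ (2 ^ (c * (formula_size \<Psi> + N) ^ c + c))) \<and>
        (v \<noteq> Atom \<longleftrightarrow> (case i of (\<Psi>, N) \<Rightarrow> \<exists>C :: nat mc. granularity_le N C \<and> is_model C \<Psi>))"
    proof (intro exI conjI, rule ev)
      show "fun_time 0 (enc_instance i) + 2 \<le>
          (case i of (\<Psi>, N) \<Rightarrow> 2 ^ (2 ^ (c * (formula_size \<Psi> + N) ^ c + c)))"
        using m(3) c[of ?u] unfolding i prod.case enc_instance.simps by linarith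
      show "fun_value 0 (enc_instance i) \<noteq> Atom \<longleftrightarrow>
          (case i of (\<Psi>, N) \<Rightarrow> \<exists>C :: nat mc. granularity_le N C \<and> is_model C \<Psi>)"
        using m(2) correct unfolding i prod.case enc_instance.simps by (rule trans)
    qed
  qed
next
  show "\<forall>(\<Psi> :: gform) (N :: nat) (C :: 's mc).
      global_window_formula \<Psi> \<longrightarrow> granularity_le N C \<longrightarrow> is_model C \<Psi> \<longrightarrow>
      (\<exists>C' :: nat mc. finite (states C') \<and> granularity_le N C' \<and> is_model C' \<Psi>)"
  proof (intro allI impI)
    fix \<Psi> :: gform and N :: nat and C :: "'s mc"
    assume "global_window_formula \<Psi>" "granularity_le N C" "is_model C \<Psi>"
    \<comment> \<open>The finite model is the chain read off from an accepted certificate; its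
      states are the indices of the listed states.\<close>
    then show "\<exists>C' :: nat mc. finite (states C') \<and> granularity_le N C' \<and> is_model C' \<Psi>"
      using accepts_complete[of N C] accepts_model
      by (cases \<Psi>) (fastforce simp: window_formula_def)
  qed
qed

end
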